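(* Let $\alpha>0$, $1\le q\le p<\infty$, $1\le s\le\infty$, and let $\mu\ge 0$ be a positive Borel measure on $\mathbb{C}$ such that $\int_{\mathbb{C}}|e^{\alpha z\overline{w}}|\,e^{-\alpha|w|^2}\,d\mu(w)<\infty$ for every $z\in\mathbb{C}$. Then the following statements are equivalent: (1) $T_\mu\in\mathcal{N}(F_\alpha^p,F_\alpha^q)$; (2) $T_\mu\in\mathcal{N}(f_\alpha^\infty,F_\alpha^s)$; (3) $\mu(\mathbb{C})<\infty$. Moreover, $\|T_\mu\|_{\mathcal{N}}\simeq\mu(\mathbb{C})$, where $\|\cdot\|_{\mathcal N}$ is the nuclear norm in $\mathcal{N}(F_\alpha^p,F_\alpha^q)$ or in $\mathcal{N}(f_\alpha^\infty,F_\alpha^s)$.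
   Context: Fock spaces: let $dA$ be Lebesgue area measure on $\mathbb{C}$. For $1\le p<\infty$, $F_\alpha^p$ is the Banach space of entire functions $f$ with $\|f\|_{\alpha,p}^p=\frac{p\alpha}{2\pi}\int_{\mathbb{C}}|f(z)e^{-\frac{\alpha}{2}|z|^2}|^p\,dA(z)<\infty$; $F_\alpha^\infty$ is the Banach space of entire functions with $\|f\|_{\alpha,\infty}=\sup_{z}|f(z)|e^{-\alpha|z|^2/2}<\infty$; $f_\alpha^\infty$ is the closed subspace of $F_\alpha^\infty$ of those $f$ with $\lim_{|z|\to\infty}f(z)e^{-\frac{\alpha}{2}|z|^2}=0$. Toeplitz operators: let $K_\alpha(z,w)=e^{\alpha z\overline{w}}$ and $K_z(w)=e^{\alpha w\overline{z}}$. The Toeplitz operator is $T_\mu f(z)=\frac{\alpha}{\pi}\int_{\mathbb{C}}K_\alpha(z,w)f(w)e^{-\alpha|w|^2}\,d\mu(w)$. Under the stated integrability condition it is well defined on $K=\operatorname{span}\{K_z:z\in\mathbb{C}\}$, which is dense in $F_\alpha^p$ ($1\le p<\infty$) and in $f_\alpha^\infty$. "$T_\mu\in\mathcal{N}(X,Y)$" means that $T_\mu$, defined on $K$, extends to an operator in $\mathcal{N}(X,Y)$. Nuclear operators: for Banach spaces $X,Y$ with dual $X'$, $x'\in X'$ and $y\in Y$, $x'\otimes y$ is the operator $x\mapsto x'(x)y$. $\mathcal{N}(X,Y)$ is the set of bounded linear $T:X\to Y$ of the form $T=\sum_{j\ge1}x_j'\otimes y_j$ with $\sum_j\|x_j'\|_{X'}\|y_j\|_Y<\infty$,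 and $\|T\|_{\mathcal N}$ is the infimum of $\sum_j\|x_j'\|\|y_j\|$ over all such representations. $A\simeq B$ means $c_1B\le A\le c_2B$ for positive constants $c_1,c_2$ (here independent of $\mu$). *)

theory Defs
  imports "HOL-Complex_Analysis.Complex_Analysis" "HOL-Library.Extended_Real"
begin

section \<open>Normed spaces of complex-valued functions\<close>

text \<open>The Fock spaces depend on real parameters, so they cannot be types. A complex normed
  space of functions on \<open>'a\<close> is given by its carrier and its norm; the vector space operations
  are pointwise, and the value of the norm outside the carrier is irrelevant.\<close>

record 'a fun_space =
  carr :: "('a \<Rightarrow> complex) set"
  nrm :: "('a \<Rightarrow> complex) \<Rightarrow> real"

definition bounded_operator ::
  "'a fun_space \<Rightarrow> 'b fun_space \<Rightarrow> (('a \<Rightarrow> complex) \<Rightarrow> ('b \<Rightarrow> complex)) \<Rightarrow> bool"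
where
  "bounded_operator X Y T \<longleftrightarrow>
     (\<forall>f\<in>carr X. T f \<in> carr Y) \<and>
     (\<forall>f\<in>carr X. \<forall>g\<in>carr X. T (\<lambda>z. f z + g z) = (\<lambda>z. T f z + T g z)) \<and>
     (\<forall>c. \<forall>f\<in>carr X. T (\<lambda>z. c * f z) = (\<lambda>z. c * T f z)) \<and>
     (\<exists>C. \<forall>f\<in>carr X. nrm Y (T f) \<le> C * nrm X f)"

definition dual_space :: "'a fun_space \<Rightarrow> (('a \<Rightarrow> complex) \<Rightarrow> complex) set" where
  "dual_space X = {\<phi>.
     (\<forall>f\<in>carr X. \<forall>g\<in>carr X. \<phi> (\<lambda>z. f z + g z) = \<phi> f + \<phi> g) \<and>
     (\<forall>c. \<forall>f\<in>carr X. \<phi> (\<lambda>z. c * f z) = c * \<phi> f) \<and>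
     (\<exists>C. \<forall>f\<in>carr X. norm (\<phi> f) \<le> C * nrm X f)}"

definition dual_norm :: "'a fun_space \<Rightarrow> (('a \<Rightarrow> complex) \<Rightarrow> complex) \<Rightarrow> real" where
  "dual_norm X \<phi> = (SUP f\<in>{f \<in> carr X. nrm X f \<le> 1}. norm (\<phi> f))"


section \<open>Nuclear operators\<close>

text \<open>The equation \<open>T = (\<Sum>j. \<phi> j \<otimes> y j)\<close> is expressed by convergence of the partial sums at each
  \<open>f\<close> in the norm of \<open>Y\<close>. The series converges absolutely in operator norm, so for Banach
  spaces this is the same as equality with the sum in operator norm.\<close>

definition nuclear_rep ::
  "'a fun_space \<Rightarrow> 'b fun_space \<Rightarrow> (('a \<Rightarrow> complex) \<Rightarrow> ('b \<Rightarrow> complex)) \<Rightarrow>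
   (nat \<Rightarrow> ('a \<Rightarrow> complex) \<Rightarrow> complex) \<Rightarrow> (nat \<Rightarrow> 'b \<Rightarrow> complex) \<Rightarrow> bool"
where
  "nuclear_rep X Y T \<phi> y \<longleftrightarrow>
     (\<forall>j. \<phi> j \<in> dual_space X) \<and> (\<forall>j. y j \<in> carr Y) \<and>
     summable (\<lambda>j. dual_norm X (\<phi> j) * nrm Y (y j)) \<and>
     (\<forall>f\<in>carr X. (\<lambda>n. nrm Y (\<lambda>z. T f z - (\<Sum>j<n. \<phi> j f * y j z))) \<longlonglongrightarrow> 0)"

definition nuclear ::
  "'a fun_space \<Rightarrow> 'b fun_space \<Rightarrow> (('a \<Rightarrow> complex) \<Rightarrow> ('b \<Rightarrow> complex)) set"
where
  "nuclear X Y = {T. bounded_operator X Y T \<and> (\<exists>\<phi> y. nuclear_rep X Y T \<phi> y)}"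

definition nuclear_norm ::
  "'a fun_space \<Rightarrow> 'b fun_space \<Rightarrow> (('a \<Rightarrow> complex) \<Rightarrow> ('b \<Rightarrow> complex)) \<Rightarrow> real"
where
  "nuclear_norm X Y T =
     Inf {(\<Sum>j. dual_norm X (\<phi> j) * nrm Y (y j)) | \<phi> y. nuclear_rep X Y T \<phi> y}"


section \<open>Fock spaces\<close>

definition fock_weighted :: "real \<Rightarrow> (complex \<Rightarrow> complex) \<Rightarrow> complex \<Rightarrow> complex" where
  "fock_weighted \<alpha> f z = f z * of_real (exp (- (\<alpha> / 2) * (norm z)\<^sup>2))"

definition fock_fin :: "real \<Rightarrow> real \<Rightarrow> complex fun_space" where
  "fock_fin \<alpha> p =
     \<lparr> carr = {f. f holomorphic_on UNIV \<and>
                  integrable lborel (\<lambda>z. norm (fock_weighted \<alpha> f z) powr p)},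
       nrm = (\<lambda>f. (p * \<alpha> / (2 * pi) * (LINT z|lborel. norm (fock_weighted \<alpha> f z) powr p))
                    powr (1 / p)) \<rparr>"

definition fock_inf :: "real \<Rightarrow> complex fun_space" where
  "fock_inf \<alpha> =
     \<lparr> carr = {f. f holomorphic_on UNIV \<and>
                  bdd_above (range (\<lambda>z. norm (fock_weighted \<alpha> f z)))},
       nrm = (\<lambda>f. SUP z. norm (fock_weighted \<alpha> f z)) \<rparr>"

definition fock :: "real \<Rightarrow> ereal \<Rightarrow> complex fun_space" where
  "fock \<alpha> p = (if p = \<infinity> then fock_inf \<alpha> else fock_fin \<alpha> (real_of_ereal p))"

definition fock_inf0 :: "real \<Rightarrow> complex fun_space" where
  "fock_inf0 \<alpha> =
     \<lparr> carr = {f \<in> carr (fock_inf \<alpha>). (fock_weighted \<alpha> f \<longlongrightarrow> 0) at_infinity},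
       nrm = nrm (fock_inf \<alpha>) \<rparr>"


section \<open>Toeplitz operators\<close>

definition fock_kernel :: "real \<Rightarrow> complex \<Rightarrow> complex \<Rightarrow> complex" where
  "fock_kernel \<alpha> z w = exp (of_real \<alpha> * z * cnj w)"

text \<open>The linear span of the functions \<open>K\<^sub>z = (\<lambda>w. fock_kernel \<alpha> w z)\<close>.\<close>

definition kernel_span :: "real \<Rightarrow> (complex \<Rightarrow> complex) set" where
  "kernel_span \<alpha> =
     {(\<lambda>w. \<Sum>z\<in>A. c z * fock_kernel \<alpha> w z) | A c. finite A}"

definition toeplitz ::
  "real \<Rightarrow> complex measure \<Rightarrow> (complex \<Rightarrow> complex) \<Rightarrow> complex \<Rightarrow> complex"
where
  "toeplitz \<alpha> \<mu> f z = of_real (\<alpha> / pi) *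
     (LINT w|\<mu>. fock_kernel \<alpha> z w * f w * of_real (exp (- \<alpha> * (norm w)\<^sup>2)))"

definition admissible_measure :: "real \<Rightarrow> complex measure \<Rightarrow> bool" where
  "admissible_measure \<alpha> \<mu> \<longleftrightarrow>
     sets \<mu> = sets borel \<and>
     (\<forall>z. (\<integral>\<^sup>+ w. ennreal (norm (fock_kernel \<alpha> z w) * exp (- \<alpha> * (norm w)\<^sup>2)) \<partial>\<mu>) < \<infinity>)"

text \<open>The nuclear operators \<open>X \<rightarrow> Y\<close> extending \<open>T\<^sub>\<mu>\<close> from the span of the kernels. Since this span
  is dense in the spaces \<open>X\<close> of interest, any two of them agree on the carrier of \<open>X\<close>.\<close>

definition nuclear_toeplitz_extensions ::
  "real \<Rightarrow> complex measure \<Rightarrow> complex fun_space \<Rightarrow> complex fun_space \<Rightarrow>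
   ((complex \<Rightarrow> complex) \<Rightarrow> (complex \<Rightarrow> complex)) set"
where
  "nuclear_toeplitz_extensions \<alpha> \<mu> X Y =
     {T \<in> nuclear X Y. \<forall>f\<in>kernel_span \<alpha>. T f = toeplitz \<alpha> \<mu> f}"

end

theory Submission
  imports Defs
begin

text \<open>
  Write \<open>T\<^sub>\<mu> f = \<alpha>/\<pi> \<integral> f(w) exp(-\<alpha>|w|^2) K\<^sub>w d\<mu>(w)\<close>. Evaluation at \<open>w\<close> is a functional of norm at most
  \<open>C exp(\<alpha>|w|^2/2)\<close> on the domain, and \<open>K\<^sub>w\<close> has norm comparable to \<open>exp(\<alpha>|w|^2/2)\<close> in the target,
  so \<open>T\<^sub>\<mu>\<close> is an integral against \<open>\<mu>\<close> of rank one operators of nuclear norm \<open>O(1)\<close>. Both halves of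
  the theorem make this precise with elementary means.

  \<^emph>\<open>Finite measures give nuclear operators.\<close> The integral is turned into a series by cutting the
  plane into countably many cells, each inside a unit disc around some \<open>a\<close>, and by expanding the
  kernel on a cell in powers of the conjugate of \<open>w - a\<close> (\<open>cell_expansion\<close>). The term of order
  \<open>m\<close> is a moment functional over the cell tensored with an atom whose weighted modulus is at most
  \<open>2^(-m)\<close> times a fixed Gaussian around \<open>a\<close>, so the nuclear series of a cell \<open>Q\<close> costs \<open>O(\<mu>(Q))\<close>.
  A superposition of translated Gaussians with summable coefficients is bounded and integrable, and
  therefore lies in every Fock space at once, with a norm estimate (\<open>fock_superposition\<close>); this
  also shows that the remainders of the series tend to 0, as \<open>toeplitz_nuclear_rep\<close> requires.

  \<^emph>\<open>Nuclear operators come from finite measures.\<close> For \<open>T = \<Sum>j. \<phi>\<^sub>j \<otimes> y\<^sub>j\<close> consider the discrete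
  trace \<open>\<Sum>z\<in>A. exp(-\<alpha>|z|^2) (T K\<^sub>z)(z)\<close> over a finite part \<open>A\<close> of the Gaussian integers. It equals
  \<open>\<Sum>j. \<phi>\<^sub>j(\<Sum>z\<in>A. y\<^sub>j(z) exp(-\<alpha>|z|^2) K\<^sub>z)\<close>, and the function inside \<open>\<phi>\<^sub>j\<close>, which samples \<open>y\<^sub>j\<close> on
  \<open>A\<close> and synthesises with kernels, has norm at most \<open>C \<parallel>y\<^sub>j\<parallel>\<close> with \<open>C\<close> independent of \<open>A\<close>
  (\<open>sampling_bounded\<close>). For \<open>F^p \<rightarrow> F^q\<close> this is where \<open>q \<le> p\<close> enters, through
  \<open>\<ell>^q \<subseteq> \<ell>^p\<close>. For \<open>T = T\<^sub>\<mu>\<close> the trace is \<open>\<alpha>/\<pi> \<integral> (\<Sum>z\<in>A. exp(-\<alpha>|z-w|^2)) d\<mu>(w)\<close>, whose integrand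
  is bounded below on the square filled by \<open>A\<close>. Letting \<open>A\<close> grow bounds \<open>\<mu>(\<complex>)\<close> by a
  constant multiple of every nuclear sum of \<open>T\<close>.

  \<^emph>\<open>Uniqueness of the extension.\<close> The upper bound for the nuclear norm concerns an arbitrary
  extension of \<open>T\<^sub>\<mu>\<close> from the span of the kernels, so it must be identified with the integral. A
  bounded functional that kills all \<open>K\<^sub>z\<close> kills the monomials (differentiate in the parameter), then
  the dilates \<open>f(r z)\<close> with \<open>r < 1\<close> (their Taylor series converges in norm), and finally \<open>f\<close> itself
  because \<open>f(r z) \<rightarrow> f\<close> in norm as \<open>r \<rightarrow> 1\<close> (\<open>kernel_span_total\<close>).

  All growth estimates are phrased with the weighted modulus \<open>|f(z)| exp(-\<alpha>|z|^2/2)\<close>, and what the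
  three kinds of Fock spaces have in common is collected in the locale \<open>gaussian_space\<close>.
\<close>

section \<open>Gaussians in the plane\<close>

definition gauss :: "real \<Rightarrow> complex \<Rightarrow> real" where
  "gauss c z = exp (- c * (norm z)\<^sup>2)"

lemma gauss_pos [simp]: "gauss c z > 0" and gauss_nonneg [simp]: "gauss c z \<ge> 0"
  by (simp_all add: gauss_def)

lemma gauss_le_1: "c \<ge> 0 \<Longrightarrow> gauss c z \<le> 1"
  by (simp add: gauss_def)

lemma continuous_on_gauss [continuous_intros]:
  "continuous_on S f \<Longrightarrow> continuous_on S (\<lambda>x. gauss c (f x))"
  unfolding gauss_def by (intro continuous_intros)

lemma borel_measurable_gauss [measurable]: "gauss c \<in> borel_measurable borel"
  by (intro borel_measurable_continuous_onI continuous_intros)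

lemma summable_gaussian_annuli:
  fixes c :: real
  assumes "c > 0"
  shows "summable (\<lambda>n. exp (- c * (real n)\<^sup>2) * (real n + 1)\<^sup>2)"
proof (rule summable_comparison_test')
  show "summable (\<lambda>n. (1 + 4 / c)\<^sup>2 * exp (- c / 2) ^ n)"
    using assms by (intro summable_mult summable_geometric) auto
next
  fix n :: nat
  have "real n + 1 \<le> (1 + 4 / c) * (1 + c * n / 4)"
    using assms by (simp add: field_simps)
  also have "\<dots> \<le> (1 + 4 / c) * exp (c * n / 4)"
    using assms by (intro mult_left_mono exp_ge_add_one_self) auto
  finally have "(real n + 1)\<^sup>2 \<le> ((1 + 4 / c) * exp (c * n / 4))\<^sup>2"
    by (intro power_mono) auto
  also have "\<dots> = (1 + 4 / c)\<^sup>2 * exp (c * n / 2)"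
    by (simp add: power_mult_distrib flip: exp_of_nat_mult)
  finally have 1: "(real n + 1)\<^sup>2 \<le> (1 + 4 / c)\<^sup>2 * exp (c * n / 2)" .
  have "real n \<le> (real n)\<^sup>2"
    by (cases n) (auto simp: power2_eq_square)
  then have 2: "exp (- c * (real n)\<^sup>2) \<le> exp (- c * n)"
    using assms by auto
  have "exp (- c * (real n)\<^sup>2) * (real n + 1)\<^sup>2
      \<le> exp (- c * n) * ((1 + 4 / c)\<^sup>2 * exp (c * n / 2))"
    by (intro mult_mono 1 2) auto
  also have "\<dots> = (1 + 4 / c)\<^sup>2 * (exp (- c * n) * exp (c * n / 2))"
    by (simp add: algebra_simps)
  also have "exp (- c * n) * exp (c * n / 2) = exp (- c / 2) ^ n"
    by (simp add: field_simps flip: exp_of_nat_mult exp_add)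
  finally show "norm (exp (- c * (real n)\<^sup>2) * (real n + 1)\<^sup>2) \<le> (1 + 4 / c)\<^sup>2 * exp (- c / 2) ^ n"
    by simp
qed

text \<open>On the annulus \<open>n \<le> |z| < n + 1\<close> the Gaussian is at most \<open>exp(-c n^2)\<close>, and the disc of radius
  \<open>n + 1\<close> has area \<open>O((n + 1)^2)\<close>.\<close>

lemma integrable_gauss:
  assumes "c > 0"
  shows "integrable lborel (gauss c)"
proof (rule integrableI_bounded)
  define V where "V = unit_ball_vol 2"
  have V: "V \<ge> 0" by (simp add: V_def)
  define u where "u n = V * (exp (- c * (real n)\<^sup>2) * (real n + 1)\<^sup>2)" for n
  have "(\<integral>\<^sup>+z. ennreal (norm (gauss c z)) \<partial>lborel) \<le>
        (\<integral>\<^sup>+(z::complex). (\<Sum>n. ennreal (exp (- c * (real n)\<^sup>2)) * indicator (ball 0 (real n + 1)) z) \<partial>lborel)"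
  proof (intro nn_integral_mono)
    fix z :: complex
    define n where "n = nat \<lfloor>norm z\<rfloor>"
    have "real n = of_int \<lfloor>norm z\<rfloor>"
      by (simp add: n_def of_nat_nat)
    then have n: "real n \<le> norm z" "norm z < real n + 1"
      by linarith+
    define t where "t k = ennreal (exp (- c * (real k)\<^sup>2)) * indicator (ball 0 (real k + 1)) z" for k :: nat
    have "ennreal (norm (gauss c z)) \<le> t n"
      using n assms by (auto simp: gauss_def t_def intro!: ennreal_leI mult_left_mono power_mono)
    also have "t n \<le> (\<Sum>k. t k)"
      using sum_le_suminf[of t "{n}"] by simp
    finally show "ennreal (norm (gauss c z)) \<le>
        (\<Sum>n. ennreal (exp (- c * (real n)\<^sup>2)) * indicator (ball 0 (real n + 1)) z)"
      by (simp add: t_def)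
  qed
  also have "\<dots> = (\<Sum>n. ennreal (u n))"
  proof (subst nn_integral_suminf)
    have "(\<integral>\<^sup>+(z::complex). ennreal (exp (- c * (real n)\<^sup>2)) * indicator (ball 0 (real n + 1)) z \<partial>lborel) = ennreal (u n)" for n
      by (subst nn_integral_cmult_indicator)
         (auto simp: emeasure_ball u_def V_def mult_ac simp flip: ennreal_mult)
    then show "(\<Sum>n. \<integral>\<^sup>+(z::complex). ennreal (exp (- c * (real n)\<^sup>2)) * indicator (ball 0 (real n + 1)) z \<partial>lborel)
      = (\<Sum>n. ennreal (u n))" by simp
  qed (intro borel_measurable_times_ennreal borel_measurable_indicator borel_measurable_const, simp)
  also have "\<dots> < \<infinity>"
    unfolding u_def using summable_gaussian_annuli[OF assms] V
    by (simp add: ennreal_suminf_neq_top less_top[symmetric] summable_mult)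
  finally show "(\<integral>\<^sup>+z. ennreal (norm (gauss c z)) \<partial>lborel) < \<infinity>" .
qed simp

lemma nn_integral_lborel_translate:
  fixes f :: "'a::euclidean_space \<Rightarrow> ennreal"
  assumes "f \<in> borel_measurable borel"
  shows "(\<integral>\<^sup>+x. f (a + x) \<partial>lborel) = (\<integral>\<^sup>+x. f x \<partial>lborel)"
proof -
  have "(\<integral>\<^sup>+x. f x \<partial>lborel) = (\<integral>\<^sup>+x. f x \<partial>distr lborel borel ((+) a))"
    by (simp add: lborel_distr_plus)
  also have "\<dots> = (\<integral>\<^sup>+x. f (a + x) \<partial>lborel)"
    using assms by (subst nn_integral_distr) auto
  finally show ?thesis by simp
qed

lemma integral_lborel_translate:
  fixes f :: "'a::euclidean_space \<Rightarrow> real"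
  assumes "integrable lborel f"
  shows "integrable lborel (\<lambda>x. f (a + x))" "(LINT x|lborel. f (a + x)) = (LINT x|lborel. f x)"
proof -
  have f: "f \<in> borel_measurable borel"
    using borel_measurable_integrable[OF assms] by simp
  have "integrable (distr lborel borel ((+) a)) f"
    using assms by (simp add: lborel_distr_plus)
  then show "integrable lborel (\<lambda>x. f (a + x))"
    using f by (subst (asm) integrable_distr_eq) auto
  have "(LINT x|lborel. f x) = (LINT x|distr lborel borel ((+) a). f x)"
    by (simp add: lborel_distr_plus)
  also have "\<dots> = (LINT x|lborel. f (a + x))"
    using f by (subst integral_distr) auto
  finally show "(LINT x|lborel. f (a + x)) = (LINT x|lborel. f x)" by simp
qed

lemma integral_gauss_translate:
  assumes "c > 0"
  shows "integrable lborel (\<lambda>z. gauss c (z - a))"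
    and "(LINT z|lborel. gauss c (z - a)) = (LINT z|lborel. gauss c z)"
  using integral_lborel_translate[OF integrable_gauss[OF assms], of "- a"] by simp_all

section \<open>Power means from linear bounds\<close>

text \<open>A substitute for Jensen's inequality. Integrating this bound of \<open>t\<close> by \<open>t^p\<close> against any measure and
  optimising in \<open>l\<close> afterwards compares means of \<open>t\<close> with means of \<open>t^p\<close>. It serves for finite sums
  and for integrals alike, and the loss of a factor \<open>2^p\<close> is harmless.\<close>

lemma le_add_scaled_powr:
  fixes t l :: real
  assumes "t \<ge> 0" "l > 0" "p \<ge> 1"
  shows "t \<le> l + l powr (1 - p) * t powr p"
proof (cases "t \<le> l")
  case True
  then show ?thesis by (simp add: add_increasing2)
next
  case False
  have "1 \<le> (t / l) powr (p - 1)"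
    using False assms by (intro ge_one_powr_ge_zero) auto
  then have "t * 1 \<le> t * (t / l) powr (p - 1)"
    using assms by (intro mult_left_mono) auto
  also have "\<dots> = l powr (1 - p) * t powr p"
    using False assms by (simp add: powr_divide powr_diff field_simps)
  finally show ?thesis using assms by simp
qed

lemma powr_le_of_linear_bounds:
  fixes x S W :: real
  assumes "x \<ge> 0" "S > 0" "p \<ge> 1" "W \<ge> 0"
    and bound: "\<And>l. l > 0 \<Longrightarrow> x \<le> l * S + l powr (1 - p) * W"
  shows "x powr p \<le> 2 powr p * S powr (p - 1) * W"
proof (cases "x = 0")
  case True
  then show ?thesis using assms by simp
next
  case False
  then have x: "x > 0" using assms by simp
  \<comment> \<open>this choice lets the term \<open>l * S\<close> absorb half of \<open>x\<close>\<close>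
  define l where "l = x / (2 * S)"
  have l: "l > 0" using x assms by (simp add: l_def)
  have "x \<le> x / 2 + l powr (1 - p) * W"
    using bound[OF l] assms by (simp add: l_def)
  then have "x / 2 * l powr (p - 1) \<le> l powr (1 - p) * W * l powr (p - 1)"
    by (intro mult_right_mono) auto
  also have "\<dots> = W"
    using l by (simp add: mult_ac flip: powr_add mult.assoc)
  finally have "S * l powr p \<le> W"
    using l assms x by (simp add: l_def powr_diff field_simps)
  then have "(2 powr p * S powr (p - 1)) * (S * l powr p) \<le> (2 powr p * S powr (p - 1)) * W"
    by (intro mult_left_mono) auto
  moreover have "(2 powr p * S powr (p - 1)) * (S * l powr p) = x powr p"
    using x assms by (simp add: l_def powr_diff powr_divide powr_mult)
  ultimately show ?thesis by simp
qed

section \<open>A mean value inequality over discs\<close>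

text \<open>Cauchy's formula for \<open>g 0\<close> over a circle that is not centred at 0 but still encloses it. The
  centre is left free so that it can be averaged over a small disc.\<close>

lemma norm_le_integral_shifted_circle:
  assumes g: "g holomorphic_on UNIV" and c: "norm c \<le> 1 / 8"
  shows "ennreal (norm (g 0)) \<le>
    (\<integral>\<^sup>+t. ennreal (2 * norm (g (circlepath c (1/4) t))) * indicator {0..1} t \<partial>lborel)"
proof -
  let ?\<gamma> = "circlepath c (1/4)"
  have cont: "continuous_on A g" for A
    using g holomorphic_on_imp_continuous_on continuous_on_subset by blast
  have cauchy: "((\<lambda>u. g u / (u - 0)) has_contour_integral (2 * of_real pi * \<i> * g 0)) ?\<gamma>"
    by (rule Cauchy_integral_circlepath)
       (use c g in \<open>auto intro: cont holomorphic_on_subset\<close>)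
  let ?h = "\<lambda>t. g (?\<gamma> t) / ?\<gamma> t * vector_derivative ?\<gamma> (at t within {0..1})"
  have hi: "(?h has_integral (2 * of_real pi * \<i> * g 0)) {0..1}"
    using cauchy by (simp add: has_contour_integral_def)
  have cont2: "continuous_on {0..1} (\<lambda>t. 4 * pi * norm (g (?\<gamma> t)))"
    unfolding circlepath by (intro continuous_intros continuous_on_compose2[OF cont[of UNIV]]) auto
  then have int2: "(\<lambda>t. 4 * pi * norm (g (?\<gamma> t))) integrable_on {0..1}"
    by (rule integrable_continuous_real)
  have "norm (integral {0..1} ?h) \<le> integral {0..1} (\<lambda>t. 4 * pi * norm (g (?\<gamma> t)))"
  proof (rule integral_norm_bound_integral)
    show "?h integrable_on {0..1}" using hi by auto
    show "(\<lambda>t. 4 * pi * norm (g (?\<gamma> t))) integrable_on {0..1}" by (rule int2)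
    fix t :: real assume t: "t \<in> {0..1}"
    have *: "?\<gamma> t = c + (1/4) * exp (2 * of_real pi * \<i> * t)"
      by (simp add: circlepath)
    have "norm (?\<gamma> t) \<ge> norm ((1/4) * exp (2 * of_real pi * \<i> * t)) - norm c"
      unfolding * by (metis add.commute norm_diff_ineq)
    then have "norm (?\<gamma> t) \<ge> 1 / 8"
      using c by (simp add: norm_mult)
    then have "norm (g (?\<gamma> t)) * (pi / 2) / norm (?\<gamma> t) \<le> norm (g (?\<gamma> t)) * (pi / 2) / (1 / 8)"
      by (intro divide_left_mono) auto
    moreover have "norm (vector_derivative ?\<gamma> (at t within {0..1})) = pi / 2"
      using t by (simp add: vector_derivative_circlepath01 norm_mult)
    then have "norm (?h t) = norm (g (?\<gamma> t)) * (pi / 2) / norm (?\<gamma> t)"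
      by (simp only: norm_mult norm_divide times_divide_eq_left)
    ultimately show "norm (?h t) \<le> 4 * pi * norm (g (?\<gamma> t))"
      by (simp add: mult_ac)
  qed
  moreover have "integral {0..1} ?h = 2 * of_real pi * \<i> * g 0"
    using hi by (rule integral_unique)
  moreover have "integral {0..1} (\<lambda>t. 4 * pi * norm (g (?\<gamma> t))) 
      = 2 * pi * integral {0..1} (\<lambda>t. 2 * norm (g (?\<gamma> t)))"
    by simp
  ultimately have "norm (g 0) \<le> integral {0..1} (\<lambda>t. 2 * norm (g (?\<gamma> t)))"
    by (simp add: norm_mult)
  moreover have "(\<lambda>t. 2 * norm (g (?\<gamma> t))) integrable_on {0..1}"
    using integrable_cmul[OF int2, of "1 / (2 * pi)"] by simp
  then have "(\<integral>\<^sup>+t. ennreal (2 * norm (g (?\<gamma> t))) * indicator {0..1} t \<partial>lborel)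
       = ennreal (integral {0..1} (\<lambda>t. 2 * norm (g (?\<gamma> t))))"
    by (intro nn_integral_has_integral_lebesgue' integrable_integral) auto
  ultimately show ?thesis by (simp add: ennreal_leI)
qed

text \<open>Averaging the bound on circles over their centres \<open>c\<close> replaces the usual passage to polar
  coordinates: for a fixed angle the points of the circles run through a translate of the disc of
  centres, so Fubini and translation invariance suffice. All points stay within
  \<open>1/8 + 1/4 = 3/8 < 1/2\<close> of 0, so the discs around points at mutual distance at least 1 are
  disjoint.\<close>

lemma norm_le_integral_disc:
  obtains C where "C > 0"
    "\<And>g. g holomorphic_on UNIV \<Longrightarrow>
       norm (g 0) \<le> C * (LINT u|lborel. indicator (cball 0 (3/8)) u * norm (g u))"
proof -
  define V where "V = measure lborel (cball (0::complex) (1/8))"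
  have V: "V > 0" "emeasure lborel (cball (0::complex) (1/8)) = ennreal V"
    by (simp_all add: V_def content_cball_pos emeasure_eq_ennreal_measure emeasure_cball)
  show ?thesis
  proof (rule that[of "2 / V"])
    show "2 / V > 0" using V by simp
    fix g :: "complex \<Rightarrow> complex" assume g: "g holomorphic_on UNIV"
    have cont: "continuous_on UNIV g"
      using g holomorphic_on_imp_continuous_on by blast
    have [measurable]: "g \<in> borel_measurable borel"
      using cont by (rule borel_measurable_continuous_onI)
    define I where "I = (\<integral>\<^sup>+u. ennreal (indicator (cball 0 (3/8)) u * norm (g u)) \<partial>lborel)"
    have int: "integrable lborel (\<lambda>u. indicator (cball 0 (3/8)) u * norm (g u))"
      using borel_integrable_compact[of "cball 0 (3/8)" "\<lambda>u. norm (g u)"] continuous_on_subset[OF cont]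
      by (auto intro!: continuous_intros)
    then have I: "I = ennreal (LINT u|lborel. indicator (cball 0 (3/8)) u * norm (g u))"
      unfolding I_def by (intro nn_integral_eq_integral) auto
    have [measurable]: "cball (0::complex) (1/8) \<in> sets borel" "cball (0::complex) (3/8) \<in> sets borel"
      by simp_all
    have meas: "(\<lambda>u. ennreal (indicator (cball 0 (3/8)) u * norm (g u))) \<in> borel_measurable borel"
      by measurable
    define e where "e t = (1/4) * exp (2 * of_real pi * \<i> * complex_of_real t)" for t
    have [measurable]: "e \<in> borel_measurable borel"
      unfolding e_def by (intro borel_measurable_continuous_onI continuous_intros)
    have "ennreal (norm (g 0)) * ennreal V
        = (\<integral>\<^sup>+(c::complex). ennreal (norm (g 0)) * indicator (cball 0 (1/8)) c \<partial>lborel)"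
      by (subst nn_integral_cmult_indicator) (simp_all add: V)
    also have "\<dots> \<le> (\<integral>\<^sup>+c. (\<integral>\<^sup>+t. indicator (cball 0 (1/8)) c * (ennreal (2 * norm (g (c + e t))) * indicator {0..1} t) \<partial>lborel) \<partial>lborel)"
    proof (rule nn_integral_mono)
      fix c :: complex
      show "ennreal (norm (g 0)) * indicator (cball 0 (1/8)) c \<le>
        (\<integral>\<^sup>+t. indicator (cball 0 (1/8)) c * (ennreal (2 * norm (g (c + e t))) * indicator {0..1} t) \<partial>lborel)"
        using norm_le_integral_shifted_circle[OF g, of c]
        by (auto simp: indicator_def circlepath e_def)
    qed
    also have "\<dots> = (\<integral>\<^sup>+t. (\<integral>\<^sup>+c. indicator (cball 0 (1/8)) c * (ennreal (2 * norm (g (c + e t))) * indicator {0..1} t) \<partial>lborel) \<partial>lborel)"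
      proof (rule lborel_pair.Fubini')
      have "(\<lambda>(t, c). indicator (cball 0 (1/8)) c * (ennreal (2 * norm (g (c + e t))) * indicator {0..1} t))
              \<in> borel_measurable (borel \<Otimes>\<^sub>M borel)"
        by measurable
      then show "(\<lambda>(t, c). indicator (cball 0 (1/8)) c * (ennreal (2 * norm (g (c + e t))) * indicator {0..1} t))
              \<in> borel_measurable (lborel \<Otimes>\<^sub>M lborel)"
        by (simp add: measurable_cong_sets[OF sets_pair_measure_cong[OF sets_lborel sets_lborel] refl])
    qed
    also have "\<dots> \<le> (\<integral>\<^sup>+(t::real). 2 * I * indicator {0..1} t \<partial>lborel)"
    proof (rule nn_integral_mono)
      fix t :: real
      have "(\<integral>\<^sup>+c. indicator (cball 0 (1/8)) c * (ennreal (2 * norm (g (c + e t))) * indicator {0..1} t) \<partial>lborel)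
         \<le> (\<integral>\<^sup>+c. (2 * indicator {0..1} t) * ennreal (indicator (cball 0 (3/8)) (e t + c) * norm (g (e t + c))) \<partial>lborel)"
      proof (rule nn_integral_mono)
        fix c :: complex
        have "norm (e t + c) \<le> 3/8" if "norm c \<le> 1/8"
          using norm_triangle_ineq[of "e t" c] that by (simp add: e_def norm_mult)
        then show "indicator (cball 0 (1/8)) c * (ennreal (2 * norm (g (c + e t))) * indicator {0..1} t)
          \<le> (2 * indicator {0..1} t) * ennreal (indicator (cball 0 (3/8)) (e t + c) * norm (g (e t + c)))"
          by (auto simp: indicator_def ennreal_mult add.commute)
      qed
      also have "\<dots> = 2 * indicator {0..1} t * I"
      proof -
        have "(\<lambda>c. ennreal (indicator (cball 0 (3/8)) (e t + c) * norm (g (e t + c)))) \<in> borel_measurable borel"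
          by (rule measurable_compose[OF _ meas]) simp
        then show ?thesis
          using nn_integral_lborel_translate[OF meas, of "e t"]
          by (subst nn_integral_cmult) (auto simp: I_def)
      qed
      finally show "(\<integral>\<^sup>+c. indicator (cball 0 (1/8)) c * (ennreal (2 * norm (g (c + e t))) * indicator {0..1} t) \<partial>lborel)
         \<le> 2 * I * indicator {0..1} t"
        by (simp add: mult_ac)
    qed
    also have "\<dots> = 2 * I"
      by (subst nn_integral_cmult) auto
    finally have "ennreal (norm (g 0) * V) \<le> ennreal (2 * (LINT u|lborel. indicator (cball 0 (3/8)) u * norm (g u)))"
      using V by (simp add: ennreal_mult I)
    then have "norm (g 0) * V \<le> 2 * (LINT u|lborel. indicator (cball 0 (3/8)) u * norm (g u))"
      by (subst (asm) ennreal_le_iff) (auto intro!: mult_nonneg_nonneg integral_nonneg_AE)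
    then show "norm (g 0) \<le> 2 / V * (LINT u|lborel. indicator (cball 0 (3/8)) u * norm (g u))"
      using V by (simp add: field_simps)
  qed
qed

section \<open>The weighted modulus\<close>

abbreviation wmod :: "real \<Rightarrow> (complex \<Rightarrow> complex) \<Rightarrow> complex \<Rightarrow> real" where
  "wmod \<alpha> f z \<equiv> norm (fock_weighted \<alpha> f z)"

lemma wmod_eq: "wmod \<alpha> f z = norm (f z) * gauss (\<alpha> / 2) z"
  by (simp add: fock_weighted_def gauss_def norm_mult)

lemma wmod_add_le: "wmod \<alpha> (\<lambda>z. f z + g z) z \<le> wmod \<alpha> f z + wmod \<alpha> g z"
  unfolding wmod_eq distrib_right[symmetric] by (intro mult_right_mono norm_triangle_ineq) simp

lemma wmod_scale: "wmod \<alpha> (\<lambda>z. c * f z) z = norm c * wmod \<alpha> f z"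
  by (simp add: wmod_eq norm_mult)

lemma wmod_sum_le:
  "wmod \<alpha> (\<lambda>z. \<Sum>k\<in>A. f k z) z \<le> (\<Sum>k\<in>A. wmod \<alpha> (f k) z)"
  unfolding wmod_eq sum_distrib_right[symmetric] by (intro mult_right_mono norm_sum) simp

lemma norm_le_of_wmod_le:
  assumes "wmod \<alpha> f z \<le> M"
  shows "norm (f z) \<le> M * exp (\<alpha> / 2 * (norm z)\<^sup>2)"
  using assms by (simp add: wmod_eq gauss_def exp_minus field_simps)

lemma continuous_on_entire:
  "f holomorphic_on UNIV \<Longrightarrow> continuous_on A f"
  using holomorphic_on_imp_continuous_on continuous_on_subset by blast

lemma continuous_on_wmod:
  "f holomorphic_on UNIV \<Longrightarrow> continuous_on A (wmod \<alpha> f)"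
  unfolding wmod_eq by (intro continuous_intros continuous_on_entire)

lemma borel_measurable_wmod:
  "f holomorphic_on UNIV \<Longrightarrow> wmod \<alpha> f \<in> borel_measurable borel"
  by (intro borel_measurable_continuous_onI continuous_on_wmod)

lemma integrable_wmod_cball:
  assumes "f holomorphic_on UNIV" "p \<ge> 0"
  shows "integrable lborel (\<lambda>w. indicator (cball z r) w * wmod \<alpha> f w powr p)"
proof -
  have "bounded (wmod \<alpha> f ` cball z r)"
    by (intro compact_imp_bounded compact_continuous_image continuous_on_wmod assms compact_cball)
  then obtain B where B: "\<forall>w\<in>cball z r. wmod \<alpha> f w \<le> B"
    by (auto simp: bounded_iff)
  show ?thesis
  proof (rule integrableI_bounded_set[where A = "cball z r" and B = "B powr p"])
    show "AE w\<in>cball z r in lborel. norm (indicator (cball z r) w * wmod \<alpha> f w powr p) \<le> B powr p"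
      using B assms by (intro AE_I2) (auto simp: indicator_def intro!: powr_mono2)
    show "emeasure lborel (cball z r) < \<infinity>"
      by (rule emeasure_lborel_cball_finite)
  qed (use borel_measurable_wmod[OF assms(1)] in \<open>auto simp: indicator_def\<close>)
qed

lemma norm_add_sqr_complex:
  "(norm (z + u))\<^sup>2 = (norm z)\<^sup>2 + 2 * Re (u * cnj z) + (norm (u::complex))\<^sup>2"
  by (simp only: cmod_power2) (simp add: power2_eq_square algebra_simps)

text \<open>The weight is removed by translating: \<open>h(z + u) exp(-\<alpha> u cnj z)\<close> is entire in \<open>u\<close>, and its modulus
  is the weighted modulus of \<open>h\<close> at \<open>z + u\<close> up to the factors \<open>exp(\<alpha>|z|^2/2)\<close> and
  \<open>exp(\<alpha>|u|^2/2)\<close>, the second of which is bounded on the disc.\<close>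

lemma wmod_le_local_mean:
  assumes "\<alpha> > 0"
  obtains C where "C > 0"
    "\<And>h z. h holomorphic_on UNIV \<Longrightarrow>
       wmod \<alpha> h z \<le> C * (LINT w|lborel. indicator (cball z (3/8)) w * wmod \<alpha> h w)"
proof -
  obtain C where C: "C > 0"
    "\<And>g. g holomorphic_on UNIV \<Longrightarrow>
       norm (g 0) \<le> C * (LINT u|lborel. indicator (cball 0 (3/8)) u * norm (g u))"
    using norm_le_integral_disc by blast
  show ?thesis
  proof (rule that[of "C * exp (\<alpha> / 2)"])
    show "C * exp (\<alpha> / 2) > 0" using C by simp
    fix h :: "complex \<Rightarrow> complex" and z :: complex assume h: "h holomorphic_on UNIV"
    let ?D = "cball z (3/8)"
    define g where "g u = h (z + u) * exp (- of_real \<alpha> * u * cnj z)" for u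
    have g: "g holomorphic_on UNIV"
      unfolding g_def using h
      by (intro holomorphic_intros holomorphic_on_compose_gen[of "\<lambda>u. z + u" UNIV h UNIV, unfolded o_def]) auto
    have int: "integrable lborel (\<lambda>w. indicator ?D w * wmod \<alpha> h w)"
      using integrable_wmod_cball[OF h, of 1] by simp
    have int': "integrable lborel (\<lambda>u. indicator (cball 0 (3/8)) u * norm (g u))"
      using borel_integrable_compact[of "cball 0 (3/8)" "\<lambda>u. norm (g u)"] continuous_on_entire[OF g]
      by (auto intro!: continuous_intros)
    let ?E = "exp (\<alpha> / 2 * (norm z)\<^sup>2)"
    have ng: "norm (g u) = wmod \<alpha> h (z + u) * ?E * exp (\<alpha> / 2 * (norm u)\<^sup>2)" for u
    proof -
      show ?thesis
        using norm_add_sqr_complex[of z u]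
        by (simp add: g_def wmod_eq gauss_def norm_mult algebra_simps flip: exp_add)
    qed
    have "norm (g 0) \<le> C * (LINT u|lborel. indicator (cball 0 (3/8)) u * norm (g u))"
      using C(2)[OF g] .
    also have "\<dots> \<le> C * (LINT u|lborel. ?E * exp (\<alpha> / 2) * (indicator ?D (z + u) * wmod \<alpha> h (z + u)))"
    proof (intro mult_left_mono integral_mono int')
      show "integrable lborel (\<lambda>u. ?E * exp (\<alpha> / 2) * (indicator ?D (z + u) * wmod \<alpha> h (z + u)))"
        using integral_lborel_translate(1)[OF int, of z] by simp
      fix u :: complex
      have "exp (\<alpha> / 2 * (norm u)\<^sup>2) \<le> exp (\<alpha> / 2)" if "norm u \<le> 3/8"
        using assms that abs_le_square_iff[of "norm u" 1] by simp
      then have "wmod \<alpha> h (z + u) * ?E * exp (\<alpha> / 2 * (norm u)\<^sup>2) \<le> wmod \<alpha> h (z + u) * ?E * exp (\<alpha> / 2)"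
        if "norm u \<le> 3/8"
        using that by (intro mult_left_mono) auto
      then show "indicator (cball 0 (3/8)) u * norm (g u) \<le> ?E * exp (\<alpha> / 2) * (indicator ?D (z + u) * wmod \<alpha> h (z + u))"
        unfolding ng by (auto simp: indicator_def dist_norm mult_ac)
    qed (use C in auto)
    also have "\<dots> = C * exp (\<alpha> / 2) * (LINT w|lborel. indicator ?D w * wmod \<alpha> h w) * ?E"
      using integral_lborel_translate(2)[OF int, of z] by simp
    finally show "wmod \<alpha> h z \<le> C * exp (\<alpha> / 2) * (LINT w|lborel. indicator ?D w * wmod \<alpha> h w)"
      using ng[of 0] by simp
  qed
qed

lemma wmod_powr_le_local_mean:
  assumes "\<alpha> > 0" "p \<ge> 1"
  obtains K where "K > 0"
    "\<And>h z. h holomorphic_on UNIV \<Longrightarrow>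
       wmod \<alpha> h z powr p \<le> K * (LINT w|lborel. indicator (cball z (3/8)) w * wmod \<alpha> h w powr p)"
proof -
  obtain C where C: "C > 0"
    "\<And>h z. h holomorphic_on UNIV \<Longrightarrow>
       wmod \<alpha> h z \<le> C * (LINT w|lborel. indicator (cball z (3/8)) w * wmod \<alpha> h w)"
    using wmod_le_local_mean[OF assms(1)] by blast
  define V where "V = measure lborel (cball (0::complex) (3/8))"
  have V: "V > 0" "measure lborel (cball z (3/8)) = V" for z :: complex
    by (simp_all add: V_def content_cball_pos content_cball)
  have D: "integrable lborel (indicator (cball z (3/8)) :: complex \<Rightarrow> real)" for z :: complex
    by (intro integrable_real_indicator) (use emeasure_lborel_cball_finite[of z "3/8"] in auto)
  show ?thesis
  proof (rule that[of "2 powr p * (C * V) powr (p - 1) * C"])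
    show "2 powr p * (C * V) powr (p - 1) * C > 0" using C V by simp
    fix h :: "complex \<Rightarrow> complex" and z :: complex assume h: "h holomorphic_on UNIV"
    let ?I = "LINT w|lborel. indicator (cball z (3/8)) w * wmod \<alpha> h w powr p"
    have int1: "integrable lborel (\<lambda>w. indicator (cball z (3/8)) w * wmod \<alpha> h w)"
      using integrable_wmod_cball[OF h, of 1] by simp
    have intp: "integrable lborel (\<lambda>w. indicator (cball z (3/8)) w * wmod \<alpha> h w powr p)"
      using integrable_wmod_cball[OF h, of p] assms by simp
    have "wmod \<alpha> h z \<le> l * (C * V) + l powr (1 - p) * (C * ?I)" if l: "l > 0" for l
    proof -
      have "wmod \<alpha> h z \<le> C * (LINT w|lborel. indicator (cball z (3/8)) w * wmod \<alpha> h w)"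
        using C(2)[OF h] .
      also have "\<dots> \<le> C * (LINT w|lborel. l * indicator (cball z (3/8)) w
                      + l powr (1 - p) * (indicator (cball z (3/8)) w * wmod \<alpha> h w powr p))"
      proof (intro mult_left_mono integral_mono int1)
        show "integrable lborel (\<lambda>w. l * indicator (cball z (3/8)) w
                      + l powr (1 - p) * (indicator (cball z (3/8)) w * wmod \<alpha> h w powr p))"
          using intp D by simp
        show "indicator (cball z (3/8)) w * wmod \<alpha> h w \<le> l * indicator (cball z (3/8)) w
                      + l powr (1 - p) * (indicator (cball z (3/8)) w * wmod \<alpha> h w powr p)" for w
          using le_add_scaled_powr[OF norm_ge_zero l assms(2), of "fock_weighted \<alpha> h w"]
          by (simp add: indicator_def)
      qed (use C in simp)
      also have "\<dots> = C * (l * V + l powr (1 - p) * ?I)"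
        using intp D V by simp
      finally show ?thesis by (simp add: algebra_simps)
    qed
    then have "wmod \<alpha> h z powr p \<le> 2 powr p * (C * V) powr (p - 1) * (C * ?I)"
      using C V assms by (intro powr_le_of_linear_bounds) (auto intro!: integral_nonneg_AE)
    then show "wmod \<alpha> h z powr p \<le> 2 powr p * (C * V) powr (p - 1) * C * ?I"
      by (simp add: mult_ac)
  qed
qed

lemma le_of_powr_le:
  fixes a b B :: real
  assumes "a powr p \<le> B * b powr p" "a \<ge> 0" "b \<ge> 0" "B \<ge> 0" "p > 0"
  shows "a \<le> B powr (1 / p) * b"
proof -
  have "(a powr p) powr (1 / p) \<le> (B * b powr p) powr (1 / p)"
    using assms by (intro powr_mono2) auto
  then show ?thesis using assms by (simp add: powr_mult powr_powr)
qed

lemma powr_add_le: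
  fixes a b :: real
  assumes "a \<ge> 0" "b \<ge> 0" "p \<ge> 0"
  shows "(a + b) powr p \<le> 2 powr p * (a powr p + b powr p)"
proof -
  have "(a + b) powr p \<le> (2 * max a b) powr p"
    using assms by (intro powr_mono2) auto
  also have "\<dots> = 2 powr p * max a b powr p"
    using assms by (simp add: powr_mult)
  also have "\<dots> \<le> 2 powr p * (a powr p + b powr p)"
    using assms by (intro mult_left_mono) (auto simp: max_def)
  finally show ?thesis .
qed

section \<open>Spaces of entire functions with Gaussian growth\<close>

text \<open>The properties shared by the Fock spaces \<open>F^p\<close>, \<open>F^\<infinity>\<close> and \<open>f^\<infinity>\<close>. There is no triangle
  inequality among them: closedness under addition, the pointwise bound and the last condition, that
  a Gaussian decay of the weighted modulus implies membership with a norm estimate, replace it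
  throughout.\<close>

locale gaussian_space =
  fixes \<alpha> :: real and X :: "complex fun_space"
  assumes alpha_pos: "\<alpha> > 0"
    and entire: "f \<in> carr X \<Longrightarrow> f holomorphic_on UNIV"
    and add_mem: "f \<in> carr X \<Longrightarrow> g \<in> carr X \<Longrightarrow> (\<lambda>z. f z + g z) \<in> carr X"
    and scale_mem: "f \<in> carr X \<Longrightarrow> (\<lambda>z. (c::complex) * f z) \<in> carr X"
    and nrm_nonneg: "f \<in> carr X \<Longrightarrow> nrm X f \<ge> 0"
    and nrm_scale: "f \<in> carr X \<Longrightarrow> nrm X (\<lambda>z. c * f z) = norm c * nrm X f"
    and pointwise: "\<exists>C. \<forall>f\<in>carr X. \<forall>z. wmod \<alpha> f z \<le> C * nrm X f"
    and gaussian_majorant: "d > 0 \<Longrightarrow> \<exists>C. \<forall>h M. h holomorphic_on UNIV \<longrightarrow> M \<ge> 0 \<longrightarrow>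
           (\<forall>z. wmod \<alpha> h z \<le> M * gauss d z) \<longrightarrow> h \<in> carr X \<and> nrm X h \<le> C * M"

text \<open>Interpolation between \<open>L^1\<close> and \<open>L^\<infinity>\<close>: if the weighted modulus is at most \<open>H \<le> M\<close> and \<open>H\<close> has
  integral at most \<open>M\<close>, then its \<open>p\<close>-th power is at most \<open>M^(p-1) H\<close>, with integral at most \<open>M^p\<close>.\<close>

lemma fock_fin_majorant:
  assumes "\<alpha> > 0" "p \<ge> 1" "h holomorphic_on UNIV" "integrable lborel H"
    and "(LINT z|lborel. H z) \<le> M" "\<And>z. wmod \<alpha> h z \<le> H z" "\<And>z. H z \<le> M"
  shows "h \<in> carr (fock_fin \<alpha> p)"
    and "nrm (fock_fin \<alpha> p) h \<le> (p * \<alpha> / (2 * pi)) powr (1 / p) * M"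
proof -
  have M: "M \<ge> 0"
    using norm_ge_zero[of "fock_weighted \<alpha> h 0"] assms(6,7)[of 0] by linarith
  have le: "wmod \<alpha> h z powr p \<le> M powr (p - 1) * H z" for z
  proof (cases "wmod \<alpha> h z = 0")
    case True
    then show ?thesis using assms(6)[of z] assms(2) by simp
  next
    case False
    then have pos: "wmod \<alpha> h z > 0" by simp
    have "wmod \<alpha> h z powr p = wmod \<alpha> h z powr (p - 1) * wmod \<alpha> h z"
      using pos by (simp add: powr_diff)
    also have "\<dots> \<le> M powr (p - 1) * H z"
      using assms(2) assms(6,7)[of z] by (intro mult_mono powr_mono2) (auto intro: order_trans)
    finally show ?thesis .
  qed
  have int: "integrable lborel (\<lambda>z. wmod \<alpha> h z powr p)"
  proof (rule Bochner_Integration.integrable_bound)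
    show "integrable lborel (\<lambda>z. M powr (p - 1) * H z)" using assms by simp
    show "(\<lambda>z. wmod \<alpha> h z powr p) \<in> borel_measurable lborel"
      using borel_measurable_wmod[OF assms(3)] by simp
    show "AE z in lborel. norm (wmod \<alpha> h z powr p) \<le> norm (M powr (p - 1) * H z)"
      by (intro AE_I2) (smt (verit) le norm_of_real powr_ge_zero real_norm_def)
  qed
  show "h \<in> carr (fock_fin \<alpha> p)"
    using int assms(3) by (simp add: fock_fin_def)
  have "(LINT z|lborel. wmod \<alpha> h z powr p) \<le> (LINT z|lborel. M powr (p - 1) * H z)"
    using int assms(4) le by (intro integral_mono) auto
  also have "\<dots> \<le> M powr (p - 1) * M"
    using assms(5) by (auto intro!: mult_left_mono)
  also have "\<dots> = M powr p"
    using M by (cases "M = 0") (auto simp: powr_diff)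
  finally have "p * \<alpha> / (2 * pi) * (LINT z|lborel. wmod \<alpha> h z powr p) \<le> p * \<alpha> / (2 * pi) * M powr p"
    using assms by (intro mult_left_mono) auto
  then have "nrm (fock_fin \<alpha> p) h \<le> (p * \<alpha> / (2 * pi) * M powr p) powr (1 / p)"
    using assms unfolding fock_fin_def
    by (auto intro!: powr_mono2 mult_nonneg_nonneg integral_nonneg_AE)
  also have "\<dots> = (p * \<alpha> / (2 * pi)) powr (1 / p) * M"
    using assms M by (subst powr_mult) (auto simp: powr_powr)
  finally show "nrm (fock_fin \<alpha> p) h \<le> (p * \<alpha> / (2 * pi)) powr (1 / p) * M" .
qed

lemma fock_fin_nrm_powr:
  assumes "\<alpha> > 0" "p \<ge> 1"
  shows "nrm (fock_fin \<alpha> p) f powr p = p * \<alpha> / (2 * pi) * (LINT z|lborel. wmod \<alpha> f z powr p)"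
  using assms unfolding fock_fin_def
  by (simp add: powr_powr integral_nonneg_AE)

lemma fock_fin_gaussian_space:
  assumes "\<alpha> > 0" "p \<ge> 1"
  shows "gaussian_space \<alpha> (fock_fin \<alpha> p)"
proof
  let ?X = "fock_fin \<alpha> p"
  show "\<alpha> > 0" by fact
  show "f holomorphic_on UNIV" if "f \<in> carr ?X" for f
    using that by (simp add: fock_fin_def)
  show "(\<lambda>z. f z + g z) \<in> carr ?X"
    if "f \<in> carr ?X" "g \<in> carr ?X" for f g
  proof -
    have f: "f holomorphic_on UNIV" "integrable lborel (\<lambda>z. wmod \<alpha> f z powr p)"
      and g: "g holomorphic_on UNIV" "integrable lborel (\<lambda>z. wmod \<alpha> g z powr p)"
      using that by (simp_all add: fock_fin_def)
    have h: "(\<lambda>z. f z + g z) holomorphic_on UNIV"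
      using f g by (intro holomorphic_intros)
    have le: "wmod \<alpha> (\<lambda>z. f z + g z) z powr p \<le> 2 powr p * (wmod \<alpha> f z powr p + wmod \<alpha> g z powr p)" for z
    proof -
      have "wmod \<alpha> (\<lambda>z. f z + g z) z powr p \<le> (wmod \<alpha> f z + wmod \<alpha> g z) powr p"
        using wmod_add_le[of \<alpha> f g z] assms by (intro powr_mono2) auto
      also have "\<dots> \<le> 2 powr p * (wmod \<alpha> f z powr p + wmod \<alpha> g z powr p)"
        using assms by (intro powr_add_le) auto
      finally show ?thesis .
    qed
    have "integrable lborel (\<lambda>z. wmod \<alpha> (\<lambda>z. f z + g z) z powr p)"
    proof (rule Bochner_Integration.integrable_bound)
      show "integrable lborel (\<lambda>z. 2 powr p * (wmod \<alpha> f z powr p + wmod \<alpha> g z powr p))"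
        using f g by simp
      show "(\<lambda>z. wmod \<alpha> (\<lambda>z. f z + g z) z powr p) \<in> borel_measurable lborel"
        using borel_measurable_wmod[OF h] by simp
      show "AE z in lborel. norm (wmod \<alpha> (\<lambda>z. f z + g z) z powr p)
              \<le> norm (2 powr p * (wmod \<alpha> f z powr p + wmod \<alpha> g z powr p))"
        using le by (intro AE_I2) simp
    qed
    then show ?thesis using h by (simp add: fock_fin_def)
  qed
  show "(\<lambda>z. c * f z) \<in> carr ?X" if "f \<in> carr ?X" for f c
    using that assms by (auto simp: fock_fin_def wmod_scale powr_mult intro!: holomorphic_intros)
  show "nrm ?X f \<ge> 0" for f
    by (simp add: fock_fin_def)
  show "nrm ?X (\<lambda>z. c * f z) = norm c * nrm ?X f"
    if "f \<in> carr ?X" for f c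
  proof -
    have "nrm ?X (\<lambda>z. c * f z)
       = (norm c powr p * (p * \<alpha> / (2 * pi) * (LINT z|lborel. wmod \<alpha> f z powr p))) powr (1 / p)"
      by (simp add: fock_fin_def wmod_scale powr_mult mult_ac)
    also have "\<dots> = norm c * nrm ?X f"
    proof -
      have "(norm c powr p * Y) powr (1 / p) = norm c * Y powr (1 / p)" if "Y \<ge> 0" for Y :: real
        using assms that by (simp add: powr_mult powr_powr)
      from this[of "p * \<alpha> / (2 * pi) * (LINT z|lborel. wmod \<alpha> f z powr p)"] show ?thesis
        using assms by (simp add: fock_fin_def integral_nonneg_AE)
    qed
    finally show ?thesis .
  qed
  show "\<exists>C. \<forall>f\<in>carr ?X. \<forall>z. wmod \<alpha> f z \<le> C * nrm ?X f"
  proof -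
    obtain K where K: "K > 0"
      "\<And>h z. h holomorphic_on UNIV \<Longrightarrow>
        wmod \<alpha> h z powr p \<le> K * (LINT w|lborel. indicator (cball z (3/8)) w * wmod \<alpha> h w powr p)"
      using wmod_powr_le_local_mean[OF assms] by blast
    define B where "B = K * (2 * pi / (p * \<alpha>))"
    have "wmod \<alpha> f z \<le> B powr (1 / p) * nrm ?X f" if f: "f \<in> carr ?X" for f z
    proof (rule le_of_powr_le)
      have f': "f holomorphic_on UNIV" "integrable lborel (\<lambda>z. wmod \<alpha> f z powr p)"
        using f by (simp_all add: fock_fin_def)
      have "wmod \<alpha> f z powr p \<le> K * (LINT w|lborel. indicator (cball z (3/8)) w * wmod \<alpha> f w powr p)"
        using K(2)[OF f'(1)] .
      also have "\<dots> \<le> K * (LINT w|lborel. wmod \<alpha> f w powr p)"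
        using K(1) f' assms integrable_wmod_cball[OF f'(1), of p z "3/8" \<alpha>]
        by (intro mult_left_mono integral_mono) (auto simp: indicator_def)
      also have "\<dots> = B * nrm ?X f powr p"
        using assms by (simp add: fock_fin_nrm_powr B_def)
      finally show "wmod \<alpha> f z powr p \<le> B * nrm ?X f powr p" .
    qed (use K assms in \<open>auto simp: B_def fock_fin_def\<close>)
    then show ?thesis by blast
  qed
  show "\<exists>C. \<forall>h M. h holomorphic_on UNIV \<longrightarrow> M \<ge> 0 \<longrightarrow> (\<forall>z. wmod \<alpha> h z \<le> M * gauss c z) \<longrightarrow>
          h \<in> carr ?X \<and> nrm ?X h \<le> C * M" if c: "c > 0" for c
  proof -
    define I where "I = max 1 (LINT z|lborel. gauss c z)"
    have "h \<in> carr ?X \<and> nrm ?X h \<le> (p * \<alpha> / (2 * pi)) powr (1 / p) * I * M"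
      if h: "h holomorphic_on UNIV" "M \<ge> 0" "\<forall>z. wmod \<alpha> h z \<le> M * gauss c z" for h M
    proof -
      have "(LINT z|lborel. M * gauss c z) \<le> M * I" "M * gauss c z \<le> M * I" for z
        using h(2) c gauss_le_1[of c z] by (auto simp: I_def intro!: mult_left_mono)
      from fock_fin_majorant[OF assms h(1) _ this(1) _ this(2)] show ?thesis
        using h(3) integrable_gauss[OF c] by (simp add: mult_ac)
    qed
    then show ?thesis by blast
  qed
qed

lemma fock_inf_gaussian_space:
  assumes "\<alpha> > 0"
  shows "gaussian_space \<alpha> (fock_inf \<alpha>)"
proof
  let ?X = "fock_inf \<alpha>"
  have upper: "wmod \<alpha> f z \<le> nrm ?X f" if "f \<in> carr ?X" for f z
    using that unfolding fock_inf_def by (auto intro: cSUP_upper)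
  have least: "nrm ?X f \<le> M" if "\<And>z. wmod \<alpha> f z \<le> M" for f M
    using that unfolding fock_inf_def by (auto intro: cSUP_least)
  have memI: "f \<in> carr ?X" if "f holomorphic_on UNIV" "\<And>z. wmod \<alpha> f z \<le> M" for f M
    using that unfolding fock_inf_def by (auto intro!: bdd_aboveI)
  show "\<alpha> > 0" by fact
  show ent: "f holomorphic_on UNIV" if "f \<in> carr ?X" for f
    using that by (simp add: fock_inf_def)
  show "(\<lambda>z. f z + g z) \<in> carr ?X"
    if "f \<in> carr ?X" "g \<in> carr ?X" for f g
    using ent[OF that(1)] ent[OF that(2)] upper[OF that(1)] upper[OF that(2)]
    by (intro memI[where M = "nrm ?X f + nrm ?X g"] holomorphic_intros)
       (auto intro: order_trans[OF wmod_add_le] add_mono)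
  show scale: "(\<lambda>z. c * f z) \<in> carr ?X" if "f \<in> carr ?X" for f c
    using ent[OF that] upper[OF that]
    by (intro memI[where M = "norm c * nrm ?X f"] holomorphic_intros)
       (auto simp: wmod_scale intro: mult_left_mono)
  show "nrm ?X f \<ge> 0" if "f \<in> carr ?X" for f
    using upper[OF that, of 0] norm_ge_zero order_trans by blast
  show "nrm ?X (\<lambda>z. c * f z) = norm c * nrm ?X f"
    if f: "f \<in> carr ?X" for f c
  proof (rule antisym)
    show "nrm ?X (\<lambda>z. c * f z) \<le> norm c * nrm ?X f"
      using upper[OF f] by (intro least) (auto simp: wmod_scale intro: mult_left_mono)
    show "norm c * nrm ?X f \<le> nrm ?X (\<lambda>z. c * f z)"
    proof (cases "c = 0")
      case True
      then show ?thesis using upper[OF scale[OF f, of c], of 0] by (simp add: wmod_eq)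
    next
      case False
      have "nrm ?X f \<le> nrm ?X (\<lambda>z. c * f z) / norm c"
        using upper[OF scale[OF f, of c]] False by (intro least) (simp add: wmod_scale field_simps)
      then show ?thesis using False by (simp add: field_simps)
    qed
  qed
  show "\<exists>C. \<forall>f\<in>carr ?X. \<forall>z. wmod \<alpha> f z \<le> C * nrm ?X f"
    using upper by (intro exI[of _ 1]) simp
  show "\<exists>C. \<forall>h M. h holomorphic_on UNIV \<longrightarrow> M \<ge> 0 \<longrightarrow> (\<forall>z. wmod \<alpha> h z \<le> M * gauss c z) \<longrightarrow>
          h \<in> carr ?X \<and> nrm ?X h \<le> C * M" if c: "c > 0" for c
  proof (intro exI[of _ 1] allI impI)
    fix h M assume h: "h holomorphic_on UNIV" "M \<ge> (0::real)" "\<forall>z. wmod \<alpha> h z \<le> M * gauss c z"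
    have "wmod \<alpha> h z \<le> M" for z
      using h(2,3) gauss_le_1[of c z] c mult_left_mono[of "gauss c z" 1 M] by (auto intro: order_trans)
    then show "h \<in> carr ?X \<and> nrm ?X h \<le> 1 * M"
      using h(1) by (auto intro: memI least)
  qed
qed

lemma fock_inf_nrm_le:
  "(\<And>z. wmod \<alpha> f z \<le> M) \<Longrightarrow> nrm (fock_inf \<alpha>) f \<le> M"
  unfolding fock_inf_def by (auto intro: cSUP_least)

lemma tendsto_gauss_at_infinity:
  assumes "c > 0"
  shows "(gauss c \<longlongrightarrow> 0) at_infinity"
proof -
  have "filterlim (\<lambda>z. c * (norm z)\<^sup>2) at_top (at_infinity :: complex filter)"
    using assms
    by (intro filterlim_tendsto_pos_mult_at_top[OF tendsto_const] filterlim_pow_at_top filterlim_norm_at_top) auto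
  then have "((\<lambda>z::complex. exp (- (c * (norm z)\<^sup>2))) \<longlongrightarrow> 0) at_infinity"
    by (intro filterlim_compose[OF exp_at_bot] filterlim_compose[OF filterlim_uminus_at_bot_at_top])
  then show ?thesis by (simp add: gauss_def[abs_def])
qed

lemma fock_inf0_gaussian_space:
  assumes "\<alpha> > 0"
  shows "gaussian_space \<alpha> (fock_inf0 \<alpha>)"
proof -
  let ?X = "fock_inf0 \<alpha>"
  interpret I: gaussian_space \<alpha> "fock_inf \<alpha>" using fock_inf_gaussian_space[OF assms] .
  show ?thesis
  proof
    show "\<alpha> > 0" by fact
    have sub: "f \<in> carr (fock_inf \<alpha>)" if "f \<in> carr ?X" for f
      using that by (simp add: fock_inf0_def)
    have nrm: "nrm ?X = nrm (fock_inf \<alpha>)"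
      by (simp add: fock_inf0_def)
    show "f holomorphic_on UNIV" if "f \<in> carr ?X" for f
      by (rule I.entire[OF sub[OF that]])
    show "nrm ?X f \<ge> 0" if "f \<in> carr ?X" for f
      unfolding nrm by (rule I.nrm_nonneg[OF sub[OF that]])
    show "nrm ?X (\<lambda>z. c * f z) = norm c * nrm ?X f"
      if "f \<in> carr ?X" for f c
      unfolding nrm by (rule I.nrm_scale[OF sub[OF that]])
    show "(\<lambda>z. f z + g z) \<in> carr ?X"
      if "f \<in> carr ?X" "g \<in> carr ?X" for f g
      using that I.add_mem tendsto_add_zero[of "fock_weighted \<alpha> f" at_infinity "fock_weighted \<alpha> g"]
      by (auto simp: fock_inf0_def fock_weighted_def[abs_def] algebra_simps)
    show "(\<lambda>z. c * f z) \<in> carr ?X" if "f \<in> carr ?X" for f c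
      using that I.scale_mem tendsto_mult_right_zero[of "fock_weighted \<alpha> f" at_infinity c]
      by (auto simp: fock_inf0_def fock_weighted_def[abs_def] algebra_simps)
    show "\<exists>C. \<forall>f\<in>carr ?X. \<forall>z. wmod \<alpha> f z \<le> C * nrm ?X f"
      using I.pointwise by (auto simp: fock_inf0_def)
    show "\<exists>C. \<forall>h M. h holomorphic_on UNIV \<longrightarrow> M \<ge> 0 \<longrightarrow> (\<forall>z. wmod \<alpha> h z \<le> M * gauss c z) \<longrightarrow>
          h \<in> carr ?X \<and> nrm ?X h \<le> C * M" if c: "c > 0" for c
    proof -
      have lim: "(fock_weighted \<alpha> h \<longlongrightarrow> 0) at_infinity" if "\<forall>z. wmod \<alpha> h z \<le> M * gauss c z" for h M
        by (rule Lim_null_comparison[OF always_eventually[OF that]])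
           (rule tendsto_mult_right_zero[OF tendsto_gauss_at_infinity[OF c]])
      obtain C where C: "\<forall>h M. h holomorphic_on UNIV \<longrightarrow> M \<ge> 0 \<longrightarrow>
         (\<forall>z. wmod \<alpha> h z \<le> M * gauss c z) \<longrightarrow> h \<in> carr (fock_inf \<alpha>) \<and> nrm (fock_inf \<alpha>) h \<le> C * M"
        using I.gaussian_majorant[OF c] ..
      show ?thesis
      proof (intro exI[of _ C] allI impI)
        fix h M assume *: "h holomorphic_on UNIV" "M \<ge> (0::real)" "\<forall>z. wmod \<alpha> h z \<le> M * gauss c z"
        show "h \<in> carr ?X \<and> nrm ?X h \<le> C * M"
          using C[rule_format, OF *[rule_format]] lim[OF *(3)] by (simp add: fock_inf0_def)
      qed
    qed
  qed
qed

lemma fock_cases: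
  assumes "1 \<le> s"
  obtains "fock \<alpha> s = fock_inf \<alpha>" | r where "1 \<le> r" "fock \<alpha> s = fock_fin \<alpha> r"
proof (cases s)
  case (real r)
  then show ?thesis using assms that(2)[of r] by (simp add: fock_def)
qed (use assms that(1) in \<open>auto simp: fock_def\<close>)

lemma fock_gaussian_space:
  assumes "\<alpha> > 0" "1 \<le> s"
  shows "gaussian_space \<alpha> (fock \<alpha> s)"
  using fock_cases[OF assms(2), of \<alpha>] fock_inf_gaussian_space[OF assms(1)] fock_fin_gaussian_space[OF assms(1)]
  by metis

lemma fock_majorant:
  assumes "\<alpha> > 0" "1 \<le> s"
  obtains C where "C > 0"
    "\<And>h H M. h holomorphic_on UNIV \<Longrightarrow> integrable lborel H \<Longrightarrow> (LINT z|lborel. H z) \<le> M \<Longrightarrow>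
       (\<And>z. wmod \<alpha> h z \<le> H z) \<Longrightarrow> (\<And>z. H z \<le> M) \<Longrightarrow> h \<in> carr (fock \<alpha> s) \<and> nrm (fock \<alpha> s) h \<le> C * M"
  using assms(2)
proof (cases rule: fock_cases[where \<alpha> = \<alpha>])
  let ?Y = "fock \<alpha> s"
  case 1
  show ?thesis
  proof (rule that[of 1])
    fix h H M assume *: "h holomorphic_on UNIV" "\<And>z. wmod \<alpha> h z \<le> H z" "\<And>z. H z \<le> (M::real)"
    then have "\<And>z. wmod \<alpha> h z \<le> M" using order_trans by blast
    with *(1) show "h \<in> carr ?Y \<and> nrm ?Y h \<le> 1 * M"
      unfolding 1 by (auto simp: fock_inf_def intro!: cSUP_least bdd_aboveI)
  qed auto
next
  case (2 r)
  show ?thesis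
  proof (rule that[of "(r * \<alpha> / (2 * pi)) powr (1 / r)"])
    show "(r * \<alpha> / (2 * pi)) powr (1 / r) > 0" using assms 2 by auto
  qed (use 2 fock_fin_majorant[OF assms(1) 2(1)] in auto)
qed

section \<open>Superpositions of Gaussian atoms\<close>

lemma entire_superposition:
  assumes "\<And>j. h j holomorphic_on UNIV" "summable b" 
    and "\<And>j z. wmod \<alpha> (h j) z \<le> b j" "\<And>z. (\<lambda>j. h j z) sums f z" "\<alpha> > 0"
  shows "f holomorphic_on UNIV"
proof (rule holomorphic_uniform_sequence[where f = "\<lambda>n z. \<Sum>j<n. h j z"])
  show "(\<lambda>z. \<Sum>j<n. h j z) holomorphic_on UNIV" for n
    using assms(1) by (intro holomorphic_intros)
  fix x :: complex
  let ?R = "exp (\<alpha> / 2 * (norm x + 1)\<^sup>2)"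
  have "uniform_limit (cball x 1) (\<lambda>n z. \<Sum>j<n. h j z) (\<lambda>z. \<Sum>j. h j z) sequentially"
  proof (rule Weierstrass_m_test)
    show "summable (\<lambda>j. b j * ?R)" using assms(2) by (rule summable_mult2)
    fix j z assume "z \<in> cball x 1"
    then have "norm z \<le> norm x + 1"
      using norm_triangle_ineq2[of z x] by (simp add: dist_norm norm_minus_commute)
    then have "exp (\<alpha> / 2 * (norm z)\<^sup>2) \<le> ?R"
      using assms(5) by (auto intro!: mult_left_mono power_mono)
    moreover have "b j \<ge> 0" using assms(3)[of j 0] norm_ge_zero order_trans by blast
    ultimately show "norm (h j z) \<le> b j * ?R"
      using norm_le_of_wmod_le[OF assms(3)[of j z]] by (meson mult_left_mono order_trans)
  qed
  moreover have "(\<lambda>z. \<Sum>j. h j z) = f"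
    using assms(4) by (auto simp: sums_iff)
  ultimately show "\<exists>d>0. cball x d \<subseteq> UNIV \<and> uniform_limit (cball x d) (\<lambda>n z. \<Sum>j<n. h j z) f sequentially"
    by (intro exI[of _ 1]) auto
qed auto

text \<open>The majorant \<open>\<Sum>j. b\<^sub>j exp(-c|z - a\<^sub>j|^2)\<close> is bounded by \<open>\<Sum>j. b\<^sub>j\<close> and its integral is the same
  sum times the mass of one Gaussian. Both bounds are independent of the centres \<open>a\<^sub>j\<close>, so the atoms
  may be spread over the whole plane.\<close>

lemma fock_superposition:
  assumes "\<alpha> > 0" "1 \<le> s" "c > 0"
  obtains C where "C > 0"
    "\<And>h a b f. (\<And>j. h j holomorphic_on UNIV) \<Longrightarrow> summable b \<Longrightarrow>
       (\<And>j z. wmod \<alpha> (h j) z \<le> b j * gauss c (z - a j)) \<Longrightarrow> (\<And>z. (\<lambda>j. h j z) sums f z) \<Longrightarrow>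
       f \<in> carr (fock \<alpha> s) \<and> nrm (fock \<alpha> s) f \<le> C * (\<Sum>j. b j)"
proof -
  let ?Y = "fock \<alpha> s"
  obtain C where C: "C > 0"
    "\<And>h H M. h holomorphic_on UNIV \<Longrightarrow> integrable lborel H \<Longrightarrow> (LINT z|lborel. H z) \<le> M \<Longrightarrow>
       (\<And>z. wmod \<alpha> h z \<le> H z) \<Longrightarrow> (\<And>z. H z \<le> M) \<Longrightarrow> h \<in> carr ?Y \<and> nrm ?Y h \<le> C * M"
    using fock_majorant[OF assms(1,2)] by blast
  define G where "G = (LINT z|lborel. gauss c z)"
  define I where "I = max 1 G"
  have G: "G \<ge> 0" unfolding G_def by (intro integral_nonneg_AE) simp
  show ?thesis
  proof (rule that[of "C * I"])
    show "C * I > 0" using C by (simp add: I_def)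
    fix h :: "nat \<Rightarrow> complex \<Rightarrow> complex" and a b f
    assume h: "\<And>j. h j holomorphic_on UNIV" and b: "summable b"
      and bd: "\<And>j z. wmod \<alpha> (h j) z \<le> b j * gauss c (z - a j)"
      and sums: "\<And>z. (\<lambda>j. h j z) sums f z"
    have b0: "b j \<ge> 0" for j
    proof -
      have "0 \<le> b j * gauss c (0 - a j)" using bd[of j 0] norm_ge_zero order_trans by blast
      then show ?thesis by (meson gauss_pos linorder_not_le mult_neg_pos)
    qed
    have bg: "b j * gauss c (z - a j) \<le> b j" for j z
      using gauss_le_1[of c "z - a j"] b0[of j] assms(3) mult_left_mono[of _ 1 "b j"] by simp
    define H where "H z = (\<Sum>j. b j * gauss c (z - a j))" for z
    have sumH: "summable (\<lambda>j. b j * gauss c (z - a j))" for z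
      using b bg b0 by (intro summable_comparison_test'[OF b]) auto
    have intj: "integrable lborel (\<lambda>z. b j * gauss c (z - a j))"
      "(LINT z|lborel. norm (b j * gauss c (z - a j))) = b j * G" for j
      using integral_gauss_translate[OF assms(3)] b0 by (simp_all add: G_def abs_mult)
    have fol: "f holomorphic_on UNIV"
      by (rule entire_superposition[OF h b _ sums assms(1)]) (use bd bg order_trans in blast)
    have AEs: "AE z in lborel. summable (\<lambda>j. norm (b j * gauss c (z - a j)))"
      using sumH b0 by (intro AE_I2) (simp add: abs_mult)
    have sumI: "summable (\<lambda>j. LINT z|lborel. norm (b j * gauss c (z - a j)))"
      unfolding intj(2) using b by (rule summable_mult2)
    have intH: "integrable lborel H"
      unfolding H_def using intj(1) AEs sumI by (rule integrable_suminf)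
    have "(LINT z|lborel. H z) = (\<Sum>j. LINT z|lborel. b j * gauss c (z - a j))"
      unfolding H_def using intj(1) AEs sumI by (rule integral_suminf)
    also have "\<dots> = (\<Sum>j. b j) * G"
    proof -
      have "(LINT z|lborel. b j * gauss c (z - a j)) = b j * G" for j
        using integral_gauss_translate[OF assms(3)] by (simp add: G_def)
      then show ?thesis using suminf_mult2[OF b, of G] by (simp only:)
    qed
    also have "\<dots> \<le> (\<Sum>j. b j) * I"
      using b0 b by (intro mult_left_mono suminf_nonneg) (auto simp: I_def)
    finally have H1: "(LINT z|lborel. H z) \<le> (\<Sum>j. b j) * I" .
    have H2: "H z \<le> (\<Sum>j. b j) * I" for z
    proof -
      have "H z \<le> (\<Sum>j. b j)" unfolding H_def by (intro suminf_le bg sumH b)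
      also have "\<dots> = (\<Sum>j. b j) * 1" by simp
      also have "\<dots> \<le> (\<Sum>j. b j) * I"
        using b0 b by (intro mult_left_mono suminf_nonneg) (auto simp: I_def)
      finally show ?thesis .
    qed
    have H3: "wmod \<alpha> f z \<le> H z" for z
    proof -
      have ws: "(\<lambda>j. fock_weighted \<alpha> (h j) z) sums fock_weighted \<alpha> f z"
        unfolding fock_weighted_def by (rule sums_mult2[OF sums])
      have sn: "summable (\<lambda>j. wmod \<alpha> (h j) z)"
        by (rule summable_comparison_test'[OF sumH[of z]]) (simp add: bd)
      have "wmod \<alpha> f z = norm (\<Sum>j. fock_weighted \<alpha> (h j) z)"
        using ws by (simp add: sums_iff)
      also have "\<dots> \<le> (\<Sum>j. wmod \<alpha> (h j) z)"
        using sn by (rule summable_norm)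
      also have "\<dots> \<le> H z"
        unfolding H_def by (intro suminf_le bd sn sumH)
      finally show ?thesis .
    qed
    from C(2)[OF fol intH H1 H3 H2]
    show "f \<in> carr ?Y \<and> nrm ?Y f \<le> C * I * (\<Sum>j. b j)"
      by (simp add: mult_ac)
  qed
qed

section \<open>Functionals that vanish on the kernels\<close>

context gaussian_space
begin

lemma zero_mem: "(\<lambda>z. 0) \<in> carr X" and nrm_zero: "nrm X (\<lambda>z. 0) = 0"
proof -
  obtain C where C: "\<forall>h M. h holomorphic_on UNIV \<longrightarrow> M \<ge> 0 \<longrightarrow>
      (\<forall>z. wmod \<alpha> h z \<le> M * gauss 1 z) \<longrightarrow> h \<in> carr X \<and> nrm X h \<le> C * M"
    using gaussian_majorant[of 1] by auto
  have "(\<lambda>z. 0) \<in> carr X \<and> nrm X (\<lambda>z. 0) \<le> C * 0"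
    by (rule C[rule_format]) (auto simp: wmod_eq)
  then show "(\<lambda>z. 0) \<in> carr X" "nrm X (\<lambda>z. 0) = 0"
    using nrm_nonneg[of "\<lambda>z. 0"] by auto
qed

lemma diff_mem: "f \<in> carr X \<Longrightarrow> g \<in> carr X \<Longrightarrow> (\<lambda>z. f z - g z) \<in> carr X"
  using add_mem[OF _ scale_mem[of g "-1"], of f] by simp

lemma sum_mem:
  assumes "\<And>k. k \<in> A \<Longrightarrow> f k \<in> carr X"
  shows "(\<lambda>z. \<Sum>k\<in>A. c k * f k z) \<in> carr X"
  using assms
proof (induction A rule: infinite_finite_induct)
  case (insert x F)
  then show ?case using add_mem[OF scale_mem[of "f x" "c x"]] by simp
qed (auto simp: zero_mem)

lemma dual_add:
  "\<phi> \<in> dual_space X \<Longrightarrow> f \<in> carr X \<Longrightarrow> g \<in> carr X \<Longrightarrow> \<phi> (\<lambda>z. f z + g z) = \<phi> f + \<phi> g"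
  and dual_scale: "\<phi> \<in> dual_space X \<Longrightarrow> f \<in> carr X \<Longrightarrow> \<phi> (\<lambda>z. c * f z) = c * \<phi> f"
  and dual_bounded: "\<phi> \<in> dual_space X \<Longrightarrow> \<exists>C. \<forall>f\<in>carr X. norm (\<phi> f) \<le> C * nrm X f"
  by (auto simp: dual_space_def)

lemma dual_diff:
  assumes "\<phi> \<in> dual_space X" "f \<in> carr X" "g \<in> carr X"
  shows "\<phi> (\<lambda>z. f z - g z) = \<phi> f - \<phi> g"
  using dual_add[OF assms(1,2) scale_mem[OF assms(3), of "-1"]] dual_scale[OF assms(1,3), of "-1"]
  by simp

lemma dual_sum:
  assumes "\<phi> \<in> dual_space X" "\<And>k. k \<in> A \<Longrightarrow> f k \<in> carr X"
  shows "\<phi> (\<lambda>z. \<Sum>k\<in>A. c k * f k z) = (\<Sum>k\<in>A. c k * \<phi> (f k))"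
  using assms(2)
proof (induction A rule: infinite_finite_induct)
  case (insert x F)
  then show ?case
    using dual_add[OF assms(1) scale_mem[of "f x" "c x"] sum_mem[of F f c]] dual_scale[OF assms(1)]
    by simp
qed (use dual_scale[OF assms(1) zero_mem, of 0] in auto)

lemma dual_eq_0_limit:
  assumes "\<phi> \<in> dual_space X" "f \<in> carr X" "\<And>n. g n \<in> carr X" "\<And>n. \<phi> (g n) = 0"
    and "(\<lambda>n. nrm X (\<lambda>z. g n z - f z)) \<longlonglongrightarrow> 0"
  shows "\<phi> f = 0"
proof -
  obtain C where C: "\<And>f. f \<in> carr X \<Longrightarrow> norm (\<phi> f) \<le> C * nrm X f"
    using dual_bounded[OF assms(1)] by blast
  have "norm (\<phi> f) \<le> C * nrm X (\<lambda>z. g n z - f z)" for n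
    using C[OF diff_mem[OF assms(3)[of n] assms(2)]] dual_diff[OF assms(1,3,2), of n] assms(4)[of n]
    by simp
  moreover have "(\<lambda>n. C * nrm X (\<lambda>z. g n z - f z)) \<longlonglongrightarrow> 0"
    using tendsto_mult_left[OF assms(5), of C] by simp
  ultimately have "norm (\<phi> f) \<le> 0"
    by (intro LIMSEQ_le_const) auto
  then show ?thesis by simp
qed

text \<open>The weight beats every function of exponential type, by completing the square in
  \<open>B |z| - \<alpha>/2 |z|^2 \<le> B^2/\<alpha> - \<alpha>/4 |z|^2\<close>. The kernels, the monomials and their products are of this
  type.\<close>

lemma exponential_type_mem:
  obtains C where "C \<ge> 0"
    "\<And>h M. h holomorphic_on UNIV \<Longrightarrow> M \<ge> 0 \<Longrightarrow> (\<And>w. norm (h w) \<le> M * exp (B * norm w)) \<Longrightarrow>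
       h \<in> carr X \<and> nrm X h \<le> C * M"
proof -
  have "\<alpha> / 4 > 0" using alpha_pos by simp
  from gaussian_majorant[OF this] obtain C where C: "\<forall>h M. h holomorphic_on UNIV \<longrightarrow> M \<ge> 0 \<longrightarrow>
      (\<forall>z. wmod \<alpha> h z \<le> M * gauss (\<alpha> / 4) z) \<longrightarrow> h \<in> carr X \<and> nrm X h \<le> C * M" ..
  show ?thesis
  proof (rule that[of "\<bar>C\<bar> * exp (B\<^sup>2 / \<alpha>)"])
    fix h M assume h: "h holomorphic_on UNIV" "M \<ge> (0::real)" "\<And>w. norm (h w) \<le> M * exp (B * norm w)"
    have "wmod \<alpha> h z \<le> M * exp (B\<^sup>2 / \<alpha>) * gauss (\<alpha> / 4) z" for z
    proof -
      have "0 \<le> (\<alpha> * norm z / 2 - B)\<^sup>2 / \<alpha>" using alpha_pos by simp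
      also have "\<dots> = \<alpha> / 4 * (norm z)\<^sup>2 - B * norm z + B\<^sup>2 / \<alpha>"
        using alpha_pos by (simp add: power2_eq_square field_simps)
      finally have le: "B * norm z - \<alpha> / 2 * (norm z)\<^sup>2 \<le> B\<^sup>2 / \<alpha> - \<alpha> / 4 * (norm z)\<^sup>2"
        by (simp add: field_simps)
      have "wmod \<alpha> h z \<le> M * exp (B * norm z) * gauss (\<alpha> / 2) z"
        unfolding wmod_eq by (intro mult_right_mono h(3)) simp
      also have "\<dots> = M * exp (B * norm z - \<alpha> / 2 * (norm z)\<^sup>2)"
        by (simp add: gauss_def algebra_simps flip: exp_add)
      also have "\<dots> \<le> M * exp (B\<^sup>2 / \<alpha> - \<alpha> / 4 * (norm z)\<^sup>2)"
        using le h(2) by (intro mult_left_mono) auto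
      also have "\<dots> = M * exp (B\<^sup>2 / \<alpha>) * gauss (\<alpha> / 4) z"
        by (simp add: gauss_def algebra_simps flip: exp_add)
      finally show ?thesis .
    qed
    then have "h \<in> carr X \<and> nrm X h \<le> C * (M * exp (B\<^sup>2 / \<alpha>))"
      using h by (intro C[rule_format]) auto
    moreover have "C * (M * exp (B\<^sup>2 / \<alpha>)) \<le> \<bar>C\<bar> * (M * exp (B\<^sup>2 / \<alpha>))"
      using h by (intro mult_right_mono) auto
    ultimately show "h \<in> carr X \<and> nrm X h \<le> \<bar>C\<bar> * exp (B\<^sup>2 / \<alpha>) * M"
      by (simp add: mult_ac)
  qed simp
qed

lemma monomial_exp_bound:
  fixes t w :: complex
  shows "norm (w ^ n * exp (of_real \<alpha> * t * w)) \<le> fact n * exp ((1 + \<alpha> * norm t) * norm w)"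
proof -
  have "norm w ^ n / fact n \<le> exp (norm w)"
  proof -
    have "(\<Sum>k\<in>{n}. norm w ^ k /\<^sub>R fact k) \<le> exp (norm w)"
      unfolding exp_def by (intro sum_le_suminf summable_exp_generic) auto
    then show ?thesis by (simp add: field_simps)
  qed
  then have 1: "norm w ^ n \<le> fact n * exp (norm w)"
    by (simp add: field_simps)
  have "Re (of_real \<alpha> * t * w) \<le> norm (of_real \<alpha> * t * w)" by (rule complex_Re_le_cmod)
  also have "\<dots> = \<alpha> * norm t * norm w" using alpha_pos by (simp add: norm_mult)
  finally have 2: "norm (exp (of_real \<alpha> * t * w)) \<le> exp (\<alpha> * norm t * norm w)" by simp
  have "norm (w ^ n * exp (of_real \<alpha> * t * w)) \<le> (fact n * exp (norm w)) * exp (\<alpha> * norm t * norm w)"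
    unfolding norm_mult norm_power by (intro mult_mono 1 2) auto
  then show ?thesis by (simp add: algebra_simps exp_add)
qed

lemma monomial_exp_mem: "(\<lambda>w. w ^ n * exp (of_real \<alpha> * t * w)) \<in> carr X"
proof -
  obtain C where C: "\<And>h M. h holomorphic_on UNIV \<Longrightarrow> M \<ge> 0 \<Longrightarrow>
      (\<And>w. norm (h w) \<le> M * exp ((1 + \<alpha> * norm t) * norm w)) \<Longrightarrow> h \<in> carr X \<and> nrm X h \<le> C * M"
    using exponential_type_mem[of "1 + \<alpha> * norm t"] by metis
  have hol: "(\<lambda>w. w ^ n * exp (of_real \<alpha> * t * w)) holomorphic_on UNIV"
    by (intro holomorphic_intros)
  show ?thesis
    using C[OF hol fact_ge_zero monomial_exp_bound] ..
qed

lemma fock_kernel_eq: "fock_kernel \<alpha> w z = exp (of_real \<alpha> * cnj z * w)"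
  by (simp add: fock_kernel_def mult_ac)

lemma kernel_mem: "(\<lambda>w. fock_kernel \<alpha> w z) \<in> carr X"
  using monomial_exp_mem[of 0 "cnj z"] by (simp add: fock_kernel_eq)

lemma kernel_combination_in_span:
  "finite A \<Longrightarrow> (\<lambda>w. \<Sum>z\<in>A. c z * fock_kernel \<alpha> w z) \<in> kernel_span \<alpha>"
  by (auto simp: kernel_span_def)

lemma kernel_in_span: "(\<lambda>w. fock_kernel \<alpha> w z) \<in> kernel_span \<alpha>"
  using kernel_combination_in_span[of "{z}" "\<lambda>_. 1"] by simp

text \<open>Induction on \<open>n\<close>, simultaneously for all \<open>t\<close>: up to the factor \<open>\<alpha>\<close>, the function with exponent
  \<open>n + 1\<close> is the derivative in \<open>t\<close> of the one with exponent \<open>n\<close>. The difference quotients converge in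
  norm because their error is \<open>O(\<epsilon>)\<close> times a fixed function of exponential type.\<close>

lemma dual_monomial_exp_eq_0:
  assumes \<phi>: "\<phi> \<in> dual_space X" "\<And>f. f \<in> kernel_span \<alpha> \<Longrightarrow> \<phi> f = 0"
  shows "\<phi> (\<lambda>w. w ^ n * exp (of_real \<alpha> * t * w)) = 0"
proof (induction n arbitrary: t)
  case 0
  have "(\<lambda>w. exp (of_real \<alpha> * t * w)) \<in> kernel_span \<alpha>"
    using kernel_in_span[of "cnj t"] by (simp add: fock_kernel_eq)
  then show ?case using \<phi>(2) by simp
next
  case (Suc n)
  define g where "g n t w = w ^ n * exp (of_real \<alpha> * t * w)" for n :: nat and t w :: complex
  have g_mem: "g n t \<in> carr X" for n t
    using monomial_exp_mem[of n t] by (simp add: g_def[abs_def])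
  define B where "B = 1 + \<alpha> * norm t + \<alpha>"
  obtain C where C: "C \<ge> 0" "\<And>h M. h holomorphic_on UNIV \<Longrightarrow> M \<ge> 0 \<Longrightarrow>
      (\<And>w. norm (h w) \<le> M * exp (B * norm w)) \<Longrightarrow> h \<in> carr X \<and> nrm X h \<le> C * M"
    using exponential_type_mem[of B] by metis
  define e where "e k = inverse (real (Suc k))" for k
  have e: "0 < e k" "e k \<le> 1" for k by (auto simp: e_def inverse_le_1_iff)
  define u where "u k w = inverse (of_real (\<alpha> * e k)) * (g n (t + of_real (e k)) w - g n t w)" for k w
  have u_mem: "u k \<in> carr X" for k
    unfolding u_def[abs_def] by (intro scale_mem diff_mem g_mem)
  have "\<phi> (g (Suc n) t) = 0"
  proof (rule dual_eq_0_limit[OF \<phi>(1) g_mem u_mem])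
    show "\<phi> (u k) = 0" for k
      using Suc.IH[of t] Suc.IH[of "t + of_real (e k)"]
        dual_scale[OF \<phi>(1) diff_mem[OF g_mem[of n "t + of_real (e k)"] g_mem[of n t]]]
        dual_diff[OF \<phi>(1) g_mem[of n "t + of_real (e k)"] g_mem[of n t]]
      by (simp add: u_def[abs_def] g_def[abs_def])
    define M where "M = \<alpha> * fact (n + 2)"
    have bound: "norm (u k w - g (Suc n) t w) \<le> (M * e k) * exp (B * norm w)" for k w
    proof -
      define x where "x = of_real \<alpha> * of_real (e k) * w"
      have x: "x \<noteq> 0 \<longleftrightarrow> w \<noteq> 0" "norm x = \<alpha> * e k * norm w"
        using alpha_pos e[of k] by (auto simp: x_def norm_mult)
      have "u k w - g (Suc n) t w = inverse (of_real (\<alpha> * e k)) * g n t w * (exp x - (1 + x))"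
        using alpha_pos e[of k]
        by (simp add: u_def g_def x_def exp_add algebra_simps)
      also have "norm \<dots> \<le> inverse (\<alpha> * e k) * norm (g n t w) * (exp (\<alpha> * norm w) * (norm x)\<^sup>2)"
      proof -
        have "norm (exp x - (1 + x)) \<le> exp \<bar>Re x\<bar> * (norm x)\<^sup>2"
          using Taylor_exp[of x 1] by (simp add: numeral_2_eq_2)
        moreover have "\<bar>Re x\<bar> \<le> \<alpha> * norm w"
        proof -
          have "\<bar>Re x\<bar> \<le> norm x" by (rule abs_Re_le_cmod)
          also have "\<dots> \<le> \<alpha> * 1 * norm w"
            unfolding x(2) using alpha_pos e[of k] by (intro mult_right_mono mult_left_mono) auto
          finally show ?thesis by simp
        qed
        ultimately have "norm (exp x - (1 + x)) \<le> exp (\<alpha> * norm w) * (norm x)\<^sup>2"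
          by (meson exp_le_cancel_iff mult_right_mono order_trans zero_le_power2)
        moreover have "norm (inverse (complex_of_real (\<alpha> * e k))) = inverse (\<alpha> * e k)"
          using alpha_pos e[of k] by (simp add: norm_inverse norm_mult)
        ultimately show ?thesis
          unfolding norm_mult using alpha_pos e[of k] by (auto intro!: mult_left_mono)
      qed
      also have "\<dots> = \<alpha> * e k * (norm (g (n + 2) t w) * exp (\<alpha> * norm w))"
        using alpha_pos e[of k] unfolding x(2)
        by (simp add: g_def norm_mult norm_power field_simps power2_eq_square)
      also have "\<dots> \<le> \<alpha> * e k * (fact (n + 2) * exp ((1 + \<alpha> * norm t) * norm w) * exp (\<alpha> * norm w))"
        using alpha_pos e[of k] monomial_exp_bound[of w "n + 2" t]
        by (intro mult_left_mono mult_right_mono) (auto simp: g_def)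
      also have "\<dots> = (M * e k) * exp (B * norm w)"
        by (simp add: M_def B_def exp_add algebra_simps)
      finally show ?thesis .
    qed
    have le: "nrm X (\<lambda>w. u k w - g (Suc n) t w) \<le> C * (M * e k)" for k
      using C(2)[OF _ _ bound[of k]] entire[OF diff_mem[OF u_mem g_mem]] alpha_pos e[of k]
      by (auto simp: M_def)
    have "(\<lambda>k. C * (M * e k)) \<longlonglongrightarrow> C * (M * 0)"
      unfolding e_def by (intro tendsto_intros LIMSEQ_inverse_real_of_nat)
    then have lim: "(\<lambda>k. C * (M * e k)) \<longlonglongrightarrow> 0" by simp
    show "(\<lambda>k. nrm X (\<lambda>w. u k w - g (Suc n) t w)) \<longlonglongrightarrow> 0"
      by (rule tendsto_sandwich[OF _ _ tendsto_const lim])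
         (use le nrm_nonneg[OF diff_mem[OF u_mem g_mem]] in auto)
  qed
  then show ?case by (simp add: g_def[abs_def])
qed

lemma taylor_coefficient_bound:
  assumes "f holomorphic_on UNIV" "\<And>z. wmod \<alpha> f z \<le> M" "\<rho> > 0"
  shows "norm ((deriv ^^ n) f 0 / fact n) * \<rho> ^ n \<le> M * exp (\<alpha> / 2 * \<rho>\<^sup>2)"
proof -
  have "norm ((deriv ^^ n) f 0) \<le> fact n * (M * exp (\<alpha> / 2 * \<rho>\<^sup>2)) / \<rho> ^ n"
  proof (rule Cauchy_inequality)
    show "norm (f x) \<le> M * exp (\<alpha> / 2 * \<rho>\<^sup>2)" if "norm (0 - x) = \<rho>" for x
      using norm_le_of_wmod_le[OF assms(2)[of x]] that by simp
  qed (use assms in \<open>auto intro: holomorphic_on_subset continuous_on_entire\<close>)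
  then show ?thesis using assms by (simp add: norm_divide field_simps)
qed

lemma dilation_mem:
  assumes "f \<in> carr X" "0 < r" "r < 1"
  shows "(\<lambda>z. f (of_real r * z)) \<in> carr X"
proof -
  obtain M where M: "\<And>z. wmod \<alpha> f z \<le> M"
    using pointwise assms(1) by blast
  define d where "d = \<alpha> / 2 * (1 - r\<^sup>2)"
  have d: "d > 0" using assms alpha_pos by (simp add: d_def abs_square_less_1)
  have "M \<ge> 0" using M[of 0] norm_ge_zero order_trans by blast
  have hol: "(\<lambda>z. f (of_real r * z)) holomorphic_on UNIV"
    using entire[OF assms(1)]
    by (intro holomorphic_on_compose_gen[of "\<lambda>z. of_real r * z" UNIV f UNIV, unfolded o_def] holomorphic_intros) auto
  have "wmod \<alpha> (\<lambda>z. f (of_real r * z)) z \<le> M * gauss d z" for z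
  proof -
    have "norm (f (of_real r * z)) \<le> M * exp (\<alpha> / 2 * (norm (of_real r * z))\<^sup>2)"
      by (rule norm_le_of_wmod_le[OF M])
    then have "wmod \<alpha> (\<lambda>z. f (of_real r * z)) z \<le> M * exp (\<alpha> / 2 * (norm (of_real r * z))\<^sup>2) * gauss (\<alpha> / 2) z"
      unfolding wmod_eq by (intro mult_right_mono) auto
    also have "\<dots> = M * gauss d z"
      using assms by (simp add: gauss_def d_def norm_mult power_mult_distrib algebra_simps flip: exp_add)
    finally show ?thesis .
  qed
  with gaussian_majorant[OF d] hol \<open>M \<ge> 0\<close> show ?thesis by blast
qed

text \<open>Cauchy's estimate on the circle of radius \<open>t |z|\<close> with \<open>r < t < 1\<close> bounds the \<open>n\<close>-th Taylor term
  of \<open>f(r z)\<close> by \<open>(r/t)^n exp(\<alpha>/2 t^2 |z|^2)\<close>. The terms decay geometrically, and since \<open>t < 1\<close> a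
  Gaussian remains after multiplication with the weight, so the Taylor series converges in norm.\<close>

lemma dual_dilation_eq_0:
  assumes \<phi>: "\<phi> \<in> dual_space X" "\<And>f. f \<in> kernel_span \<alpha> \<Longrightarrow> \<phi> f = 0"
    and f: "f \<in> carr X" and r: "0 < r" "r < 1"
  shows "\<phi> (\<lambda>z. f (of_real r * z)) = 0"
proof -
  have hol: "f holomorphic_on UNIV" using entire[OF f] .
  obtain M where M: "\<And>z. wmod \<alpha> f z \<le> M"
    using pointwise f by blast
  have M0: "M \<ge> 0" using M[of 0] norm_ge_zero order_trans by blast
  define t where "t = (1 + r) / 2"
  have t: "r < t" "0 < t" "t < 1" using r by (auto simp: t_def)
  define q where "q = r / t"
  have q: "0 < q" "q < 1" using r t by (auto simp: q_def)
  define d where "d = \<alpha> / 2 * (1 - t\<^sup>2)"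
  have d: "d > 0" using t alpha_pos by (simp add: d_def abs_square_less_1)
  obtain C where C: "\<forall>h M. h holomorphic_on UNIV \<longrightarrow> M \<ge> 0 \<longrightarrow>
      (\<forall>z. wmod \<alpha> h z \<le> M * gauss d z) \<longrightarrow> h \<in> carr X \<and> nrm X h \<le> C * M"
    using gaussian_majorant[OF d] ..
  define a where "a n = (deriv ^^ n) f 0 / fact n" for n
  define s where "s N z = (\<Sum>n<N. (a n * of_real r ^ n) * z ^ n)" for N z
  have mono: "(\<lambda>z. z ^ n) \<in> carr X" "\<phi> (\<lambda>z. z ^ n) = 0" for n
    using monomial_exp_mem[of n 0] dual_monomial_exp_eq_0[OF \<phi>, of n 0] by simp_all
  have s_mem: "s N \<in> carr X" for N
    unfolding s_def[abs_def] by (intro sum_mem mono)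
  have fr_mem: "(\<lambda>z. f (of_real r * z)) \<in> carr X"
    using dilation_mem[OF f r] .
  have term_le: "norm ((a n * of_real r ^ n) * z ^ n) \<le> M * q ^ n * exp (\<alpha> / 2 * t\<^sup>2 * (norm z)\<^sup>2)" for n z
  proof (cases "z = 0")
    case False
    have "norm (a n) * (t * norm z) ^ n \<le> M * exp (\<alpha> / 2 * (t * norm z)\<^sup>2)"
      unfolding a_def using False t by (intro taylor_coefficient_bound hol M) auto
    then have "q ^ n * (norm (a n) * (t * norm z) ^ n) \<le> q ^ n * (M * exp (\<alpha> / 2 * (t * norm z)\<^sup>2))"
      using q by (intro mult_left_mono) auto
    moreover have "q ^ n * (norm (a n) * (t * norm z) ^ n) = norm ((a n * of_real r ^ n) * z ^ n)"
      using r t by (simp add: q_def norm_mult norm_power power_mult_distrib power_divide)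
    ultimately show ?thesis by (simp add: power_mult_distrib mult_ac)
  next
    case True
    have "norm (f 0) \<le> M" using norm_le_of_wmod_le[OF M, of 0] by simp
    then show ?thesis using True M0 q by (cases n) (auto simp: a_def)
  qed
  show "\<phi> (\<lambda>z. f (of_real r * z)) = 0"
  proof (rule dual_eq_0_limit[OF \<phi>(1) fr_mem s_mem])
    show "\<phi> (s N) = 0" for N
      using dual_sum[OF \<phi>(1), of "{..<N}" "\<lambda>n z. z ^ n" "\<lambda>n. a n * of_real r ^ n"] mono
      by (simp add: s_def[abs_def])
    have tail: "wmod \<alpha> (\<lambda>z. s N z - f (of_real r * z)) z \<le> (M * q ^ N / (1 - q)) * gauss d z" for N z
    proof -
      let ?E = "exp (\<alpha> / 2 * t\<^sup>2 * (norm z)\<^sup>2)"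
      have sums: "(\<lambda>n. (a n * of_real r ^ n) * z ^ n) sums f (of_real r * z)"
        using holomorphic_power_series[of f 0 "norm (of_real r * z) + 1" "of_real r * z"] hol
        by (auto simp: a_def power_mult_distrib mult_ac intro: holomorphic_on_subset)
      then have tsum: "(\<lambda>n. (a (n + N) * of_real r ^ (n + N)) * z ^ (n + N)) sums (f (of_real r * z) - s N z)"
        unfolding s_def by (rule sums_split_initial_segment)
      have geo: "(\<lambda>n. M * q ^ N * ?E * q ^ n) sums (M * q ^ N * ?E * (1 / (1 - q)))"
        using q by (intro sums_mult geometric_sums) auto
      have le: "norm ((a (n + N) * of_real r ^ (n + N)) * z ^ (n + N)) \<le> M * q ^ N * ?E * q ^ n" for n
        using term_le[of "n + N" z] by (simp add: power_add mult_ac)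
      have "norm (f (of_real r * z) - s N z) \<le> M * q ^ N * ?E * (1 / (1 - q))"
        using norm_suminf_le[OF le sums_summable[OF geo]] sums_unique[OF tsum] sums_unique[OF geo] by simp
      then have "wmod \<alpha> (\<lambda>z. s N z - f (of_real r * z)) z \<le> M * q ^ N * ?E * (1 / (1 - q)) * gauss (\<alpha> / 2) z"
        unfolding wmod_eq by (intro mult_right_mono) (auto simp: norm_minus_commute)
      also have "\<dots> = (M * q ^ N / (1 - q)) * (?E * gauss (\<alpha> / 2) z)"
        by simp
      also have "?E * gauss (\<alpha> / 2) z = gauss d z"
        by (simp add: gauss_def d_def algebra_simps flip: exp_add)
      finally show ?thesis .
    qed
    have le: "nrm X (\<lambda>z. s N z - f (of_real r * z)) \<le> C * (M * q ^ N / (1 - q))" for N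
      using C[rule_format, OF entire[OF diff_mem[OF s_mem fr_mem]] _ tail[of N]] M0 q by simp
    have "(\<lambda>N. C * (M * q ^ N / (1 - q))) \<longlonglongrightarrow> C * (M * 0 / (1 - q))"
      using q by (intro tendsto_intros LIMSEQ_power_zero) auto
    then have lim: "(\<lambda>N. C * (M * q ^ N / (1 - q))) \<longlonglongrightarrow> 0" by simp
    show "(\<lambda>N. nrm X (\<lambda>z. s N z - f (of_real r * z))) \<longlonglongrightarrow> 0"
      by (rule tendsto_sandwich[OF _ _ tendsto_const lim])
         (use le nrm_nonneg[OF diff_mem[OF s_mem fr_mem]] in auto)
  qed
qed

end

text \<open>Convergence \<open>f(r z) \<rightarrow> f\<close> fails in \<open>F^\<infinity>\<close>; it distinguishes the spaces in which the kernels span a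
  dense subspace. With \<open>1/2 \<le> r\<close> the factor \<open>r^(-2)\<close> of a change of variables stays bounded.\<close>

locale dilation_continuous_space = gaussian_space +
  assumes dilation_tendsto:
    "f \<in> carr X \<Longrightarrow> r \<longlonglongrightarrow> 1 \<Longrightarrow> (\<And>n. 1/2 \<le> r n) \<Longrightarrow> (\<And>n. r n < 1) \<Longrightarrow>
       (\<lambda>n. nrm X (\<lambda>z. f (of_real (r n) * z) - f z)) \<longlonglongrightarrow> 0"
begin

lemma kernel_span_total:
  assumes \<phi>: "\<phi> \<in> dual_space X" "\<And>f. f \<in> kernel_span \<alpha> \<Longrightarrow> \<phi> f = 0" and f: "f \<in> carr X"
  shows "\<phi> f = 0"
proof -
  define r where "r n = 1 - inverse (real (Suc (Suc n)))" for n
  have r: "1/2 \<le> r n" "r n < 1" for n by (auto simp: r_def field_simps)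
  have "(\<lambda>n. 1 - inverse (real (Suc n))) \<longlonglongrightarrow> 1 - 0"
    by (intro tendsto_intros LIMSEQ_inverse_real_of_nat)
  then have lim: "r \<longlonglongrightarrow> 1" 
    unfolding r_def using LIMSEQ_Suc by fastforce
  have r0: "0 < r n" for n using r(1)[of n] by simp
  have mem: "(\<lambda>z. f (of_real (r n) * z)) \<in> carr X" for n
    by (rule dilation_mem[OF f r0 r(2)])
  have zero: "\<phi> (\<lambda>z. f (of_real (r n) * z)) = 0" for n
    by (rule dual_dilation_eq_0[OF \<phi> f r0 r(2)])
  have "(\<lambda>n. nrm X (\<lambda>z. f (of_real (r n) * z) - f z)) \<longlonglongrightarrow> 0"
    by (rule dilation_tendsto[OF f lim r])
  with dual_eq_0_limit[where g = "\<lambda>n z. f (of_real (r n) * z)", OF \<phi>(1) f mem zero] show ?thesis .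
qed

end

section \<open>Continuity of dilations in the Fock spaces\<close>

text \<open>Outside a large disc both \<open>f(r z)\<close> and \<open>f(z)\<close> have small weighted modulus, inside it \<open>f\<close> is uniformly
  continuous.\<close>

lemma fock_inf0_dilation_continuous:
  assumes "\<alpha> > 0"
  shows "dilation_continuous_space \<alpha> (fock_inf0 \<alpha>)"
proof -
  let ?X = "fock_inf0 \<alpha>"
  interpret gaussian_space \<alpha> "fock_inf0 \<alpha>" using fock_inf0_gaussian_space[OF assms] .
  show ?thesis
  proof
    fix f and r :: "nat \<Rightarrow> real"
    assume f: "f \<in> carr ?X" and lim: "r \<longlonglongrightarrow> 1" and r: "\<And>n. 1/2 \<le> r n" "\<And>n. r n < 1"
    let ?g = "\<lambda>n z. f (of_real (r n) * z) - f z"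
    have hol: "f holomorphic_on UNIV" using entire[OF f] .
    have F0: "(fock_weighted \<alpha> f \<longlongrightarrow> 0) at_infinity"
      using f by (simp add: fock_inf0_def)
    have g_mem: "?g n \<in> carr ?X" for n
    proof -
      have "0 < r n" using r(1)[of n] by simp
      then show ?thesis by (intro diff_mem dilation_mem f r)
    qed
    show "(\<lambda>n. nrm ?X (?g n)) \<longlonglongrightarrow> 0"
    proof (rule LIMSEQ_I)
      fix e :: real assume e: "e > 0"
      obtain R where R: "\<And>z. R \<le> norm z \<Longrightarrow> wmod \<alpha> f z < e / 4"
        using tendstoD[OF F0, of "e / 4"] e by (auto simp: eventually_at_infinity)
      define S where "S = 2 * \<bar>R\<bar>"
      have "uniformly_continuous_on (cball 0 S) f"
        by (intro compact_uniformly_continuous continuous_on_entire hol compact_cball)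
      then obtain \<delta> where \<delta>: "\<delta> > 0"
        "\<And>x y. x \<in> cball 0 S \<Longrightarrow> y \<in> cball 0 S \<Longrightarrow> dist y x < \<delta> \<Longrightarrow> dist (f y) (f x) < e / 2"
        using e unfolding uniformly_continuous_on_def by (metis half_gt_zero)
      have "\<delta> / (S + 1) > 0" using \<delta> by (simp add: S_def)
      then obtain N where N: "\<And>n. n \<ge> N \<Longrightarrow> \<bar>r n - 1\<bar> < \<delta> / (S + 1)"
        using LIMSEQ_D[OF lim, of "\<delta> / (S + 1)"] by auto
      have "nrm ?X (?g n) \<le> e / 2" if n: "n \<ge> N" for n
      proof -
        have "wmod \<alpha> (?g n) z \<le> e / 2" for z
        proof (cases "norm z \<le> S")
          case True
          have nr: "norm (of_real (r n) * z) \<le> norm z"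
            using r(1)[of n] r(2)[of n] by (simp add: norm_mult mult_left_le_one_le)
          have "dist (of_real (r n) * z) z = \<bar>r n - 1\<bar> * norm z"
          proof -
            have "of_real (r n) * z - z = of_real (r n - 1) * z" by (simp add: algebra_simps)
            then show ?thesis by (simp only: dist_norm norm_mult norm_of_real)
          qed
          also have "\<dots> \<le> \<bar>r n - 1\<bar> * (S + 1)"
            using True by (intro mult_left_mono) auto
          also have "\<dots> < \<delta>"
            using N[OF n] \<delta> by (simp add: field_simps S_def)
          finally have "dist (f (of_real (r n) * z)) (f z) < e / 2"
            using True nr by (intro \<delta>(2)) auto
          then have "norm (?g n z) * gauss (\<alpha> / 2) z \<le> e / 2 * 1"
            using gauss_le_1[of "\<alpha> / 2" z] assms e by (intro mult_mono) (auto simp: dist_norm)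
          then show ?thesis by (simp add: wmod_eq)
        next
          case False
          have "R \<le> norm z" "R \<le> norm (of_real (r n) * z)"
          proof -
            show "R \<le> norm z" using False by (simp add: S_def)
            have "R \<le> 1/2 * norm z" using False by (simp add: S_def)
            also have "\<dots> \<le> r n * norm z" using r(1)[of n] by (intro mult_right_mono) auto
            finally show "R \<le> norm (of_real (r n) * z)" using r(1)[of n] by (simp add: norm_mult)
          qed
          then have Rb: "wmod \<alpha> f z < e / 4" "wmod \<alpha> f (of_real (r n) * z) < e / 4"
            using R by blast+
          have "(norm (of_real (r n) * z))\<^sup>2 \<le> (norm z)\<^sup>2"
            using r(1)[of n] r(2)[of n] by (intro power_mono) (auto simp: norm_mult mult_left_le_one_le)
          then have "gauss (\<alpha> / 2) z \<le> gauss (\<alpha> / 2) (of_real (r n) * z)"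
            using assms by (simp add: gauss_def)
          then have "norm (f (of_real (r n) * z)) * gauss (\<alpha> / 2) z \<le> wmod \<alpha> f (of_real (r n) * z)"
            unfolding wmod_eq by (intro mult_left_mono) auto
          moreover have "wmod \<alpha> (?g n) z \<le> norm (f (of_real (r n) * z)) * gauss (\<alpha> / 2) z + wmod \<alpha> f z"
            unfolding wmod_eq distrib_right[symmetric] by (intro mult_right_mono norm_triangle_ineq4) simp
          ultimately show ?thesis using Rb by linarith
        qed
        then have "nrm (fock_inf \<alpha>) (?g n) \<le> e / 2" by (rule fock_inf_nrm_le)
        then show ?thesis by (simp add: fock_inf0_def)
      qed
      then show "\<exists>N. \<forall>n\<ge>N. norm (nrm ?X (?g n) - 0) < e"
        using e nrm_nonneg[OF g_mem] by (intro exI[of _ N]) fastforce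
    qed
  qed
qed

lemma nn_integral_dilation:
  fixes u :: "complex \<Rightarrow> ennreal"
  assumes "u \<in> borel_measurable borel" "r > 0"
  shows "(\<integral>\<^sup>+z. ennreal (r\<^sup>2) * u (of_real r * z) \<partial>lborel) = (\<integral>\<^sup>+z. u z \<partial>lborel)"
proof -
  have "(\<integral>\<^sup>+z. u z \<partial>lborel)
      = (\<integral>\<^sup>+z. u z \<partial>density (distr lborel borel (\<lambda>z::complex. 0 + r *\<^sub>R z)) (\<lambda>_. \<bar>r\<bar> ^ DIM(complex)))"
    using lborel_affine[of r "0::complex"] assms by simp
  also have "\<dots> = (\<integral>\<^sup>+z. ennreal (\<bar>r\<bar> ^ DIM(complex)) * u z \<partial>distr lborel borel (\<lambda>z::complex. 0 + r *\<^sub>R z))"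
    using assms by (subst nn_integral_density) auto
  also have "\<dots> = (\<integral>\<^sup>+z. ennreal (\<bar>r\<bar> ^ DIM(complex)) * u (0 + r *\<^sub>R z) \<partial>lborel)"
    using assms by (subst nn_integral_distr) auto
  finally show ?thesis by (simp add: scaleR_conv_of_real)
qed

text \<open>With \<open>u = |f|^p\<close> (weighted) and \<open>F = r^2 |f(r z)|^p\<close> (weighted), a change of variables gives
  \<open>\<integral> F \<le> \<integral> u\<close>, so \<open>F \<rightarrow> u\<close> in \<open>L^1\<close> by Scheffe's lemma. The \<open>p\<close>-th power \<open>D\<close> of the weighted modulus
  of the difference is bounded by \<open>min D (5 * 2^p u)\<close> plus a multiple of \<open>|F - u|\<close>; dominated
  convergence applies to the first summand.\<close>

lemma fock_fin_dilation_continuous: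
  assumes "\<alpha> > 0" "p \<ge> 1"
  shows "dilation_continuous_space \<alpha> (fock_fin \<alpha> p)"
proof -
  let ?X = "fock_fin \<alpha> p"
  interpret gaussian_space \<alpha> "fock_fin \<alpha> p" using fock_fin_gaussian_space[OF assms] .
  show ?thesis
  proof
    fix f and r :: "nat \<Rightarrow> real"
    assume f: "f \<in> carr ?X" and lim: "r \<longlonglongrightarrow> 1" and r: "\<And>n. 1/2 \<le> r n" "\<And>n. r n < 1"
    let ?fr = "\<lambda>n z. f (of_real (r n) * z)"
    let ?g = "\<lambda>n z. ?fr n z - f z"
    have hol: "f holomorphic_on UNIV" using entire[OF f] .
    have r0: "0 < r n" for n using r(1)[of n] by simp
    have fr_mem: "?fr n \<in> carr ?X" for n
      by (intro dilation_mem f r r0)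
    have g_mem: "?g n \<in> carr ?X" for n
      by (intro diff_mem fr_mem f)
    define u where "u z = wmod \<alpha> f z powr p" for z
    define F where "F n z = (r n)\<^sup>2 * wmod \<alpha> (?fr n) z powr p" for n z
    define D where "D n z = wmod \<alpha> (?g n) z powr p" for n z
    have int_u: "integrable lborel u"
      using f by (simp add: fock_fin_def u_def[abs_def])
    have int_F: "integrable lborel (F n)" for n
      using fr_mem[of n] by (simp add: fock_fin_def F_def[abs_def])
    have int_D: "integrable lborel (D n)" for n
      using g_mem[of n] by (simp add: fock_fin_def D_def[abs_def])
    have cont: "isCont f z" for z
      using continuous_on_entire[OF hol, of UNIV] by (simp add: continuous_on_eq_continuous_at)
    have fr_lim: "(\<lambda>n. ?fr n z) \<longlonglongrightarrow> f z" for z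
    proof (rule isCont_tendsto_compose[OF cont])
      have "(\<lambda>n. complex_of_real (r n) * z) \<longlonglongrightarrow> of_real 1 * z"
        by (intro tendsto_intros lim)
      then show "(\<lambda>n. complex_of_real (r n) * z) \<longlonglongrightarrow> z" by simp
    qed
    have F_lim: "(\<lambda>n. F n z) \<longlonglongrightarrow> u z" for z
    proof -
      have "(\<lambda>n. (r n)\<^sup>2 * (norm (?fr n z) * gauss (\<alpha> / 2) z) powr p) \<longlonglongrightarrow> 1\<^sup>2 * (norm (f z) * gauss (\<alpha> / 2) z) powr p"
        using assms by (intro tendsto_intros lim fr_lim tendsto_powr') auto
      then show ?thesis by (simp add: F_def u_def wmod_eq)
    qed
    have D_lim: "(\<lambda>n. D n z) \<longlonglongrightarrow> 0" for z
    proof -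
      have "(\<lambda>n. (norm (?fr n z - f z) * gauss (\<alpha> / 2) z) powr p) \<longlonglongrightarrow> (norm (f z - f z) * gauss (\<alpha> / 2) z) powr p"
        using assms by (intro tendsto_intros fr_lim tendsto_powr') auto
      then show ?thesis by (simp add: D_def wmod_eq)
    qed
    have Fnn: "F n z \<ge> 0" "u z \<ge> 0" "D n z \<ge> 0" for n z by (auto simp: F_def u_def D_def)
    have scheffe: "(\<lambda>n. \<integral>\<^sup>+z. norm (F n z - u z) \<partial>lborel) \<longlonglongrightarrow> 0"
    proof (rule Scheffe_lemma2)
      show "F n \<in> borel_measurable lborel" for n using int_F by auto
      show "integrable lborel u" by (rule int_u)
      show "AE z in lborel. (\<lambda>n. F n z) \<longlonglongrightarrow> u z" using F_lim by simp
      fix n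
      have um: "(\<lambda>z. ennreal (u z)) \<in> borel_measurable borel"
        using borel_measurable_integrable[OF int_u] by simp
      have "(\<integral>\<^sup>+z. norm (F n z) \<partial>lborel) \<le> (\<integral>\<^sup>+z. ennreal ((r n)\<^sup>2) * ennreal (u (of_real (r n) * z)) \<partial>lborel)"
      proof (rule nn_integral_mono)
        fix z :: complex
        have "(norm (of_real (r n) * z))\<^sup>2 \<le> (norm z)\<^sup>2"
          using r(1)[of n] r(2)[of n] by (intro power_mono) (auto simp: norm_mult mult_left_le_one_le)
        then have "gauss (\<alpha> / 2) z \<le> gauss (\<alpha> / 2) (of_real (r n) * z)"
          using assms by (simp add: gauss_def)
        then have "wmod \<alpha> (?fr n) z \<le> wmod \<alpha> f (of_real (r n) * z)"
          unfolding wmod_eq by (intro mult_left_mono) auto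
        then have "F n z \<le> (r n)\<^sup>2 * u (of_real (r n) * z)"
          unfolding F_def u_def using assms by (intro mult_left_mono powr_mono2) auto
        then show "ennreal (norm (F n z)) \<le> ennreal ((r n)\<^sup>2) * ennreal (u (of_real (r n) * z))"
          using Fnn by (simp add: ennreal_leI flip: ennreal_mult)
      qed
      also have "\<dots> = (\<integral>\<^sup>+z. u z \<partial>lborel)"
        by (rule nn_integral_dilation[OF um r0])
      finally show "(\<integral>\<^sup>+z. norm (F n z) \<partial>lborel) \<le> (\<integral>\<^sup>+z. norm (u z) \<partial>lborel)"
        using Fnn by simp
    qed
    have "(\<integral>\<^sup>+z. norm (F n z - u z) \<partial>lborel) = ennreal (LINT z|lborel. \<bar>F n z - u z\<bar>)" for n
      using int_F[of n] int_u by (subst nn_integral_eq_integral) auto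
    with scheffe have Fu: "(\<lambda>n. LINT z|lborel. \<bar>F n z - u z\<bar>) \<longlonglongrightarrow> 0"
      by (intro tendsto_ennrealD[of _ 0]) auto
    define m where "m n z = min (D n z) (5 * 2 powr p * u z)" for n z
    have m_lim: "(\<lambda>n. LINT z|lborel. m n z) \<longlonglongrightarrow> (LINT (z::complex)|lborel. 0)"
    proof (rule integral_dominated_convergence)
      show "integrable lborel (\<lambda>z. 5 * 2 powr p * u z)" using int_u by simp
      show "m n \<in> borel_measurable lborel" for n
        unfolding m_def[abs_def] using int_D[of n] int_u by measurable
      show "AE z in lborel. (\<lambda>n. m n z) \<longlonglongrightarrow> 0"
      proof (rule AE_I2)
        fix z
        have "(\<lambda>n. m n z) \<longlonglongrightarrow> min 0 (5 * 2 powr p * u z)"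
          unfolding m_def by (intro tendsto_min D_lim tendsto_const)
        then show "(\<lambda>n. m n z) \<longlonglongrightarrow> 0" using Fnn by simp
      qed
      show "AE z in lborel. norm (m n z) \<le> 5 * 2 powr p * u z" for n
        using Fnn by (intro AE_I2) (simp add: m_def)
    qed simp
    have int_m: "integrable lborel (m n)" for n
      unfolding m_def[abs_def] using int_D[of n] int_u by simp
    have D_le: "D n z \<le> m n z + 4 * 2 powr p * \<bar>F n z - u z\<bar>" for n z
    proof -
      have "1 \<le> 4 * (r n)\<^sup>2"
        using power_mono[OF r(1)[of n], of 2] by (simp add: power2_eq_square)
      then have fr4: "wmod \<alpha> (?fr n) z powr p \<le> 4 * F n z"
        unfolding F_def using mult_right_mono[of 1 "4 * (r n)\<^sup>2" "wmod \<alpha> (?fr n) z powr p"] by simp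
      have "wmod \<alpha> (?g n) z \<le> wmod \<alpha> (?fr n) z + wmod \<alpha> f z"
        unfolding wmod_eq distrib_right[symmetric] by (intro mult_right_mono norm_triangle_ineq4) simp
      then have "D n z \<le> (wmod \<alpha> (?fr n) z + wmod \<alpha> f z) powr p"
        unfolding D_def using assms by (intro powr_mono2) auto
      also have "\<dots> \<le> 2 powr p * (wmod \<alpha> (?fr n) z powr p + u z)"
        unfolding u_def using assms by (intro powr_add_le) auto
      also have "\<dots> \<le> 2 powr p * (4 * \<bar>F n z - u z\<bar> + 5 * u z)"
      proof (intro mult_left_mono)
        have "4 * F n z \<le> 4 * \<bar>F n z - u z\<bar> + 4 * u z"
          by (simp add: abs_if)
        with fr4 have "wmod \<alpha> (?fr n) z powr p \<le> 4 * \<bar>F n z - u z\<bar> + 4 * u z"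
          by (rule order_trans)
        then show "wmod \<alpha> (?fr n) z powr p + u z \<le> 4 * \<bar>F n z - u z\<bar> + 5 * u z"
          by simp
      qed simp
      finally have "D n z \<le> 5 * 2 powr p * u z + 4 * 2 powr p * \<bar>F n z - u z\<bar>"
        by (simp add: algebra_simps)
      moreover have "0 \<le> 4 * 2 powr p * \<bar>F n z - u z\<bar>" by simp
      ultimately show ?thesis unfolding m_def min_def by auto
    qed
    have up: "(LINT z|lborel. D n z) \<le> (LINT z|lborel. m n z) + 4 * 2 powr p * (LINT z|lborel. \<bar>F n z - u z\<bar>)" for n
    proof -
      have "(LINT z|lborel. D n z) \<le> (LINT z|lborel. m n z + 4 * 2 powr p * \<bar>F n z - u z\<bar>)"
        using int_D[of n] int_m[of n] int_F[of n] int_u by (intro integral_mono D_le) auto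
      also have "\<dots> = (LINT z|lborel. m n z) + 4 * 2 powr p * (LINT z|lborel. \<bar>F n z - u z\<bar>)"
        using int_m[of n] int_F[of n] int_u by (subst Bochner_Integration.integral_add) auto
      finally show ?thesis .
    qed
    have up_lim: "(\<lambda>n. (LINT z|lborel. m n z) + 4 * 2 powr p * (LINT z|lborel. \<bar>F n z - u z\<bar>)) \<longlonglongrightarrow> 0"
      using tendsto_add[OF m_lim tendsto_mult_left[OF Fu, of "4 * 2 powr p"]] by simp
    have D_nonneg: "(LINT z|lborel. D n z) \<ge> 0" for n
      using Fnn by (intro integral_nonneg_AE) simp
    have D0: "(\<lambda>n. LINT z|lborel. D n z) \<longlonglongrightarrow> 0"
      by (rule tendsto_sandwich[OF _ _ tendsto_const up_lim]) (use up D_nonneg in auto)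
    have "(\<lambda>n. p * \<alpha> / (2 * pi) * (LINT z|lborel. D n z)) \<longlonglongrightarrow> p * \<alpha> / (2 * pi) * 0"
      by (rule tendsto_mult_left[OF D0])
    then have "(\<lambda>n. (p * \<alpha> / (2 * pi) * (LINT z|lborel. D n z)) powr (1 / p)) \<longlonglongrightarrow> (p * \<alpha> / (2 * pi) * 0) powr (1 / p)"
      by (rule tendsto_powr'[OF _ tendsto_const]) (use assms D_nonneg in auto)
    then show "(\<lambda>n. nrm ?X (?g n)) \<longlonglongrightarrow> 0"
      using assms by (simp add: fock_fin_def D_def)
  qed
qed

section \<open>Series indexed by pairs and partitions of the plane\<close>

lemma sums_prod_decode_mult:
  fixes x y :: "nat \<Rightarrow> real"
  assumes "x sums X" "y sums Y" "\<And>i. x i \<ge> 0" "\<And>m. y m \<ge> 0"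
  shows "(\<lambda>j. x (fst (prod_decode j)) * y (snd (prod_decode j))) sums (X * Y)"
proof -
  have hx: "(x has_sum X) UNIV" and hy: "(y has_sum Y) UNIV"
    using assms by (auto intro: sums_nonneg_imp_has_sum)
  have inner: "((\<lambda>m. x i * y m) has_sum x i * Y) UNIV" for i
    by (rule has_sum_cmult_right[OF hy])
  have outer: "((\<lambda>i. x i * Y) has_sum X * Y) UNIV"
    by (rule has_sum_cmult_left[OF hx])
  have "Y \<ge> 0"
    using assms by (auto simp: sums_iff intro: suminf_nonneg)
  let ?f = "\<lambda>(i, m). x i * y m"
  have "(\<lambda>p. norm (?f p)) summable_on (UNIV \<times> UNIV)"
    unfolding Infinite_Sum.abs_summable_on_Sigma_iff
    using has_sum_imp_summable[OF inner] infsumI[OF inner] has_sum_imp_summable[OF outer] assms \<open>Y \<ge> 0\<close>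
    by (simp add: abs_mult)
  then have sm: "?f summable_on UNIV \<times> UNIV"
    by (rule Infinite_Sum.abs_summable_summable)
  have "infsum ?f (UNIV \<times> UNIV) = infsum (\<lambda>i. infsum (\<lambda>m. x i * y m) UNIV) UNIV"
    using infsum_Sigma'_banach[OF sm] by simp
  also have "\<dots> = X * Y"
    using infsumI[OF inner] infsumI[OF outer] by simp
  finally have "(?f has_sum X * Y) (UNIV \<times> UNIV)"
    using sm by (simp add: has_sum_iff)
  then have "((\<lambda>j. ?f (prod_decode j)) has_sum X * Y) UNIV"
    by (subst has_sum_reindex_bij_betw[OF bij_prod_decode]) simp
  then show ?thesis
    by (auto dest!: has_sum_imp_sums simp: case_prod_beta)
qed

text \<open>A series over a single row of the index plane, which is what remains of a sum over all cells at a
  point that lies in only one of them.\<close>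

lemma sums_prod_decode_row:
  fixes t :: "nat \<Rightarrow> 'a::banach"
  assumes "summable (\<lambda>m. norm (t m))" "t sums S"
  shows "(\<lambda>j. if fst (prod_decode j) = i then t (snd (prod_decode j)) else 0) sums S"
proof -
  have "(t has_sum S) UNIV"
    using assms by (rule norm_summable_imp_has_sum)
  then have "((\<lambda>(k, m). t m) has_sum S) (Pair i ` UNIV)"
    by (subst has_sum_reindex) (auto simp: inj_on_def o_def)
  then have "((\<lambda>(k, m). if k = i then t m else 0) has_sum S) UNIV"
    by (rule has_sum_cong_neutral[THEN iffD1, rotated -1]) auto
  then have "((\<lambda>j. (\<lambda>(k, m). if k = i then t m else 0) (prod_decode j)) has_sum S) UNIV"
    by (subst has_sum_reindex_bij_betw[OF bij_prod_decode]) simp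
  then show ?thesis
    by (auto dest!: has_sum_imp_sums simp: case_prod_beta)
qed

lemma unit_disc_partition:
  obtains a :: "nat \<Rightarrow> complex" and Q :: "nat \<Rightarrow> complex set"
  where "disjoint_family Q" "(\<Union>i. Q i) = UNIV" "\<And>i. Q i \<in> sets borel" "\<And>i. Q i \<subseteq> ball (a i) 1"
proof -
  obtain D :: "complex set" where D: "countable D" "\<And>X. open X \<Longrightarrow> X \<noteq> {} \<Longrightarrow> \<exists>d\<in>D. d \<in> X"
    using countable_dense_exists by blast
  have "D \<noteq> {}" using D(2)[of UNIV] by auto
  define a where "a = from_nat_into D"
  have "\<exists>i. z \<in> ball (a i) 1" for z
  proof -
    obtain d where "d \<in> D" "d \<in> ball z 1"
      using D(2)[of "ball z 1"] by auto
    moreover obtain i where "a i = d"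
      unfolding a_def using from_nat_into_surj[OF D(1) \<open>d \<in> D\<close>] by blast
    ultimately show ?thesis by (intro exI[of _ i]) (simp add: dist_commute)
  qed
  then have "(\<Union>i. ball (a i) 1) = UNIV" by blast
  moreover have "range (disjointed (\<lambda>i. ball (a i) 1)) \<subseteq> sets borel"
    by (rule sets.range_disjointed_sets) auto
  ultimately show ?thesis
    by (intro that[of "disjointed (\<lambda>i. ball (a i) 1)" a])
       (use disjointed_subset[of "\<lambda>i. ball (a i) 1"]
         in \<open>auto simp: disjoint_family_disjointed UN_disjointed_eq simp del: mem_ball\<close>)
qed

section \<open>Expansion of the kernel on a cell\<close>

text \<open>In \<open>\<alpha> z cnj w = \<alpha> z cnj a + \<alpha> a cnj (w - a) + \<alpha> (z - a) cnj (w - a)\<close> only the exponential of the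
  last summand is expanded into a power series. The Gaussian factors are distributed such that both
  the weight, multiplied by \<open>f\<close> and restricted to the unit disc around \<open>a\<close>, and the atom are of
  moderate size independently of \<open>a\<close>.\<close>

definition cell_weight :: "real \<Rightarrow> complex \<Rightarrow> nat \<Rightarrow> complex \<Rightarrow> complex" where
  "cell_weight \<alpha> a m w = cnj (w - a) ^ m * exp (of_real \<alpha> * a * cnj (w - a)) *
     of_real (exp (\<alpha> / 2 * (norm a)\<^sup>2 - \<alpha> * (norm w)\<^sup>2))"

definition cell_atom :: "real \<Rightarrow> complex \<Rightarrow> nat \<Rightarrow> complex \<Rightarrow> complex" where
  "cell_atom \<alpha> a m z = exp (of_real \<alpha> * z * cnj a) * of_real (exp (- (\<alpha> / 2) * (norm a)\<^sup>2)) *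
     ((of_real \<alpha> * (z - a)) ^ m / fact m)"

definition cell_functional ::
  "real \<Rightarrow> complex measure \<Rightarrow> complex set \<Rightarrow> complex \<Rightarrow> nat \<Rightarrow> (complex \<Rightarrow> complex) \<Rightarrow> complex" where
  "cell_functional \<alpha> \<mu> Q a m f =
     of_real (\<alpha> / pi) * (LINT w|\<mu>. indicator Q w * (cell_weight \<alpha> a m w * f w))"

lemma entire_cell_atom: "cell_atom \<alpha> a m holomorphic_on UNIV"
  unfolding cell_atom_def by (intro holomorphic_intros) auto

lemma cell_expansion:
  shows "summable (\<lambda>m. norm (cell_atom \<alpha> a m z * cell_weight \<alpha> a m w))"
    and "(\<lambda>m. cell_atom \<alpha> a m z * cell_weight \<alpha> a m w) sums
           (fock_kernel \<alpha> z w * of_real (exp (- \<alpha> * (norm w)\<^sup>2)))"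
proof -
  define c where "c = exp (of_real \<alpha> * z * cnj a) * exp (of_real \<alpha> * a * cnj (w - a)) *
     of_real (exp (- \<alpha> * (norm w)\<^sup>2))"
  define x where "x = of_real \<alpha> * (z - a) * cnj (w - a)"
  have eq: "cell_atom \<alpha> a m z * cell_weight \<alpha> a m w = c * (x ^ m /\<^sub>R fact m)" for m
  proof -
    have "exp (- (\<alpha> / 2) * (norm a)\<^sup>2) * exp (\<alpha> / 2 * (norm a)\<^sup>2 - \<alpha> * (norm w)\<^sup>2) = exp (- \<alpha> * (norm w)\<^sup>2)"
      by (simp flip: exp_add)
    then have e: "complex_of_real (exp (- (\<alpha> / 2) * (norm a)\<^sup>2)) * of_real (exp (\<alpha> / 2 * (norm a)\<^sup>2 - \<alpha> * (norm w)\<^sup>2))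
       = of_real (exp (- \<alpha> * (norm w)\<^sup>2))"
      by (metis of_real_mult)
    have "cell_atom \<alpha> a m z * cell_weight \<alpha> a m w = 
       exp (of_real \<alpha> * z * cnj a) * exp (of_real \<alpha> * a * cnj (w - a)) * 
       (complex_of_real (exp (- (\<alpha> / 2) * (norm a)\<^sup>2)) * of_real (exp (\<alpha> / 2 * (norm a)\<^sup>2 - \<alpha> * (norm w)\<^sup>2))) *
       (x ^ m / fact m)"
      by (simp add: cell_atom_def cell_weight_def x_def power_mult_distrib del: of_real_exp)
    also have "\<dots> = c * (x ^ m /\<^sub>R fact m)"
      unfolding e c_def by (simp add: scaleR_conv_of_real divide_inverse mult_ac)
    finally show ?thesis .
  qed
  have "summable (\<lambda>m. norm c * norm (x ^ m /\<^sub>R fact m))"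
    by (intro summable_mult summable_norm_exp)
  then show "summable (\<lambda>m. norm (cell_atom \<alpha> a m z * cell_weight \<alpha> a m w))"
    by (simp only: eq norm_mult)
  have "(\<lambda>m. c * (x ^ m /\<^sub>R fact m)) sums (c * exp x)"
    by (intro sums_mult exp_converges)
  also have "c * exp x = fock_kernel \<alpha> z w * of_real (exp (- \<alpha> * (norm w)\<^sup>2))"
  proof -
    have "exp (of_real \<alpha> * z * cnj a) * exp (of_real \<alpha> * a * cnj (w - a)) * exp x = fock_kernel \<alpha> z w"
      unfolding fock_kernel_def x_def exp_add[symmetric] by (simp add: algebra_simps)
    then show ?thesis by (simp add: c_def mult_ac)
  qed
  finally show "(\<lambda>m. cell_atom \<alpha> a m z * cell_weight \<alpha> a m w) sums
           (fock_kernel \<alpha> z w * of_real (exp (- \<alpha> * (norm w)\<^sup>2)))"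
    by (simp add: eq)
qed

lemma norm_cell_weight_mult_le:
  assumes "\<alpha> > 0" "w \<in> ball a 1"
  shows "norm (cell_weight \<alpha> a m w * f w) \<le> wmod \<alpha> f w"
proof -
  define u where "u = w - a"
  have u: "norm u \<le> 1" using assms by (simp add: u_def dist_norm norm_minus_commute)
  have w: "w = a + u" by (simp add: u_def)
  have "Re (a * cnj u) = Re (u * cnj a)" by simp
  then have sq: "(norm w)\<^sup>2 = (norm a)\<^sup>2 + 2 * Re (a * cnj u) + (norm u)\<^sup>2"
    unfolding w norm_add_sqr_complex by simp
  have nx: "norm (exp (of_real \<alpha> * a * cnj u)) = exp (\<alpha> * Re (a * cnj u))"
    by (simp add: mult.assoc)
  have ex: "exp (\<alpha> * Re (a * cnj u)) * exp (\<alpha> / 2 * (norm a)\<^sup>2 - \<alpha> * (norm w)\<^sup>2)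
      = gauss (\<alpha> / 2) u * gauss (\<alpha> / 2) w"
    unfolding gauss_def exp_add[symmetric] sq by (simp add: algebra_simps)
  have "norm (cell_weight \<alpha> a m w) = norm u ^ m * (exp (\<alpha> * Re (a * cnj u)) * exp (\<alpha> / 2 * (norm a)\<^sup>2 - \<alpha> * (norm w)\<^sup>2))"
    unfolding cell_weight_def u_def[symmetric] norm_mult norm_power complex_mod_cnj nx
    by (simp del: of_real_exp)
  also have "\<dots> \<le> 1 * (1 * gauss (\<alpha> / 2) w)"
    unfolding ex using u assms gauss_le_1[of "\<alpha> / 2" u]
    by (intro mult_mono power_le_one) auto
  finally have "norm (cell_weight \<alpha> a m w) * norm (f w) \<le> gauss (\<alpha> / 2) w * norm (f w)"
    by (intro mult_right_mono) auto
  then show ?thesis by (simp add: wmod_eq norm_mult mult_ac)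
qed

text \<open>With \<open>v = z - a\<close> the weighted modulus equals \<open>exp(-\<alpha>|v|^2/2) (\<alpha>|v|)^m / m!\<close>. The factor
  \<open>2^(-m)\<close> comes from comparing \<open>(2 \<alpha>|v|)^m / m!\<close> with \<open>exp(2 \<alpha>|v|)\<close>, which costs half of the
  Gaussian decay.\<close>

lemma wmod_cell_atom_le:
  assumes "\<alpha> > 0"
  shows "wmod \<alpha> (cell_atom \<alpha> a m) z \<le> (1/2) ^ m * exp (4 * \<alpha>) * gauss (\<alpha> / 4) (z - a)"
proof -
  define v where "v = z - a"
  have z: "z = a + v" by (simp add: v_def)
  have "Re (z * cnj a) = (norm a)\<^sup>2 + Re (v * cnj a)"
    unfolding z by (simp only: cmod_power2) (simp add: power2_eq_square algebra_simps)
  then have ex: "exp (\<alpha> * Re (z * cnj a)) * exp (- (\<alpha> / 2) * (norm a)\<^sup>2) * gauss (\<alpha> / 2) z = gauss (\<alpha> / 2) v"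
    unfolding gauss_def exp_add[symmetric] z norm_add_sqr_complex by (simp add: algebra_simps)
  have nx: "norm (exp (of_real \<alpha> * z * cnj a)) = exp (\<alpha> * Re (z * cnj a))"
    by (simp add: mult.assoc)
  have "(\<Sum>k\<in>{m}. (2 * \<alpha> * norm v) ^ k /\<^sub>R fact k) \<le> exp (2 * \<alpha> * norm v)"
    unfolding exp_def using assms by (intro sum_le_suminf summable_exp_generic) auto
  then have "(2 * \<alpha> * norm v) ^ m / fact m \<le> exp (2 * \<alpha> * norm v)"
    by (simp add: field_simps)
  then have series: "(\<alpha> * norm v) ^ m / fact m \<le> (1/2) ^ m * exp (2 * \<alpha> * norm v)"
    by (simp add: power_mult_distrib power_divide field_simps)
  have "0 \<le> (norm v / 2 - 2)\<^sup>2" by simp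
  then have "2 * norm v \<le> (norm v)\<^sup>2 / 4 + 4"
    by (simp add: power2_eq_square field_simps)
  then have "\<alpha> * (2 * norm v) \<le> \<alpha> * ((norm v)\<^sup>2 / 4 + 4)"
    using assms by (intro mult_left_mono) auto
  then have expo: "exp (2 * \<alpha> * norm v) * gauss (\<alpha> / 2) v \<le> exp (4 * \<alpha>) * gauss (\<alpha> / 4) v"
    unfolding gauss_def exp_add[symmetric] by (simp add: algebra_simps)
  have "wmod \<alpha> (cell_atom \<alpha> a m) z
      = (exp (\<alpha> * Re (z * cnj a)) * exp (- (\<alpha> / 2) * (norm a)\<^sup>2) * gauss (\<alpha> / 2) z) * ((\<alpha> * norm v) ^ m / fact m)"
    unfolding wmod_eq cell_atom_def v_def[symmetric] norm_mult nx norm_divide norm_power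
    using assms by (simp del: of_real_exp)
  also have "\<dots> \<le> gauss (\<alpha> / 2) v * ((1/2) ^ m * exp (2 * \<alpha> * norm v))"
    unfolding ex by (intro mult_left_mono series) simp
  also have "\<dots> = (1/2) ^ m * (exp (2 * \<alpha> * norm v) * gauss (\<alpha> / 2) v)"
    by simp
  also have "\<dots> \<le> (1/2) ^ m * (exp (4 * \<alpha>) * gauss (\<alpha> / 4) v)"
    by (intro mult_left_mono expo) simp
  finally show ?thesis by (simp add: v_def mult_ac)
qed

lemma norm_fock_kernel_le:
  fixes z w :: complex
  assumes "\<alpha> > 0"
  shows "norm (fock_kernel \<alpha> z w) \<le> exp (\<alpha> / 2 * (norm z)\<^sup>2) * exp (\<alpha> / 2 * (norm w)\<^sup>2)"
proof -
  have "Re (z * cnj w) \<le> norm z * norm w"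
    using complex_Re_le_cmod[of "z * cnj w"] by (simp add: norm_mult)
  also have "\<dots> \<le> (norm z)\<^sup>2 / 2 + (norm w)\<^sup>2 / 2"
    using sum_squares_bound[of "norm z" "norm w"] by simp
  finally have "\<alpha> * Re (z * cnj w) \<le> \<alpha> * ((norm z)\<^sup>2 / 2 + (norm w)\<^sup>2 / 2)"
    using assms by (intro mult_left_mono) auto
  then show ?thesis
    by (simp add: fock_kernel_def mult.assoc algebra_simps flip: exp_add)
qed

section \<open>The dual norm\<close>

context gaussian_space
begin

lemma pointwise_obtain:
  obtains C where "C > 0" "\<And>f z. f \<in> carr X \<Longrightarrow> wmod \<alpha> f z \<le> C * nrm X f"
proof -
  obtain C where C: "\<forall>f\<in>carr X. \<forall>z. wmod \<alpha> f z \<le> C * nrm X f"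
    using pointwise ..
  have "wmod \<alpha> f z \<le> max 1 C * nrm X f" if "f \<in> carr X" for f z
    using C that mult_right_mono[OF max.cobounded2[of C 1] nrm_nonneg[OF that]] by (meson order_trans)
  then show ?thesis using that[of "max 1 C"] by simp
qed

lemma dual_norm_le:
  assumes "\<And>f. f \<in> carr X \<Longrightarrow> norm (\<phi> f) \<le> B * nrm X f" "B \<ge> 0"
  shows "dual_norm X \<phi> \<le> B"
  unfolding dual_norm_def
proof (rule cSUP_least)
  show "{f \<in> carr X. nrm X f \<le> 1} \<noteq> {}" using zero_mem nrm_zero by force
  fix f assume "f \<in> {f \<in> carr X. nrm X f \<le> 1}"
  then show "norm (\<phi> f) \<le> B"
    using assms(1)[of f] mult_left_mono[of "nrm X f" 1 B] assms(2) by auto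
qed

lemma bdd_above_dual:
  assumes "\<phi> \<in> dual_space X"
  shows "bdd_above ((\<lambda>f. norm (\<phi> f)) ` {f \<in> carr X. nrm X f \<le> 1})"
proof -
  obtain C where C: "\<And>f. f \<in> carr X \<Longrightarrow> norm (\<phi> f) \<le> C * nrm X f"
    using dual_bounded[OF assms] by blast
  have "norm (\<phi> f) \<le> \<bar>C\<bar>" if "f \<in> carr X" "nrm X f \<le> 1" for f
  proof -
    have "C * nrm X f \<le> \<bar>C\<bar> * 1"
      using that nrm_nonneg[OF that(1)] by (intro mult_mono) auto
    then show ?thesis using C[OF that(1)] by simp
  qed
  then show ?thesis by (intro bdd_aboveI[of _ "\<bar>C\<bar>"]) auto
qed

text \<open>As \<open>nrm\<close> may vanish on nonzero functions a priori, the boundedness of \<open>\<phi>\<close> is used once more in that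
  case.\<close>

lemma norm_le_dual_norm:
  assumes "\<phi> \<in> dual_space X" "f \<in> carr X"
  shows "norm (\<phi> f) \<le> dual_norm X \<phi> * nrm X f"
proof (cases "nrm X f = 0")
  case True
  then show ?thesis using dual_bounded[OF assms(1)] assms(2) by fastforce
next
  case False
  then have pos: "nrm X f > 0" using nrm_nonneg[OF assms(2)] by simp
  let ?c = "inverse (complex_of_real (nrm X f))"
  have "(\<lambda>z. ?c * f z) \<in> {f \<in> carr X. nrm X f \<le> 1}"
    using assms scale_mem nrm_scale pos by (simp add: norm_inverse)
  then have "norm (\<phi> (\<lambda>z. ?c * f z)) \<le> dual_norm X \<phi>"
    unfolding dual_norm_def by (intro cSUP_upper bdd_above_dual assms)
  moreover have "norm (\<phi> (\<lambda>z. ?c * f z)) = norm (\<phi> f) / nrm X f"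
    unfolding dual_scale[OF assms] using pos by (simp add: norm_mult norm_inverse norm_divide field_simps)
  ultimately have "norm (\<phi> f) / nrm X f \<le> dual_norm X \<phi>"
    by (simp only:)
  then show ?thesis
    using pos by (simp add: field_simps)
qed

lemma dual_norm_nonneg:
  assumes "\<phi> \<in> dual_space X"
  shows "dual_norm X \<phi> \<ge> 0"
proof -
  have "norm (\<phi> (\<lambda>z. 0)) \<le> dual_norm X \<phi>"
    unfolding dual_norm_def using zero_mem nrm_zero by (intro cSUP_upper bdd_above_dual assms) auto
  then show ?thesis using norm_ge_zero order_trans by blast
qed

end

section \<open>Nuclear representations for finite measures\<close>

locale finite_borel_measure = finite_measure \<mu> for \<mu> :: "complex measure" +
  assumes sets_eq: "sets \<mu> = sets borel"
begin

lemma space_eq: "space \<mu> = UNIV"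
  using sets_eq_imp_space_eq[OF sets_eq] by simp

lemma measurable_eq: "borel_measurable \<mu> = borel_measurable borel"
  using measurable_cong_sets[OF sets_eq refl] .

lemma integrable_toeplitz_integrand:
  assumes "\<alpha> > 0" "f holomorphic_on UNIV" "\<And>w. wmod \<alpha> f w \<le> M"
  shows "integrable \<mu> (\<lambda>w. fock_kernel \<alpha> z w * f w * of_real (exp (- \<alpha> * (norm w)\<^sup>2)))"
proof (rule integrable_const_bound)
  show "(\<lambda>w. fock_kernel \<alpha> z w * f w * of_real (exp (- \<alpha> * (norm w)\<^sup>2))) \<in> borel_measurable \<mu>"
    unfolding measurable_eq fock_kernel_def
    by (intro borel_measurable_continuous_onI continuous_intros continuous_on_entire assms)
  show "AE w in \<mu>. norm (fock_kernel \<alpha> z w * f w * of_real (exp (- \<alpha> * (norm w)\<^sup>2))) \<le> exp (\<alpha> / 2 * (norm z)\<^sup>2) * M"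
  proof (rule AE_I2)
    fix w
    have "norm (fock_kernel \<alpha> z w * f w * of_real (exp (- \<alpha> * (norm w)\<^sup>2))) =
      norm (fock_kernel \<alpha> z w) * (norm (f w) * exp (- \<alpha> * (norm w)\<^sup>2))"
      by (simp add: norm_mult del: of_real_exp)
    also have "\<dots> \<le> (exp (\<alpha> / 2 * (norm z)\<^sup>2) * exp (\<alpha> / 2 * (norm w)\<^sup>2)) * (norm (f w) * exp (- \<alpha> * (norm w)\<^sup>2))"
      by (intro mult_right_mono norm_fock_kernel_le assms) auto
    also have "\<dots> = exp (\<alpha> / 2 * (norm z)\<^sup>2) * wmod \<alpha> f w"
    proof -
      have "exp (\<alpha> / 2 * (norm w)\<^sup>2) * exp (- \<alpha> * (norm w)\<^sup>2) = gauss (\<alpha> / 2) w"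
        unfolding gauss_def exp_add[symmetric] by (simp add: algebra_simps)
      then show ?thesis by (simp add: wmod_eq mult_ac) 
    qed
    also have "\<dots> \<le> exp (\<alpha> / 2 * (norm z)\<^sup>2) * M"
      by (intro mult_left_mono assms) auto
    finally show "norm (fock_kernel \<alpha> z w * f w * of_real (exp (- \<alpha> * (norm w)\<^sup>2))) \<le> exp (\<alpha> / 2 * (norm z)\<^sup>2) * M" .
  qed
qed

lemma cell_integrand:
  assumes "\<alpha> > 0" "f holomorphic_on UNIV" "\<And>w. wmod \<alpha> f w \<le> M" "Q \<in> sets borel" "Q \<subseteq> ball a 1"
  shows "integrable \<mu> (\<lambda>w. indicator Q w * (cell_weight \<alpha> a m w * f w))"
    and "(LINT w|\<mu>. norm (indicator Q w * (cell_weight \<alpha> a m w * f w))) \<le> M * measure \<mu> Q"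
proof -
  have M: "M \<ge> 0" using assms(3)[of 0] norm_ge_zero order_trans by blast
  have le: "norm (indicator Q w * (cell_weight \<alpha> a m w * f w)) \<le> indicator Q w * M" for w
  proof (cases "w \<in> Q")
    case True
    then have "norm (cell_weight \<alpha> a m w * f w) \<le> wmod \<alpha> f w"
      using assms by (intro norm_cell_weight_mult_le) auto
    then show ?thesis using True assms(3)[of w] by simp
  qed simp
  have intM: "integrable \<mu> (\<lambda>w. indicator Q w * M)"
    using assms(4) by (intro integrable_mult_left integrable_real_indicator) (auto simp: sets_eq less_top[symmetric])
  show int: "integrable \<mu> (\<lambda>w. indicator Q w * (cell_weight \<alpha> a m w * f w))"
  proof (rule Bochner_Integration.integrable_bound[OF intM])
    have [measurable]: "f \<in> borel_measurable borel"
      by (intro borel_measurable_continuous_onI continuous_on_entire assms)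
    have [measurable]: "cell_weight \<alpha> a m \<in> borel_measurable borel"
      unfolding cell_weight_def by (intro borel_measurable_continuous_onI continuous_intros)
    note assms(4)[measurable]
    show "(\<lambda>w. indicator Q w * (cell_weight \<alpha> a m w * f w)) \<in> borel_measurable \<mu>"
      unfolding measurable_eq by measurable
    show "AE w in \<mu>. norm (indicator Q w * (cell_weight \<alpha> a m w * f w)) \<le> norm (indicator Q w * M)"
      using le M by (intro AE_I2) (simp add: abs_mult)
  qed
  have "(LINT w|\<mu>. norm (indicator Q w * (cell_weight \<alpha> a m w * f w))) \<le> (LINT w|\<mu>. indicator Q w * M)"
    using int intM le by (intro integral_mono) auto
  also have "\<dots> = M * measure \<mu> Q"
    using assms(4) by (simp add: space_eq sets_eq)
  finally show "(LINT w|\<mu>. norm (indicator Q w * (cell_weight \<alpha> a m w * f w))) \<le> M * measure \<mu> Q" .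
qed

lemma norm_cell_functional_le:
  assumes "\<alpha> > 0" "f holomorphic_on UNIV" "\<And>w. wmod \<alpha> f w \<le> M" "Q \<in> sets borel" "Q \<subseteq> ball a 1"
  shows "norm (cell_functional \<alpha> \<mu> Q a m f) \<le> \<alpha> / pi * (M * measure \<mu> Q)"
proof -
  have "norm (LINT w|\<mu>. indicator Q w * (cell_weight \<alpha> a m w * f w)) \<le> M * measure \<mu> Q"
    using integral_norm_bound[of \<mu> "\<lambda>w. indicator Q w * (cell_weight \<alpha> a m w * f w)"]
      cell_integrand(2)[OF assms, of m] by linarith
  then show ?thesis
    unfolding cell_functional_def norm_mult using assms(1)
    by (simp add: mult_left_mono norm_divide divide_right_mono)
qed

text \<open>Integrate the expansion of the kernel, cell by cell. The interchange of sum and integral is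
  justified by the total \<open>\<Sum>i m. \<mu>(Q\<^sub>i) 2^(-m) = 2 \<mu>(\<complex>)\<close>, up to a constant that depends on \<open>z\<close>
  and \<open>f\<close>.\<close>

lemma toeplitz_cell_sums:
  assumes \<alpha>: "\<alpha> > 0" and f: "f holomorphic_on UNIV" "\<And>w. wmod \<alpha> f w \<le> M"
    and Q: "disjoint_family Q" "(\<Union>i. Q i) = UNIV" "\<And>i. Q i \<in> sets borel" "\<And>i. Q i \<subseteq> ball (a i) 1"
  shows "(\<lambda>j. case prod_decode j of (i, m) \<Rightarrow> cell_functional \<alpha> \<mu> (Q i) (a i) m f * cell_atom \<alpha> (a i) m z)
           sums toeplitz \<alpha> \<mu> f z"
proof -
  define g where "g j w = (case prod_decode j of (i, m) \<Rightarrow>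
     cell_atom \<alpha> (a i) m z * (indicator (Q i) w * (cell_weight \<alpha> (a i) m w * f w)))" for j w
  define t where "t i w m = cell_atom \<alpha> (a i) m z * cell_weight \<alpha> (a i) m w * f w" for i w m
  have M: "M \<ge> 0" using f(2)[of 0] norm_ge_zero order_trans by blast
  have row: "g j w = (if fst (prod_decode j) = i then t i w (snd (prod_decode j)) else 0)" if "w \<in> Q i" for i j w
  proof (cases "fst (prod_decode j) = i")
    case True
    then show ?thesis using that by (simp add: g_def t_def case_prod_beta)
  next
    case False
    then have "w \<notin> Q (fst (prod_decode j))"
      using that Q(1) by (auto simp: disjoint_family_on_def)
    then show ?thesis using False by (simp add: g_def case_prod_beta)
  qed
  have t: "summable (\<lambda>m. norm (t i w m))"
    "t i w sums (fock_kernel \<alpha> z w * of_real (exp (- \<alpha> * (norm w)\<^sup>2)) * f w)" for i w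
    using summable_mult2[OF cell_expansion(1)[of \<alpha> "a i" z w], of "norm (f w)"]
      sums_mult2[OF cell_expansion(2)[of \<alpha> "a i" z w], of "f w"]
    unfolding t_def[abs_def] by (simp_all add: norm_mult)
  have point: "(\<lambda>j. g j w) sums (fock_kernel \<alpha> z w * f w * of_real (exp (- \<alpha> * (norm w)\<^sup>2)))"
    "summable (\<lambda>j. norm (g j w))" for w
  proof -
    obtain i where i: "w \<in> Q i" using Q(2) by blast
    show "(\<lambda>j. g j w) sums (fock_kernel \<alpha> z w * f w * of_real (exp (- \<alpha> * (norm w)\<^sup>2)))"
      using sums_prod_decode_row[OF t(1)[of i w] t(2)[of i w], of i] by (simp add: row[OF i] mult_ac del: of_real_exp)
    have "(\<lambda>j. if fst (prod_decode j) = i then norm (t i w (snd (prod_decode j))) else 0) sums (\<Sum>m. norm (t i w m))"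
      using t(1)[of i w] by (intro sums_prod_decode_row summable_sums) auto
    moreover have "norm (g j w) = (if fst (prod_decode j) = i then norm (t i w (snd (prod_decode j))) else 0)" for j
      by (simp add: row[OF i])
    ultimately show "summable (\<lambda>j. norm (g j w))"
      by (simp add: sums_summable)
  qed
  have int: "integrable \<mu> (g j)" for j
  proof -
    obtain i m where j: "prod_decode j = (i, m)" by fastforce
    show ?thesis
      unfolding g_def j prod.case using cell_integrand(1)[OF \<alpha> f Q(3,4)]
      by (intro integrable_mult_right) 
  qed
  define E where "E = exp (\<alpha> / 2 * (norm z)\<^sup>2) * exp (4 * \<alpha>)"
  have atom: "norm (cell_atom \<alpha> (a i) m z) \<le> E * (1/2) ^ m" for i m
  proof -
    have "wmod \<alpha> (cell_atom \<alpha> (a i) m) z \<le> (1/2) ^ m * exp (4 * \<alpha>) * gauss (\<alpha> / 4) (z - a i)"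
      using wmod_cell_atom_le[OF \<alpha>] .
    also have "\<dots> \<le> (1/2) ^ m * exp (4 * \<alpha>) * 1"
      using \<alpha> by (intro mult_left_mono gauss_le_1) auto
    finally have "norm (cell_atom \<alpha> (a i) m z) \<le> (1/2) ^ m * exp (4 * \<alpha>) * 1 * exp (\<alpha> / 2 * (norm z)\<^sup>2)"
      by (rule norm_le_of_wmod_le)
    then show ?thesis by (simp add: E_def mult_ac)
  qed
  have meas_sums: "(\<lambda>i. measure \<mu> (Q i)) sums measure \<mu> UNIV"
    using finite_measure_UNION[of Q] Q(1,2,3) by (auto simp: sets_eq)
  have "(\<lambda>j. measure \<mu> (Q (fst (prod_decode j))) * (1/2) ^ snd (prod_decode j)) sums (measure \<mu> UNIV * (1 / (1 - 1/2)))"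
    by (intro sums_prod_decode_mult meas_sums geometric_sums) auto
  then have bsum: "summable (\<lambda>j. E * M * (measure \<mu> (Q (fst (prod_decode j))) * (1/2) ^ snd (prod_decode j)))"
    by (intro summable_mult sums_summable)
  have "summable (\<lambda>j. LINT w|\<mu>. norm (g j w))"
  proof (rule summable_comparison_test'[OF bsum])
    fix j
    obtain i m where j: "prod_decode j = (i, m)" by fastforce
    have "(LINT w|\<mu>. norm (g j w)) = norm (cell_atom \<alpha> (a i) m z) *
        (LINT w|\<mu>. norm (indicator (Q i) w * (cell_weight \<alpha> (a i) m w * f w)))"
      by (simp add: g_def j norm_mult)
    also have "\<dots> \<le> (E * (1/2) ^ m) * (M * measure \<mu> (Q i))"
      using cell_integrand(2)[OF \<alpha> f Q(3,4)] atom
      by (intro mult_mono) (auto simp: E_def intro!: integral_nonneg_AE)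
    finally show "norm (LINT w|\<mu>. norm (g j w)) \<le> E * M * (measure \<mu> (Q (fst (prod_decode j))) * (1/2) ^ snd (prod_decode j))"
      by (simp add: j mult_ac)
  qed
  then have "(\<lambda>j. LINT w|\<mu>. g j w) sums (LINT w|\<mu>. (\<Sum>j. g j w))"
    using int point(2) by (intro sums_integral) auto
  then have "(\<lambda>j. of_real (\<alpha> / pi) * (LINT w|\<mu>. g j w)) sums toeplitz \<alpha> \<mu> f z"
    unfolding toeplitz_def using sums_unique[OF point(1)] by (intro sums_mult) simp
  moreover have "of_real (\<alpha> / pi) * (LINT w|\<mu>. g j w) =
     (case prod_decode j of (i, m) \<Rightarrow> cell_functional \<alpha> \<mu> (Q i) (a i) m f * cell_atom \<alpha> (a i) m z)" for j
    unfolding g_def cell_functional_def case_prod_beta integral_mult_right_zero by (simp only: mult_ac)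
  ultimately show ?thesis by simp
qed

end

context gaussian_space
begin

lemma toeplitz_linear:
  assumes "finite_borel_measure \<mu>" "f \<in> carr X" "g \<in> carr X"
  shows "toeplitz \<alpha> \<mu> (\<lambda>z. f z + g z) = (\<lambda>z. toeplitz \<alpha> \<mu> f z + toeplitz \<alpha> \<mu> g z)"
    and "toeplitz \<alpha> \<mu> (\<lambda>z. c * f z) = (\<lambda>z. c * toeplitz \<alpha> \<mu> f z)"
proof -
  interpret finite_borel_measure \<mu> by fact
  obtain C where C: "\<And>f z. f \<in> carr X \<Longrightarrow> wmod \<alpha> f z \<le> C * nrm X f"
    using pointwise by blast
  have int: "integrable \<mu> (\<lambda>w. fock_kernel \<alpha> z w * f w * of_real (exp (- \<alpha> * (norm w)\<^sup>2)))"
    if "f \<in> carr X" for f z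
    by (rule integrable_toeplitz_integrand[OF alpha_pos entire[OF that] C[OF that]])
  show "toeplitz \<alpha> \<mu> (\<lambda>z. f z + g z) = (\<lambda>z. toeplitz \<alpha> \<mu> f z + toeplitz \<alpha> \<mu> g z)"
    unfolding toeplitz_def ring_distribs(1)[of "fock_kernel \<alpha> _ _"] ring_distribs(2)
    using int assms by (simp add: ring_distribs del: of_real_exp)
  show "toeplitz \<alpha> \<mu> (\<lambda>z. c * f z) = (\<lambda>z. c * toeplitz \<alpha> \<mu> f z)"
  proof
    fix z
    have "(LINT w|\<mu>. fock_kernel \<alpha> z w * (c * f w) * of_real (exp (- \<alpha> * (norm w)\<^sup>2)))
        = (LINT w|\<mu>. c * (fock_kernel \<alpha> z w * f w * of_real (exp (- \<alpha> * (norm w)\<^sup>2))))"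
      by (simp add: mult_ac)
    then show "toeplitz \<alpha> \<mu> (\<lambda>z. c * f z) z = c * toeplitz \<alpha> \<mu> f z"
      by (simp add: toeplitz_def del: of_real_exp)
  qed
qed

lemma cell_functional_dual:
  assumes "finite_borel_measure \<mu>" "Q \<in> sets borel" "Q \<subseteq> ball a 1"
    and "C \<ge> 0" "\<And>f z. f \<in> carr X \<Longrightarrow> wmod \<alpha> f z \<le> C * nrm X f"
  shows "cell_functional \<alpha> \<mu> Q a m \<in> dual_space X"
    and "dual_norm X (cell_functional \<alpha> \<mu> Q a m) \<le> \<alpha> / pi * C * measure \<mu> Q"
proof -
  interpret finite_borel_measure \<mu> by fact
  have le: "norm (cell_functional \<alpha> \<mu> Q a m f) \<le> \<alpha> / pi * C * measure \<mu> Q * nrm X f" if "f \<in> carr X" for f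
    using norm_cell_functional_le[OF alpha_pos entire[OF that] assms(5)[OF that] assms(2,3), of m] by (simp add: mult_ac)
  have int: "integrable \<mu> (\<lambda>w. indicator Q w * (cell_weight \<alpha> a m w * f w))" if "f \<in> carr X" for f
    by (rule cell_integrand(1)[OF alpha_pos entire[OF that] assms(5)[OF that] assms(2,3)])
  have add: "cell_functional \<alpha> \<mu> Q a m (\<lambda>z. f z + g z) = cell_functional \<alpha> \<mu> Q a m f + cell_functional \<alpha> \<mu> Q a m g"
    if "f \<in> carr X" "g \<in> carr X" for f g
    unfolding cell_functional_def using int[OF that(1)] int[OF that(2)]
    by (simp add: distrib_left)
  have scale: "cell_functional \<alpha> \<mu> Q a m (\<lambda>z. c * f z) = c * cell_functional \<alpha> \<mu> Q a m f" for f c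
  proof -
    have "(LINT w|\<mu>. indicator Q w * (cell_weight \<alpha> a m w * (c * f w)))
        = (LINT w|\<mu>. c * (indicator Q w * (cell_weight \<alpha> a m w * f w)))"
      by (simp add: mult_ac)
    then show ?thesis by (simp add: cell_functional_def)
  qed
  show "cell_functional \<alpha> \<mu> Q a m \<in> dual_space X"
    unfolding dual_space_def using le add scale by blast
  show "dual_norm X (cell_functional \<alpha> \<mu> Q a m) \<le> \<alpha> / pi * C * measure \<mu> Q"
    using le assms(4) alpha_pos by (intro dual_norm_le) auto
qed

text \<open>The cells and their centres are chosen before \<open>\<mu>\<close>, and the constant depends only on the pointwise
  bound of \<open>X\<close>, the superposition constant of the target and \<open>\<alpha>\<close>. The remainder after \<open>n\<close> terms is
  again a superposition of the atoms, with the tail of the coefficients, which yields boundedness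
  (\<open>n = 0\<close>) and convergence at once.\<close>

proposition toeplitz_nuclear_rep:
  assumes "1 \<le> s"
  obtains C where "C > 0"
    "\<And>\<mu>. finite_borel_measure \<mu> \<Longrightarrow>
       bounded_operator X (fock \<alpha> s) (toeplitz \<alpha> \<mu>) \<and>
       (\<exists>\<phi> y. nuclear_rep X (fock \<alpha> s) (toeplitz \<alpha> \<mu>) \<phi> y \<and>
          (\<Sum>j. dual_norm X (\<phi> j) * nrm (fock \<alpha> s) (y j)) \<le> C * measure \<mu> UNIV)"
proof -
  let ?Y = "fock \<alpha> s"
  interpret Y: gaussian_space \<alpha> "fock \<alpha> s"
    using fock_gaussian_space[OF alpha_pos assms] .
  have "\<alpha> / 4 > 0" using alpha_pos by simp
  obtain S where S: "S > 0"
    "\<And>h a b f. (\<And>j. h j holomorphic_on UNIV) \<Longrightarrow> summable b \<Longrightarrow>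
       (\<And>j z. wmod \<alpha> (h j) z \<le> b j * gauss (\<alpha> / 4) (z - a j)) \<Longrightarrow> (\<And>z. (\<lambda>j. h j z) sums f z) \<Longrightarrow>
       f \<in> carr ?Y \<and> nrm ?Y f \<le> S * (\<Sum>j. b j)"
    using fock_superposition[OF alpha_pos assms \<open>\<alpha> / 4 > 0\<close>] by metis
  obtain C where C: "C > 0" "\<And>f z. f \<in> carr X \<Longrightarrow> wmod \<alpha> f z \<le> C * nrm X f"
    using pointwise_obtain by metis
  obtain a :: "nat \<Rightarrow> complex" and Q where
    Q: "disjoint_family Q" "(\<Union>i. Q i) = UNIV" "\<And>i. Q i \<in> sets borel" "\<And>i. Q i \<subseteq> ball (a i) 1"
    using unit_disc_partition by metis
  define ci mi where "ci j = fst (prod_decode j)" and "mi j = snd (prod_decode j)" for j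
  define y where "y j = cell_atom \<alpha> (a (ci j)) (mi j)" for j
  have y_bound: "wmod \<alpha> (y j) z \<le> (1/2) ^ mi j * exp (4 * \<alpha>) * gauss (\<alpha> / 4) (z - a (ci j))" for j z
    unfolding y_def by (rule wmod_cell_atom_le[OF alpha_pos])
  have y_entire: "y j holomorphic_on UNIV" for j
    unfolding y_def by (rule entire_cell_atom)
  have y_mem: "y j \<in> carr ?Y \<and> nrm ?Y (y j) \<le> S * ((1/2) ^ mi j * exp (4 * \<alpha>))" for j
  proof -
    \<comment> \<open>a single atom is a superposition with one nonzero coefficient\<close>
    let ?b = "\<lambda>k. if k = 0 then (1/2) ^ mi j * exp (4 * \<alpha>) else (0::real)"
    have b: "?b sums ((1/2) ^ mi j * exp (4 * \<alpha>))"
      using sums_single[of 0 "\<lambda>_. (1/2) ^ mi j * exp (4 * \<alpha>)"] by simp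
    have "y j \<in> carr ?Y \<and> nrm ?Y (y j) \<le> S * suminf ?b"
    proof (rule S(2)[where h = "\<lambda>k z. if k = 0 then y j z else 0" and a = "\<lambda>_. a (ci j)"])
      show "(\<lambda>z. if k = 0 then y j z else 0) holomorphic_on UNIV" for k :: nat
        using y_entire by (cases "k = 0") auto
      show "summable ?b" using b by (rule sums_summable)
      show "wmod \<alpha> (\<lambda>z. if k = 0 then y j z else 0) z \<le> ?b k * gauss (\<alpha> / 4) (z - a (ci j))" for k :: nat and z
        using y_bound[of j z] by (cases "k = 0") (auto simp: wmod_eq)
      show "(\<lambda>k. if k = 0 then y j z else 0) sums y j z" for z
        using sums_single[of 0 "\<lambda>_. y j z"] by simp
    qed
    then show ?thesis using sums_unique[OF b] by simp
  qed
  define K where "K = \<alpha> / pi * C * S * exp (4 * \<alpha>)"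
  have K: "K > 0" using alpha_pos C S by (simp add: K_def)
  show ?thesis
  proof (rule that[of "K * 2"])
    show "K * 2 > 0" using K by simp
    fix \<mu> :: "complex measure" assume \<mu>: "finite_borel_measure \<mu>"
    interpret finite_borel_measure \<mu> by fact
    define \<phi> where "\<phi> j = cell_functional \<alpha> \<mu> (Q (ci j)) (a (ci j)) (mi j)" for j
    define b where "b j = measure \<mu> (Q (ci j)) * (1/2) ^ mi j" for j
    have meas_sums: "(\<lambda>i. measure \<mu> (Q i)) sums measure \<mu> UNIV"
      using finite_measure_UNION[of Q] Q(1,2,3) by (auto simp: sets_eq)
    have "b sums (measure \<mu> UNIV * (1 / (1 - 1/2)))"
      unfolding b_def ci_def mi_def by (intro sums_prod_decode_mult meas_sums geometric_sums) auto
    then have b: "b sums (measure \<mu> UNIV * 2)" by simp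
    have b0: "b j \<ge> 0" for j by (simp add: b_def)
    have \<phi>_dual: "\<phi> j \<in> dual_space X" "dual_norm X (\<phi> j) \<le> \<alpha> / pi * C * measure \<mu> (Q (ci j))" for j
      unfolding \<phi>_def using cell_functional_dual[OF \<mu> Q(3,4) less_imp_le[OF C(1)] C(2)] by auto
    have prod_le: "dual_norm X (\<phi> j) * nrm ?Y (y j) \<le> K * b j" for j
    proof -
      have "dual_norm X (\<phi> j) * nrm ?Y (y j)
          \<le> (\<alpha> / pi * C * measure \<mu> (Q (ci j))) * (S * ((1/2) ^ mi j * exp (4 * \<alpha>)))"
        using \<phi>_dual y_mem[of j] alpha_pos C Y.nrm_nonneg[of "y j"]
        by (intro mult_mono) auto
      then show ?thesis by (simp add: K_def b_def mult_ac)
    qed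
    have prod_nonneg: "0 \<le> dual_norm X (\<phi> j) * nrm ?Y (y j)" for j
      using dual_norm_nonneg[OF \<phi>_dual(1)] Y.nrm_nonneg[of "y j"] y_mem[of j] by simp
    have Kb: "summable (\<lambda>j. K * b j)"
      using b by (intro summable_mult sums_summable)
    have summ: "summable (\<lambda>j. dual_norm X (\<phi> j) * nrm ?Y (y j))"
      using prod_le prod_nonneg by (intro summable_comparison_test'[OF Kb]) auto
    have "(\<Sum>j. dual_norm X (\<phi> j) * nrm ?Y (y j)) \<le> (\<Sum>j. K * b j)"
      by (intro suminf_le prod_le summ Kb)
    also have "\<dots> = K * 2 * measure \<mu> UNIV"
      using sums_unique[OF sums_mult[OF b, of K]] by simp
    finally have total: "(\<Sum>j. dual_norm X (\<phi> j) * nrm ?Y (y j)) \<le> K * 2 * measure \<mu> UNIV" .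
    define L where "L = \<alpha> / pi * C * exp (4 * \<alpha>)"
    have tail: "(\<lambda>z. toeplitz \<alpha> \<mu> f z - (\<Sum>j<n. \<phi> j f * y j z)) \<in> carr ?Y \<and>
        nrm ?Y (\<lambda>z. toeplitz \<alpha> \<mu> f z - (\<Sum>j<n. \<phi> j f * y j z)) \<le> S * (L * nrm X f * (\<Sum>j. b (j + n)))"
      if f: "f \<in> carr X" for f n
    proof -
      have bs: "summable (\<lambda>j. b (j + n))"
        using sums_summable[OF b] by (subst summable_iff_shift)
      have "(\<lambda>z. toeplitz \<alpha> \<mu> f z - (\<Sum>j<n. \<phi> j f * y j z)) \<in> carr ?Y \<and>
        nrm ?Y (\<lambda>z. toeplitz \<alpha> \<mu> f z - (\<Sum>j<n. \<phi> j f * y j z)) \<le> S * (\<Sum>j. L * nrm X f * b (j + n))"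
      proof (rule S(2)[where h = "\<lambda>j z. \<phi> (j + n) f * y (j + n) z" and a = "\<lambda>j. a (ci (j + n))"])
        show "(\<lambda>z. \<phi> (j + n) f * y (j + n) z) holomorphic_on UNIV" for j
          by (intro holomorphic_intros y_entire)
        show "summable (\<lambda>j. L * nrm X f * b (j + n))" using bs by (rule summable_mult)
        show "wmod \<alpha> (\<lambda>z. \<phi> (j + n) f * y (j + n) z) z \<le> L * nrm X f * b (j + n) * gauss (\<alpha> / 4) (z - a (ci (j + n)))" for j z
        proof -
          have "norm (\<phi> (j + n) f) \<le> \<alpha> / pi * C * measure \<mu> (Q (ci (j + n))) * nrm X f"
            using norm_le_dual_norm[OF \<phi>_dual(1) f] mult_right_mono[OF \<phi>_dual(2) nrm_nonneg[OF f]]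
            by (rule order_trans)
          then have "norm (\<phi> (j + n) f) * wmod \<alpha> (y (j + n)) z \<le>
             (\<alpha> / pi * C * measure \<mu> (Q (ci (j + n))) * nrm X f) * ((1/2) ^ mi (j + n) * exp (4 * \<alpha>) * gauss (\<alpha> / 4) (z - a (ci (j + n))))"
            using alpha_pos C nrm_nonneg[OF f] by (intro mult_mono y_bound) auto
          then show ?thesis by (simp add: wmod_scale L_def b_def mult_ac)
        qed
        show "(\<lambda>j. \<phi> (j + n) f * y (j + n) z) sums (toeplitz \<alpha> \<mu> f z - (\<Sum>j<n. \<phi> j f * y j z))" for z
        proof (rule sums_split_initial_segment)
          show "(\<lambda>j. \<phi> j f * y j z) sums toeplitz \<alpha> \<mu> f z"
            using toeplitz_cell_sums[OF alpha_pos entire[OF f] C(2)[OF f] Q, of z]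
            by (simp add: \<phi>_def y_def ci_def mi_def case_prod_beta)
        qed
      qed
      then show ?thesis using suminf_mult[OF bs, of "L * nrm X f"] by simp
    qed
    have Tb: "toeplitz \<alpha> \<mu> f \<in> carr ?Y" "nrm ?Y (toeplitz \<alpha> \<mu> f) \<le> (S * L * suminf b) * nrm X f"
      if "f \<in> carr X" for f
      using tail[OF that, of 0] by (simp_all add: mult_ac)
    have bdd: "bounded_operator X ?Y (toeplitz \<alpha> \<mu>)"
      unfolding bounded_operator_def using Tb toeplitz_linear[OF \<mu>] by blast
    have "(\<lambda>n. nrm ?Y (\<lambda>z. toeplitz \<alpha> \<mu> f z - (\<Sum>j<n. \<phi> j f * y j z))) \<longlonglongrightarrow> 0" if f: "f \<in> carr X" for f
    proof -
      have "(\<lambda>n. suminf b - (\<Sum>j<n. b j)) \<longlonglongrightarrow> suminf b - suminf b"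
        by (intro tendsto_intros summable_LIMSEQ sums_summable[OF b])
      then have "(\<lambda>n. \<Sum>j. b (j + n)) \<longlonglongrightarrow> 0"
        using suminf_minus_initial_segment[OF sums_summable[OF b]] by simp
      then have "(\<lambda>n. S * (L * nrm X f * (\<Sum>j. b (j + n)))) \<longlonglongrightarrow> S * (L * nrm X f * 0)"
        by (intro tendsto_mult_left)
      then have lim: "(\<lambda>n. S * (L * nrm X f * (\<Sum>j. b (j + n)))) \<longlonglongrightarrow> 0" by simp
      show ?thesis
        by (rule tendsto_sandwich[OF _ _ tendsto_const lim]) (use tail[OF f] Y.nrm_nonneg in auto)
    qed
    then have "nuclear_rep X ?Y (toeplitz \<alpha> \<mu>) \<phi> y"
      unfolding nuclear_rep_def using \<phi>_dual(1) y_mem summ by blast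
    with bdd total show "bounded_operator X ?Y (toeplitz \<alpha> \<mu>) \<and>
       (\<exists>\<phi> y. nuclear_rep X ?Y (toeplitz \<alpha> \<mu>) \<phi> y \<and>
          (\<Sum>j. dual_norm X (\<phi> j) * nrm ?Y (y j)) \<le> K * 2 * measure \<mu> UNIV)"
      by blast
  qed
qed

end

text \<open>For fixed \<open>z\<close>, \<open>f \<mapsto> T f z - T' f z\<close> is a bounded functional because evaluations are bounded on the
  target; it vanishes on the kernels.\<close>

lemma (in dilation_continuous_space) bounded_extension_unique:
  assumes "gaussian_space \<alpha> Y" "bounded_operator X Y T" "bounded_operator X Y T'"
    and "\<And>f. f \<in> kernel_span \<alpha> \<Longrightarrow> T f = T' f" and f: "f \<in> carr X"
  shows "T f = T' f"
proof
  fix z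
  interpret Y: gaussian_space \<alpha> Y by fact
  obtain C where C: "C > 0" "\<And>f z. f \<in> carr Y \<Longrightarrow> wmod \<alpha> f z \<le> C * nrm Y f"
    using Y.pointwise_obtain by metis
  have bd: "\<exists>B. \<forall>f\<in>carr X. norm (T f z) \<le> B * nrm X f" if "bounded_operator X Y T" for T
  proof -
    have "\<exists>A. \<forall>f\<in>carr X. nrm Y (T f) \<le> A * nrm X f"
      using \<open>bounded_operator X Y T\<close> by (simp add: bounded_operator_def)
    then obtain A where A: "\<And>f. f \<in> carr X \<Longrightarrow> nrm Y (T f) \<le> A * nrm X f"
      by blast
    have "norm (T f z) \<le> (C * A * exp (\<alpha> / 2 * (norm z)\<^sup>2)) * nrm X f" if "f \<in> carr X" for f
    proof -
      have "T f \<in> carr Y" using \<open>bounded_operator X Y T\<close> that by (simp add: bounded_operator_def)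
      then have "wmod \<alpha> (T f) z \<le> C * nrm Y (T f)" by (rule C(2))
      also have "\<dots> \<le> C * (A * nrm X f)" using A[OF that] C(1) by (intro mult_left_mono) auto
      finally have "norm (T f z) \<le> C * (A * nrm X f) * exp (\<alpha> / 2 * (norm z)\<^sup>2)"
        by (rule norm_le_of_wmod_le)
      then show ?thesis by (simp add: mult_ac)
    qed
    then show ?thesis by blast
  qed
  obtain A B where AB: "\<And>f. f \<in> carr X \<Longrightarrow> norm (T f z) \<le> A * nrm X f"
    "\<And>f. f \<in> carr X \<Longrightarrow> norm (T' f z) \<le> B * nrm X f"
    using bd[OF assms(2)] bd[OF assms(3)] by blast
  have "norm (T f z - T' f z) \<le> (A + B) * nrm X f" if "f \<in> carr X" for f
    using norm_triangle_ineq4[of "T f z" "T' f z"] AB[OF that] by (simp add: algebra_simps)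
  then have "\<exists>C. \<forall>f\<in>carr X. norm (T f z - T' f z) \<le> C * nrm X f"
    by blast
  moreover have "T (\<lambda>z. f z + g z) = (\<lambda>z. T f z + T g z)" "T' (\<lambda>z. f z + g z) = (\<lambda>z. T' f z + T' g z)"
    "T (\<lambda>z. c * f z) = (\<lambda>z. c * T f z)" "T' (\<lambda>z. c * f z) = (\<lambda>z. c * T' f z)"
    if "f \<in> carr X" "g \<in> carr X" for f g c
    using assms(2,3) that by (simp_all add: bounded_operator_def)
  ultimately have "(\<lambda>f. T f z - T' f z) \<in> dual_space X"
    by (simp add: dual_space_def algebra_simps)
  then have "T f z - T' f z = 0"
    by (rule kernel_span_total) (use assms(4) f in auto)
  then show "T f z = T' f z" by simp
qed

section \<open>Sampling on separated sets\<close>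

definition unit_separated :: "complex set \<Rightarrow> bool" where
  "unit_separated A \<longleftrightarrow> finite A \<and> (\<forall>z\<in>A. \<forall>w\<in>A. z \<noteq> w \<longrightarrow> 1 \<le> dist z w)"

text \<open>The discs around the points of a separated set are disjoint because \<open>2 * 3/8 < 1\<close>.\<close>

lemma sum_disc_integrals_le:
  fixes u :: "complex \<Rightarrow> real"
  assumes A: "unit_separated A" and u: "integrable lborel u" "\<And>w. u w \<ge> 0"
  shows "(\<Sum>z\<in>A. LINT w|lborel. indicator (cball z (3/8)) w * u w) \<le> (LINT w|lborel. u w)"
proof -
  have fin: "finite A" using A by (simp add: unit_separated_def)
  have int: "integrable lborel (\<lambda>w. indicator (cball z (3/8)) w * u w)" for z
    using integrable_real_mult_indicator[OF _ u(1), of "cball z (3/8)"] by (simp add: mult.commute)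
  have le: "(\<Sum>z\<in>A. indicator (cball z (3/8)) w) \<le> (1::real)" for w
  proof (cases "\<exists>z\<in>A. w \<in> cball z (3/8)")
    case True
    then obtain z where z: "z \<in> A" "dist z w \<le> 3/8" by auto
    have "w \<notin> cball z' (3/8)" if "z' \<in> A" "z' \<noteq> z" for z'
    proof -
      have "1 \<le> dist z z'" using A z that by (auto simp: unit_separated_def)
      then show ?thesis using z(2) dist_triangle2[of z z' w] by (auto simp: dist_commute)
    qed
    then have "(\<Sum>z'\<in>A. indicator (cball z' (3/8)) w) = (\<Sum>z'\<in>A. if z' = z then 1 else (0::real))"
      using z by (intro sum.cong) auto
    then show ?thesis using fin z by simp
  next
    case False
    then have "(\<Sum>z\<in>A. indicator (cball z (3/8)) w) = (0::real)"
      by (intro sum.neutral) auto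
    then show ?thesis by simp
  qed
  have "(\<Sum>z\<in>A. LINT w|lborel. indicator (cball z (3/8)) w * u w)
      = (LINT w|lborel. (\<Sum>z\<in>A. indicator (cball z (3/8)) w) * u w)"
    using int by (simp add: sum_distrib_right)
  also have "\<dots> \<le> (LINT w|lborel. u w)"
  proof (intro integral_mono u(1))
    show "integrable lborel (\<lambda>w. (\<Sum>z\<in>A. indicator (cball z (3/8)) w) * u w)"
      using int by (simp add: sum_distrib_right)
    show "(\<Sum>z\<in>A. indicator (cball z (3/8)) w) * u w \<le> u w" for w
      using mult_right_mono[OF le u(2)] by simp
  qed
  finally show ?thesis .
qed

text \<open>Each value of the Gaussian is at most a constant times the integral of a wider Gaussian over the
  disc around the point, because \<open>|u - w|^2 \<le> 1 + 2 |z - w|^2\<close> for \<open>u\<close> in the disc around \<open>z\<close>; the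
  discs are disjoint.\<close>

lemma sum_gauss_le:
  assumes "c > 0"
  obtains S where "S > 0" "\<And>A w. unit_separated A \<Longrightarrow> (\<Sum>z\<in>A. gauss c (w - z)) \<le> S"
proof -
  define V where "V = measure lborel (cball (0::complex) (3/8))"
  have V: "V > 0" "measure lborel (cball z (3/8)) = V" for z :: complex
    by (simp_all add: V_def content_cball_pos content_cball)
  define G where "G = (LINT u|lborel. gauss (c / 2) u)"
  have "G \<ge> 0" unfolding G_def by (intro integral_nonneg_AE) simp
  show ?thesis
  proof (rule that[of "exp (c / 2) / V * (G + 1)"])
    show "exp (c / 2) / V * (G + 1) > 0" using V \<open>G \<ge> 0\<close> by simp
    fix A w assume A: "unit_separated A"
    have c2: "c / 2 > 0" using assms by simp
    have int: "integrable lborel (\<lambda>u. gauss (c / 2) (u - w))" "(LINT u|lborel. gauss (c / 2) (u - w)) = G"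
      using integral_gauss_translate[OF c2, of w] by (simp_all add: G_def)
    have gauss_le: "gauss c (w - z) \<le> exp (c / 2) / V * (LINT u|lborel. indicator (cball z (3/8)) u * gauss (c / 2) (u - w))" for z
    proof -
      have "(LINT u|lborel. indicator (cball z (3/8)) u * (exp (- c / 2) * gauss c (w - z)))
         \<le> (LINT u|lborel. indicator (cball z (3/8)) u * gauss (c / 2) (u - w))"
      proof (rule integral_mono)
        show "integrable lborel (\<lambda>u. indicator (cball z (3/8)) u * (exp (- c / 2) * gauss c (w - z)))"
          using emeasure_lborel_cball_finite[of z "3/8"]
          by (intro integrable_mult_left integrable_real_indicator) auto
        show "integrable lborel (\<lambda>u. indicator (cball z (3/8)) u * gauss (c / 2) (u - w))"
          using integrable_real_mult_indicator[OF _ int(1), of "cball z (3/8)"] by (simp add: mult.commute)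
        fix u
        have "exp (- c / 2) * gauss c (w - z) \<le> gauss (c / 2) (u - w)" if u: "norm (u - z) \<le> 3/8"
        proof -
          have "norm (u - w) \<le> norm (u - z) + norm (w - z)"
            using norm_triangle_ineq4[of "u - z" "w - z"] by simp
          then have "(norm (u - w))\<^sup>2 \<le> (norm (u - z) + norm (w - z))\<^sup>2"
            by (intro power_mono) auto
          also have "\<dots> \<le> 2 * (norm (u - z))\<^sup>2 + 2 * (norm (w - z))\<^sup>2"
            using sum_squares_bound[of "norm (u - z)" "norm (w - z)"] by (simp add: power2_sum)
          also have "(norm (u - z))\<^sup>2 \<le> (3/8)\<^sup>2"
            using u by (intro power_mono) auto
          finally have "(norm (u - w))\<^sup>2 \<le> 1 + 2 * (norm (w - z))\<^sup>2"
            by (simp add: power2_eq_square)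
          then have "c / 2 * (norm (u - w))\<^sup>2 \<le> c / 2 * (1 + 2 * (norm (w - z))\<^sup>2)"
            using assms by (intro mult_left_mono) auto
          then show ?thesis
            unfolding gauss_def exp_add[symmetric] by (simp add: algebra_simps)
        qed
        then show "indicator (cball z (3/8)) u * (exp (- c / 2) * gauss c (w - z)) \<le> indicator (cball z (3/8)) u * gauss (c / 2) (u - w)"
          by (auto simp: indicator_def dist_norm norm_minus_commute)
      qed
      then have "V * (exp (- c / 2) * gauss c (w - z)) \<le> (LINT u|lborel. indicator (cball z (3/8)) u * gauss (c / 2) (u - w))"
        by (simp add: V)
      then show ?thesis using V(1) by (simp add: exp_minus field_simps)
    qed
    have "(\<Sum>z\<in>A. gauss c (w - z))
       \<le> (\<Sum>z\<in>A. exp (c / 2) / V * (LINT u|lborel. indicator (cball z (3/8)) u * gauss (c / 2) (u - w)))"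
      by (intro sum_mono gauss_le)
    also have "\<dots> = exp (c / 2) / V * (\<Sum>z\<in>A. LINT u|lborel. indicator (cball z (3/8)) u * gauss (c / 2) (u - w))"
      by (simp add: sum_distrib_left)
    also have "\<dots> \<le> exp (c / 2) / V * G"
      using sum_disc_integrals_le[OF A int(1)] V(1) unfolding int(2) by (intro mult_left_mono) auto
    also have "\<dots> \<le> exp (c / 2) / V * (G + 1)"
      using V(1) by (intro mult_left_mono) auto
    finally show "(\<Sum>z\<in>A. gauss c (w - z)) \<le> exp (c / 2) / V * (G + 1)" .
  qed
qed

lemma wmod_kernel: "wmod \<alpha> (\<lambda>w. fock_kernel \<alpha> w z) w = exp (\<alpha> / 2 * (norm z)\<^sup>2) * gauss (\<alpha> / 2) (w - z)"
proof -
  have "(norm (w + - z))\<^sup>2 = (norm w)\<^sup>2 + 2 * Re (- z * cnj w) + (norm (- z))\<^sup>2"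
    by (rule norm_add_sqr_complex)
  then have sq: "(norm (w - z))\<^sup>2 = (norm w)\<^sup>2 - 2 * Re (w * cnj z) + (norm z)\<^sup>2"
    by (simp add: algebra_simps)
  have "norm (fock_kernel \<alpha> w z) = exp (\<alpha> * Re (w * cnj z))"
    by (simp add: fock_kernel_def mult.assoc)
  then show ?thesis
    unfolding wmod_eq gauss_def sq by (simp add: algebra_simps flip: exp_add)
qed

text \<open>Sampling of \<open>y\<close> on \<open>A\<close> followed by synthesis with kernels. Up to a constant, the sum is a Riemann
  sum of the reproducing formula when \<open>A\<close> is a lattice.\<close>

definition sampled_kernel_sum :: "real \<Rightarrow> complex set \<Rightarrow> (complex \<Rightarrow> complex) \<Rightarrow> complex \<Rightarrow> complex" where
  "sampled_kernel_sum \<alpha> A y w = (\<Sum>z\<in>A. (y z * of_real (gauss \<alpha> z)) * fock_kernel \<alpha> w z)"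

lemma wmod_sampled_kernel_sum_le:
  "wmod \<alpha> (sampled_kernel_sum \<alpha> A y) w \<le> (\<Sum>z\<in>A. wmod \<alpha> y z * gauss (\<alpha> / 2) (w - z))"
proof -
  have "wmod \<alpha> (sampled_kernel_sum \<alpha> A y) w
      \<le> (\<Sum>z\<in>A. wmod \<alpha> (\<lambda>w. (y z * of_real (gauss \<alpha> z)) * fock_kernel \<alpha> w z) w)"
    unfolding sampled_kernel_sum_def[abs_def] by (rule wmod_sum_le)
  also have "\<dots> = (\<Sum>z\<in>A. wmod \<alpha> y z * gauss (\<alpha> / 2) (w - z))"
  proof (rule sum.cong[OF refl])
    fix z
    have "gauss \<alpha> z * exp (\<alpha> / 2 * (norm z)\<^sup>2) = gauss (\<alpha> / 2) z"
      unfolding gauss_def exp_add[symmetric] by (simp add: algebra_simps)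
    moreover have "wmod \<alpha> (\<lambda>w. (y z * of_real (gauss \<alpha> z)) * fock_kernel \<alpha> w z) w
        = norm (y z) * (gauss \<alpha> z * exp (\<alpha> / 2 * (norm z)\<^sup>2)) * gauss (\<alpha> / 2) (w - z)"
      unfolding wmod_scale wmod_kernel by (simp add: norm_mult)
    ultimately show "wmod \<alpha> (\<lambda>w. (y z * of_real (gauss \<alpha> z)) * fock_kernel \<alpha> w z) w = wmod \<alpha> y z * gauss (\<alpha> / 2) (w - z)"
      by (simp add: wmod_eq[of \<alpha> y])
  qed
  finally show ?thesis .
qed

lemma (in gaussian_space) sampled_kernel_sum_mem: "sampled_kernel_sum \<alpha> A y \<in> carr X"
  unfolding sampled_kernel_sum_def[abs_def] by (rule sum_mem[OF kernel_mem])

definition sampling_bounded :: "real \<Rightarrow> complex fun_space \<Rightarrow> complex fun_space \<Rightarrow> bool" where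
  "sampling_bounded \<alpha> X Y \<longleftrightarrow>
     (\<exists>C. \<forall>A. unit_separated A \<longrightarrow> (\<forall>y\<in>carr Y. nrm X (sampled_kernel_sum \<alpha> A y) \<le> C * nrm Y y))"

lemma sampling_bounded_fock_inf0:
  assumes "\<alpha> > 0" "1 \<le> s"
  shows "sampling_bounded \<alpha> (fock_inf0 \<alpha>) (fock \<alpha> s)"
proof -
  let ?Y = "fock \<alpha> s"
  interpret Y: gaussian_space \<alpha> "fock \<alpha> s" using fock_gaussian_space[OF assms] .
  obtain C where C: "C > 0" "\<And>f z. f \<in> carr ?Y \<Longrightarrow> wmod \<alpha> f z \<le> C * nrm ?Y f"
    using Y.pointwise_obtain by metis
  have "\<alpha> / 2 > 0" using assms by simp
  then obtain S where S: "S > 0" "\<And>A w. unit_separated A \<Longrightarrow> (\<Sum>z\<in>A. gauss (\<alpha> / 2) (w - z)) \<le> S"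
    using sum_gauss_le by metis
  have "nrm (fock_inf0 \<alpha>) (sampled_kernel_sum \<alpha> A y) \<le> (C * S) * nrm ?Y y"
    if A: "unit_separated A" and y: "y \<in> carr ?Y" for A y
  proof -
    have "wmod \<alpha> (sampled_kernel_sum \<alpha> A y) w \<le> (C * S) * nrm ?Y y" for w
    proof -
      have "wmod \<alpha> (sampled_kernel_sum \<alpha> A y) w \<le> (\<Sum>z\<in>A. wmod \<alpha> y z * gauss (\<alpha> / 2) (w - z))"
        by (rule wmod_sampled_kernel_sum_le)
      also have "\<dots> \<le> (\<Sum>z\<in>A. (C * nrm ?Y y) * gauss (\<alpha> / 2) (w - z))"
        by (intro sum_mono mult_right_mono C y) simp
      also have "\<dots> = (C * nrm ?Y y) * (\<Sum>z\<in>A. gauss (\<alpha> / 2) (w - z))"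
        by (simp add: sum_distrib_left)
      also have "\<dots> \<le> (C * nrm ?Y y) * S"
        using C(1) Y.nrm_nonneg[OF y] by (intro mult_left_mono S A) auto
      finally show ?thesis by (simp add: mult_ac)
    qed
    then have "nrm (fock_inf \<alpha>) (sampled_kernel_sum \<alpha> A y) \<le> (C * S) * nrm ?Y y"
      by (rule fock_inf_nrm_le)
    then show ?thesis by (simp add: fock_inf0_def)
  qed
  then show ?thesis unfolding sampling_bounded_def by blast
qed

text \<open>A discrete analogue of \<open>F^q \<subseteq> F^p\<close>: the samples are uniformly bounded by the norm of \<open>y\<close>, which
  reduces the exponent \<open>p\<close> to \<open>q\<close>, and by the local mean value inequality the sum of their \<open>q\<close>-th
  powers is controlled by integrals over disjoint discs.\<close>

lemma sum_samples_le:
  assumes "\<alpha> > 0" "1 \<le> q" "q \<le> p"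
  obtains B where "B > 0"
    "\<And>A y. unit_separated A \<Longrightarrow> y \<in> carr (fock_fin \<alpha> q) \<Longrightarrow>
       (\<Sum>z\<in>A. wmod \<alpha> y z powr p) \<le> B * nrm (fock_fin \<alpha> q) y powr p"
proof -
  let ?Y = "fock_fin \<alpha> q"
  interpret Y: gaussian_space \<alpha> "fock_fin \<alpha> q" using fock_fin_gaussian_space[OF assms(1,2)] .
  obtain C where C: "C > 0" "\<And>f z. f \<in> carr ?Y \<Longrightarrow> wmod \<alpha> f z \<le> C * nrm ?Y f"
    using Y.pointwise_obtain by metis
  obtain K where K: "K > 0"
    "\<And>h z. h holomorphic_on UNIV \<Longrightarrow>
      wmod \<alpha> h z powr q \<le> K * (LINT w|lborel. indicator (cball z (3/8)) w * wmod \<alpha> h w powr q)"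
    using wmod_powr_le_local_mean[OF assms(1,2)] by metis
  define B where "B = C powr (p - q) * (K * (2 * pi / (q * \<alpha>)))"
  show ?thesis
  proof (rule that[of B])
    show "B > 0" using C K assms by (simp add: B_def)
    fix A y assume A: "unit_separated A" and y: "y \<in> carr ?Y"
    let ?n = "nrm ?Y y"
    have n0: "?n \<ge> 0" using Y.nrm_nonneg[OF y] .
    have y': "y holomorphic_on UNIV" "integrable lborel (\<lambda>w. wmod \<alpha> y w powr q)"
      using y by (simp_all add: fock_fin_def)
    have split: "wmod \<alpha> y z powr p \<le> (C * ?n) powr (p - q) * wmod \<alpha> y z powr q" for z
    proof -
      have "wmod \<alpha> y z powr p = wmod \<alpha> y z powr (p - q) * wmod \<alpha> y z powr q"
        by (simp flip: powr_add)
      also have "\<dots> \<le> (C * ?n) powr (p - q) * wmod \<alpha> y z powr q"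
        using assms by (intro mult_right_mono powr_mono2 C y) auto
      finally show ?thesis .
    qed
    have "(\<Sum>z\<in>A. wmod \<alpha> y z powr q) \<le> (\<Sum>z\<in>A. K * (LINT w|lborel. indicator (cball z (3/8)) w * wmod \<alpha> y w powr q))"
      by (intro sum_mono K y')
    also have "\<dots> = K * (\<Sum>z\<in>A. LINT w|lborel. indicator (cball z (3/8)) w * wmod \<alpha> y w powr q)"
      by (simp add: sum_distrib_left)
    also have "\<dots> \<le> K * (LINT w|lborel. wmod \<alpha> y w powr q)"
      using K(1) by (intro mult_left_mono sum_disc_integrals_le A y') auto
    also have "\<dots> = K * (2 * pi / (q * \<alpha>)) * ?n powr q"
      using assms by (simp add: fock_fin_nrm_powr)
    finally have sq: "(\<Sum>z\<in>A. wmod \<alpha> y z powr q) \<le> K * (2 * pi / (q * \<alpha>)) * ?n powr q" .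
    have "(\<Sum>z\<in>A. wmod \<alpha> y z powr p) \<le> (\<Sum>z\<in>A. (C * ?n) powr (p - q) * wmod \<alpha> y z powr q)"
      by (intro sum_mono split)
    also have "\<dots> = (C * ?n) powr (p - q) * (\<Sum>z\<in>A. wmod \<alpha> y z powr q)"
      by (simp add: sum_distrib_left)
    also have "\<dots> \<le> (C * ?n) powr (p - q) * (K * (2 * pi / (q * \<alpha>)) * ?n powr q)"
      by (intro mult_left_mono sq) auto
    also have "\<dots> = B * (?n powr (p - q) * ?n powr q)"
      using C(1) n0 by (simp add: B_def powr_mult)
    also have "?n powr (p - q) * ?n powr q = ?n powr p"
      by (simp flip: powr_add)
    finally show "(\<Sum>z\<in>A. wmod \<alpha> y z powr p) \<le> B * ?n powr p" .
  qed
qed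

text \<open>The weighted modulus of the synthesised function is at most a Gaussian average of the samples.
  Its \<open>p\<close>-th power is at most a Gaussian average \<open>W\<close> of their \<open>p\<close>-th powers, since the Gaussian
  weights have bounded sum, and \<open>W\<close> is integrated term by term.\<close>

lemma sampling_bounded_fock_fin:
  assumes "\<alpha> > 0" "1 \<le> q" "q \<le> p"
  shows "sampling_bounded \<alpha> (fock_fin \<alpha> p) (fock_fin \<alpha> q)"
proof -
  let ?Y = "fock_fin \<alpha> q"
  let ?X = "fock_fin \<alpha> p"
  have p: "1 \<le> p" using assms by simp
  interpret X: gaussian_space \<alpha> "fock_fin \<alpha> p" using fock_fin_gaussian_space[OF assms(1) p] .
  interpret Y: gaussian_space \<alpha> "fock_fin \<alpha> q" using fock_fin_gaussian_space[OF assms(1,2)] .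
  have a2: "\<alpha> / 2 > 0" using assms by simp
  then obtain S where S: "S > 0" "\<And>A w. unit_separated A \<Longrightarrow> (\<Sum>z\<in>A. gauss (\<alpha> / 2) (w - z)) \<le> S"
    using sum_gauss_le by metis
  obtain B where B: "B > 0"
    "\<And>A y. unit_separated A \<Longrightarrow> y \<in> carr ?Y \<Longrightarrow>
       (\<Sum>z\<in>A. wmod \<alpha> y z powr p) \<le> B * nrm ?Y y powr p"
    using sum_samples_le[OF assms] by metis
  define G where "G = (LINT w|lborel. gauss (\<alpha> / 2) w)"
  have G: "G \<ge> 0" unfolding G_def by (intro integral_nonneg_AE) simp
  define K where "K = 2 powr p * S powr (p - 1)"
  define R where "R = p * \<alpha> / (2 * pi) * (K * (G * B))"
  have "nrm ?X (sampled_kernel_sum \<alpha> A y) \<le> R powr (1 / p) * nrm ?Y y"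
    if A: "unit_separated A" and y: "y \<in> carr ?Y" for A y
  proof (rule le_of_powr_le)
    let ?F = "sampled_kernel_sum \<alpha> A y"
    have F: "?F \<in> carr ?X"
      by (rule X.sampled_kernel_sum_mem)
    show "nrm ?X ?F \<ge> 0" "nrm ?Y y \<ge> 0"
      using X.nrm_nonneg[OF F] Y.nrm_nonneg[OF y] .
    show "R \<ge> 0" "p > 0" using assms p G B S by (auto simp: R_def K_def)
    define W where "W w = (\<Sum>z\<in>A. wmod \<alpha> y z powr p * gauss (\<alpha> / 2) (w - z))" for w
    have jensen: "wmod \<alpha> ?F w powr p \<le> K * W w" for w
    proof -
      have lin: "wmod \<alpha> ?F w \<le> l * S + l powr (1 - p) * W w" if l: "l > 0" for l
      proof -
        have "wmod \<alpha> ?F w \<le> (\<Sum>z\<in>A. wmod \<alpha> y z * gauss (\<alpha> / 2) (w - z))"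
          by (rule wmod_sampled_kernel_sum_le)
        also have "\<dots> \<le> (\<Sum>z\<in>A. (l + l powr (1 - p) * wmod \<alpha> y z powr p) * gauss (\<alpha> / 2) (w - z))"
          by (intro sum_mono mult_right_mono le_add_scaled_powr l p) auto
        also have "\<dots> = l * (\<Sum>z\<in>A. gauss (\<alpha> / 2) (w - z)) + l powr (1 - p) * W w"
          by (simp add: W_def distrib_right sum.distrib sum_distrib_left mult.assoc)
        also have "\<dots> \<le> l * S + l powr (1 - p) * W w"
          using l by (intro add_right_mono mult_left_mono S A) auto
        finally show ?thesis .
      qed
      have "W w \<ge> 0" unfolding W_def by (intro sum_nonneg) auto
      then show ?thesis
        unfolding K_def using lin S(1) p by (intro powr_le_of_linear_bounds) auto
    qed
    have intW: "integrable lborel W" "(LINT w|lborel. W w) = (\<Sum>z\<in>A. wmod \<alpha> y z powr p) * G"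
      unfolding W_def using integral_gauss_translate[OF a2] by (simp_all add: G_def sum_distrib_right)
    have "nrm ?X ?F powr p = p * \<alpha> / (2 * pi) * (LINT w|lborel. wmod \<alpha> ?F w powr p)"
      by (rule fock_fin_nrm_powr[OF assms(1) p])
    also have "\<dots> \<le> p * \<alpha> / (2 * pi) * (LINT w|lborel. K * W w)"
      using assms p F intW jensen by (intro mult_left_mono integral_mono) (auto simp: fock_fin_def)
    also have "\<dots> = p * \<alpha> / (2 * pi) * (K * (G * (\<Sum>z\<in>A. wmod \<alpha> y z powr p)))"
      using intW by (simp add: mult_ac)
    also have "\<dots> \<le> p * \<alpha> / (2 * pi) * (K * (G * (B * nrm ?Y y powr p)))"
      using assms p G by (intro mult_left_mono B A y) (auto simp: K_def)
    also have "\<dots> = R * nrm ?Y y powr p"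
      by (simp add: R_def)
    finally show "nrm ?X ?F powr p \<le> R * nrm ?Y y powr p" .
  qed
  then show ?thesis unfolding sampling_bounded_def by blast
qed

section \<open>The discrete trace of a nuclear operator\<close>

text \<open>Convergence in the norm of \<open>Y\<close> implies pointwise convergence, so the finite sum over \<open>A\<close> can be
  exchanged with the nuclear series; linearity of \<open>\<phi>\<^sub>j\<close> then collects the kernels into one function.\<close>

lemma (in gaussian_space) kernel_trace_le:
  assumes Y: "gaussian_space \<alpha> Y" and T: "bounded_operator X Y T" and rep: "nuclear_rep X Y T \<phi> y"
    and C: "C \<ge> 0" "\<And>y. y \<in> carr Y \<Longrightarrow> nrm X (sampled_kernel_sum \<alpha> A y) \<le> C * nrm Y y"
  shows "norm (\<Sum>z\<in>A. of_real (gauss \<alpha> z) * T (\<lambda>w. fock_kernel \<alpha> w z) z) \<le> C * (\<Sum>j. dual_norm X (\<phi> j) * nrm Y (y j))"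
proof -
  interpret Y: gaussian_space \<alpha> Y by fact
  have \<phi>: "\<phi> j \<in> dual_space X" and y: "y j \<in> carr Y" for j
    using rep by (auto simp: nuclear_rep_def)
  have sm: "summable (\<lambda>j. dual_norm X (\<phi> j) * nrm Y (y j))"
    using rep by (simp add: nuclear_rep_def)
  have nn: "0 \<le> dual_norm X (\<phi> j) * nrm Y (y j)" for j
    using dual_norm_nonneg[OF \<phi>] Y.nrm_nonneg[OF y] by simp
  obtain P where P: "P > 0" "\<And>f z. f \<in> carr Y \<Longrightarrow> wmod \<alpha> f z \<le> P * nrm Y f"
    using Y.pointwise_obtain by metis
  have point: "(\<lambda>n. \<Sum>j<n. \<phi> j f * y j z) \<longlonglongrightarrow> T f z" if f: "f \<in> carr X" for f z
  proof -
    let ?r = "\<lambda>n z. T f z - (\<Sum>j<n. \<phi> j f * y j z)"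
    have r_mem: "?r n \<in> carr Y" for n
    proof -
      have "T f \<in> carr Y" using T f by (simp add: bounded_operator_def)
      then show ?thesis by (intro Y.diff_mem Y.sum_mem y)
    qed
    have "(\<lambda>n. nrm Y (?r n)) \<longlonglongrightarrow> 0"
      using rep f by (simp add: nuclear_rep_def)
    then have "(\<lambda>n. P * nrm Y (?r n) * exp (\<alpha> / 2 * (norm z)\<^sup>2)) \<longlonglongrightarrow> P * 0 * exp (\<alpha> / 2 * (norm z)\<^sup>2)"
      by (intro tendsto_intros)
    then have lim: "(\<lambda>n. P * nrm Y (?r n) * exp (\<alpha> / 2 * (norm z)\<^sup>2)) \<longlonglongrightarrow> 0" by simp
    have "(\<lambda>n. ?r n z) \<longlonglongrightarrow> 0"
      by (rule Lim_null_comparison[OF always_eventually lim])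
         (use norm_le_of_wmod_le[OF P(2)[OF r_mem]] in blast)
    from tendsto_diff[OF tendsto_const[of "T f z"] this] show ?thesis by simp
  qed
  have interchange: "(\<Sum>z\<in>A. of_real (gauss \<alpha> z) * (\<Sum>j<n. \<phi> j (\<lambda>w. fock_kernel \<alpha> w z) * y j z))
      = (\<Sum>j<n. \<phi> j (sampled_kernel_sum \<alpha> A (y j)))" for n
  proof -
    have "\<phi> j (sampled_kernel_sum \<alpha> A (y j)) = (\<Sum>z\<in>A. (y j z * of_real (gauss \<alpha> z)) * \<phi> j (\<lambda>w. fock_kernel \<alpha> w z))" for j
      unfolding sampled_kernel_sum_def[abs_def] by (rule dual_sum[OF \<phi> kernel_mem])
    then show ?thesis
      by (simp add: sum_distrib_left mult_ac) (rule sum.swap)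
  qed
  have bound: "norm (\<Sum>j<n. \<phi> j (sampled_kernel_sum \<alpha> A (y j))) \<le> C * (\<Sum>j. dual_norm X (\<phi> j) * nrm Y (y j))" for n
  proof -
    have "norm (\<phi> j (sampled_kernel_sum \<alpha> A (y j))) \<le> C * (dual_norm X (\<phi> j) * nrm Y (y j))" for j
    proof -
      have "norm (\<phi> j (sampled_kernel_sum \<alpha> A (y j))) \<le> dual_norm X (\<phi> j) * nrm X (sampled_kernel_sum \<alpha> A (y j))"
        by (rule norm_le_dual_norm[OF \<phi> sampled_kernel_sum_mem])
      also have "\<dots> \<le> dual_norm X (\<phi> j) * (C * nrm Y (y j))"
        by (intro mult_left_mono C y dual_norm_nonneg \<phi>)
      finally show ?thesis by (simp add: mult_ac)
    qed
    then have "norm (\<Sum>j<n. \<phi> j (sampled_kernel_sum \<alpha> A (y j))) \<le> (\<Sum>j<n. C * (dual_norm X (\<phi> j) * nrm Y (y j)))"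
      by (intro order_trans[OF norm_sum] sum_mono)
    also have "\<dots> = C * (\<Sum>j<n. dual_norm X (\<phi> j) * nrm Y (y j))"
      by (simp add: sum_distrib_left)
    also have "\<dots> \<le> C * (\<Sum>j. dual_norm X (\<phi> j) * nrm Y (y j))"
      using C(1) by (intro mult_left_mono sum_le_suminf sm nn) auto
    finally show ?thesis .
  qed
  have "(\<lambda>n. \<Sum>z\<in>A. of_real (gauss \<alpha> z) * (\<Sum>j<n. \<phi> j (\<lambda>w. fock_kernel \<alpha> w z) * y j z))
      \<longlonglongrightarrow> (\<Sum>z\<in>A. of_real (gauss \<alpha> z) * T (\<lambda>w. fock_kernel \<alpha> w z) z)"
    by (intro tendsto_sum tendsto_mult_left point kernel_mem)
  then have "(\<lambda>n. norm (\<Sum>j<n. \<phi> j (sampled_kernel_sum \<alpha> A (y j))))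
      \<longlonglongrightarrow> norm (\<Sum>z\<in>A. of_real (gauss \<alpha> z) * T (\<lambda>w. fock_kernel \<alpha> w z) z)"
    unfolding interchange by (rule tendsto_norm)
  then show ?thesis
    by (rule LIMSEQ_le_const2) (use bound in auto)
qed

text \<open>This is the Berezin transform of \<open>\<mu>\<close>. Since \<open>exp(-\<alpha>|z - w|^2)\<close> is
  \<open>exp(-\<alpha>|z|^2) |K(2 z, w)| exp(-\<alpha>|w|^2)\<close>, it is integrable by admissibility at the point \<open>2 z\<close>.\<close>

lemma toeplitz_kernel_diagonal:
  assumes \<mu>: "admissible_measure \<alpha> \<mu>"
  shows "integrable \<mu> (\<lambda>w. gauss \<alpha> (z - w))"
    and "of_real (gauss \<alpha> z) * toeplitz \<alpha> \<mu> (\<lambda>w. fock_kernel \<alpha> w z) z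
           = of_real (\<alpha> / pi * (LINT w|\<mu>. gauss \<alpha> (z - w)))"
proof -
  have sets: "sets \<mu> = sets borel"
    using \<mu> by (simp add: admissible_measure_def)
  have meas: "borel_measurable \<mu> = borel_measurable borel"
    by (rule measurable_cong_sets[OF sets refl])
  have sq: "(norm (z - w))\<^sup>2 = (norm z)\<^sup>2 - 2 * Re (z * cnj w) + (norm w)\<^sup>2" for w
    using norm_add_sqr_complex[of z "- w"] by (simp add: algebra_simps)
  have abs_eq: "gauss \<alpha> (z - w) = gauss \<alpha> z * (norm (fock_kernel \<alpha> (2 * z) w) * exp (- \<alpha> * (norm w)\<^sup>2))" for w
  proof -
    have "norm (fock_kernel \<alpha> (2 * z) w) = exp (2 * \<alpha> * Re (z * cnj w))"
      by (simp add: fock_kernel_def algebra_simps)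
    then show ?thesis
      unfolding gauss_def sq by (simp add: algebra_simps flip: exp_add)
  qed
  show "integrable \<mu> (\<lambda>w. gauss \<alpha> (z - w))"
  proof (rule integrableI_bounded)
    show "(\<lambda>w. gauss \<alpha> (z - w)) \<in> borel_measurable \<mu>"
      unfolding meas by (intro borel_measurable_continuous_onI continuous_intros)
    have m: "(\<lambda>w. ennreal (norm (fock_kernel \<alpha> (2 * z) w) * exp (- \<alpha> * (norm w)\<^sup>2))) \<in> borel_measurable \<mu>"
      unfolding meas fock_kernel_def
      by (intro measurable_compose[OF _ measurable_ennreal] borel_measurable_continuous_onI continuous_intros)
    have "(\<integral>\<^sup>+w. ennreal (norm (gauss \<alpha> (z - w))) \<partial>\<mu>)
        = (\<integral>\<^sup>+w. ennreal (gauss \<alpha> z) * ennreal (norm (fock_kernel \<alpha> (2 * z) w) * exp (- \<alpha> * (norm w)\<^sup>2)) \<partial>\<mu>)"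
      unfolding abs_eq by (intro nn_integral_cong) (simp add: abs_mult flip: ennreal_mult)
    also have "\<dots> = ennreal (gauss \<alpha> z) * (\<integral>\<^sup>+w. ennreal (norm (fock_kernel \<alpha> (2 * z) w) * exp (- \<alpha> * (norm w)\<^sup>2)) \<partial>\<mu>)"
      by (rule nn_integral_cmult[OF m])
    also have "\<dots> < \<infinity>"
      using \<mu> by (auto simp: admissible_measure_def ennreal_mult_less_top)
    finally show "(\<integral>\<^sup>+w. ennreal (norm (gauss \<alpha> (z - w))) \<partial>\<mu>) < \<infinity>" .
  qed
  have eq: "of_real (gauss \<alpha> z) * (fock_kernel \<alpha> z w * fock_kernel \<alpha> w z * of_real (exp (- \<alpha> * (norm w)\<^sup>2)))
      = complex_of_real (gauss \<alpha> (z - w))" for w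
  proof -
    have "z * cnj w + w * cnj z = of_real (2 * Re (z * cnj w))"
      using complex_add_cnj[of "z * cnj w"] by (simp add: mult.commute)
    then have "of_real \<alpha> * (z * cnj w + w * cnj z) = complex_of_real (2 * \<alpha> * Re (z * cnj w))"
      by (simp only: of_real_mult of_real_numeral mult_ac)
    then have "of_real \<alpha> * z * cnj w + of_real \<alpha> * w * cnj z = complex_of_real (2 * \<alpha> * Re (z * cnj w))"
      by (simp only: distrib_left mult.assoc)
    then have "fock_kernel \<alpha> z w * fock_kernel \<alpha> w z = of_real (exp (2 * \<alpha> * Re (z * cnj w)))"
      unfolding fock_kernel_def exp_add[symmetric] by (simp only: exp_of_real)
    moreover have "gauss \<alpha> z * (exp (2 * \<alpha> * Re (z * cnj w)) * exp (- \<alpha> * (norm w)\<^sup>2)) = gauss \<alpha> (z - w)"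
      unfolding gauss_def sq exp_add[symmetric] by (simp add: algebra_simps)
    ultimately show ?thesis by (metis of_real_mult)
  qed
  have "of_real (gauss \<alpha> z) * toeplitz \<alpha> \<mu> (\<lambda>w. fock_kernel \<alpha> w z) z
     = of_real (\<alpha> / pi) * (LINT w|\<mu>. of_real (gauss \<alpha> z) * (fock_kernel \<alpha> z w * fock_kernel \<alpha> w z * of_real (exp (- \<alpha> * (norm w)\<^sup>2))))"
    unfolding toeplitz_def integral_mult_right_zero by (simp only: mult_ac)
  then show "of_real (gauss \<alpha> z) * toeplitz \<alpha> \<mu> (\<lambda>w. fock_kernel \<alpha> w z) z
           = of_real (\<alpha> / pi * (LINT w|\<mu>. gauss \<alpha> (z - w)))"
    unfolding eq by simp
qed

definition gaussian_grid :: "nat \<Rightarrow> complex set" where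
  "gaussian_grid n = (\<lambda>(k, l). Complex (of_int k) (of_int l)) ` ({- int n..int n} \<times> {- int n..int n})"

lemma unit_separated_gaussian_grid: "unit_separated (gaussian_grid n)"
  unfolding unit_separated_def
proof (intro conjI ballI impI)
  show "finite (gaussian_grid n)" by (simp add: gaussian_grid_def)
  fix z w assume zw: "z \<in> gaussian_grid n" "w \<in> gaussian_grid n" "z \<noteq> w"
  then obtain k l k' l' where eq: "z = Complex (of_int k) (of_int l)" "w = Complex (of_int k') (of_int l')"
    by (auto simp: gaussian_grid_def)
  have "1 \<le> \<bar>Re (z - w)\<bar> \<or> 1 \<le> \<bar>Im (z - w)\<bar>"
  proof -
    have "k \<noteq> k' \<or> l \<noteq> l'" using zw(3) eq by auto
    then have "1 \<le> \<bar>k - k'\<bar> \<or> 1 \<le> \<bar>l - l'\<bar>" by linarith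
    then have "1 \<le> \<bar>real_of_int (k - k')\<bar> \<or> 1 \<le> \<bar>real_of_int (l - l')\<bar>"
      by (metis of_int_1_le_iff of_int_abs)
    then show ?thesis by (simp add: eq)
  qed
  then show "1 \<le> dist z w"
    using abs_Re_le_cmod[of "z - w"] abs_Im_le_cmod[of "z - w"] by (auto simp: dist_norm)
qed

lemma gaussian_grid_near:
  assumes "\<bar>Re w\<bar> \<le> real n" "\<bar>Im w\<bar> \<le> real n"
  obtains z where "z \<in> gaussian_grid n" "(norm (z - w))\<^sup>2 \<le> 2"
proof
  let ?z = "Complex (of_int \<lfloor>Re w\<rfloor>) (of_int \<lfloor>Im w\<rfloor>)"
  have "- int n \<le> \<lfloor>x\<rfloor>" "\<lfloor>x\<rfloor> \<le> int n" if "\<bar>x\<bar> \<le> real n" for x :: real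
    using that by (simp_all add: le_floor_iff floor_le_iff)
  then show "?z \<in> gaussian_grid n"
    using assms by (auto simp: gaussian_grid_def)
  have 1: "(of_int \<lfloor>x\<rfloor> - x)\<^sup>2 \<le> 1" for x :: real
  proof -
    have "\<bar>of_int \<lfloor>x\<rfloor> - x\<bar> \<le> \<bar>1\<bar>" by linarith
    then show ?thesis using abs_le_square_iff[of "of_int \<lfloor>x\<rfloor> - x" 1] by simp
  qed
  show "(norm (?z - w))\<^sup>2 \<le> 2"
    using 1[of "Re w"] 1[of "Im w"] by (simp add: cmod_power2)
qed

text \<open>Every point of the square of side \<open>2 n\<close> lies in a unit square with lower left corner in the grid, so
  the sum of Gaussians there is at least \<open>exp(-2 \<alpha>)\<close>.\<close>

lemma emeasure_le_of_grid_sums: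
  assumes "\<alpha> > 0" and \<mu>: "admissible_measure \<alpha> \<mu>"
    and bound: "\<And>n. (\<Sum>z\<in>gaussian_grid n. LINT w|\<mu>. gauss \<alpha> (z - w)) \<le> B"
  shows "emeasure \<mu> UNIV \<le> ennreal (exp (2 * \<alpha>) * B)"
proof -
  have sets: "sets \<mu> = sets borel" using \<mu> by (simp add: admissible_measure_def)
  define S where "S n = {w. \<bar>Re w\<bar> \<le> real n \<and> \<bar>Im w\<bar> \<le> real n}" for n
  have S_sets: "S n \<in> sets \<mu>" for n
  proof -
    have "closed (S n)"
      unfolding S_def by (intro closed_Collect_conj closed_Collect_le continuous_intros)
    then show ?thesis by (simp add: sets)
  qed
  have fin: "finite (gaussian_grid n)" for n
    using unit_separated_gaussian_grid by (simp add: unit_separated_def)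
  have le: "emeasure \<mu> (S n) \<le> ennreal (exp (2 * \<alpha>) * B)" for n
  proof -
    have "emeasure \<mu> (S n) = (\<integral>\<^sup>+w. indicator (S n) w \<partial>\<mu>)"
      using S_sets by simp
    also have "\<dots> \<le> (\<integral>\<^sup>+w. ennreal (exp (2 * \<alpha>) * (\<Sum>z\<in>gaussian_grid n. gauss \<alpha> (z - w))) \<partial>\<mu>)"
    proof (rule nn_integral_mono)
      fix w
      have "1 \<le> exp (2 * \<alpha>) * (\<Sum>z\<in>gaussian_grid n. gauss \<alpha> (z - w))" if w: "w \<in> S n"
      proof -
        obtain z where z: "z \<in> gaussian_grid n" "(norm (z - w))\<^sup>2 \<le> 2"
          using gaussian_grid_near[of w n] w by (auto simp: S_def)
        have "\<alpha> * (norm (z - w))\<^sup>2 \<le> \<alpha> * 2"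
          using z(2) assms(1) by (intro mult_left_mono) auto
        then have "1 \<le> exp (2 * \<alpha>) * gauss \<alpha> (z - w)"
          by (simp add: gauss_def flip: exp_add)
        also have "\<dots> \<le> exp (2 * \<alpha>) * (\<Sum>z\<in>gaussian_grid n. gauss \<alpha> (z - w))"
          by (intro mult_left_mono member_le_sum z fin) auto
        finally show ?thesis .
      qed
      then show "indicator (S n) w \<le> ennreal (exp (2 * \<alpha>) * (\<Sum>z\<in>gaussian_grid n. gauss \<alpha> (z - w)))"
        by (cases "w \<in> S n") (auto simp flip: ennreal_1 intro!: ennreal_leI)
    qed
    also have "\<dots> = ennreal (LINT w|\<mu>. exp (2 * \<alpha>) * (\<Sum>z\<in>gaussian_grid n. gauss \<alpha> (z - w)))"
      using toeplitz_kernel_diagonal(1)[OF \<mu>]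
      by (intro nn_integral_eq_integral AE_I2 mult_nonneg_nonneg sum_nonneg) auto
    also have "\<dots> \<le> ennreal (exp (2 * \<alpha>) * B)"
      using toeplitz_kernel_diagonal(1)[OF \<mu>] bound[of n] by (intro ennreal_leI) simp
    finally show ?thesis .
  qed
  have "incseq S" by (auto simp: incseq_def S_def)
  moreover have "(\<Union>n. S n) = UNIV"
  proof -
    have "w \<in> S (nat \<lceil>norm w\<rceil>)" for w
      unfolding S_def mem_Collect_eq
      by (meson abs_Re_le_cmod abs_Im_le_cmod real_nat_ceiling_ge order_trans)
    then show ?thesis by blast
  qed
  ultimately have "(SUP n. emeasure \<mu> (S n)) = emeasure \<mu> UNIV"
    using SUP_emeasure_incseq[of S \<mu>] S_sets by auto
  then show ?thesis using le by (metis SUP_least)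
qed

lemma (in gaussian_space) emeasure_le_nuclear_sum:
  assumes Y: "gaussian_space \<alpha> Y" and sampling: "sampling_bounded \<alpha> X Y"
  obtains C where "C > 0"
    "\<And>\<mu> T \<phi> y. admissible_measure \<alpha> \<mu> \<Longrightarrow> T \<in> nuclear_toeplitz_extensions \<alpha> \<mu> X Y \<Longrightarrow>
       nuclear_rep X Y T \<phi> y \<Longrightarrow>
       emeasure \<mu> UNIV \<le> ennreal (C * (\<Sum>j. dual_norm X (\<phi> j) * nrm Y (y j)))"
proof -
  interpret Y: gaussian_space \<alpha> Y by fact
  obtain C where C: "\<And>A y. unit_separated A \<Longrightarrow> y \<in> carr Y \<Longrightarrow> nrm X (sampled_kernel_sum \<alpha> A y) \<le> C * nrm Y y"
    using sampling unfolding sampling_bounded_def by blast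
  define D where "D = max 1 C"
  have D: "D > 0" "\<And>A y. unit_separated A \<Longrightarrow> y \<in> carr Y \<Longrightarrow> nrm X (sampled_kernel_sum \<alpha> A y) \<le> D * nrm Y y"
  proof -
    show "D > 0" by (simp add: D_def)
    fix A y assume "unit_separated A" "y \<in> carr Y"
    then show "nrm X (sampled_kernel_sum \<alpha> A y) \<le> D * nrm Y y"
      using C mult_right_mono[OF max.cobounded2[of C 1] Y.nrm_nonneg] unfolding D_def by (meson order_trans)
  qed
  show ?thesis
  proof (rule that[of "exp (2 * \<alpha>) * (pi / \<alpha> * D)"])
    show "exp (2 * \<alpha>) * (pi / \<alpha> * D) > 0" using D(1) alpha_pos by simp
    fix \<mu> T \<phi> y
    assume \<mu>: "admissible_measure \<alpha> \<mu>" and T: "T \<in> nuclear_toeplitz_extensions \<alpha> \<mu> X Y"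
      and rep: "nuclear_rep X Y T \<phi> y"
    let ?N = "\<Sum>j. dual_norm X (\<phi> j) * nrm Y (y j)"
    have bT: "bounded_operator X Y T"
      using T by (simp add: nuclear_toeplitz_extensions_def nuclear_def)
    have TK: "T (\<lambda>w. fock_kernel \<alpha> w z) = toeplitz \<alpha> \<mu> (\<lambda>w. fock_kernel \<alpha> w z)" for z
      using T kernel_in_span by (simp add: nuclear_toeplitz_extensions_def)
    have "(\<Sum>z\<in>gaussian_grid n. LINT w|\<mu>. gauss \<alpha> (z - w)) \<le> pi / \<alpha> * D * ?N" for n
    proof -
      have nn: "0 \<le> (LINT w|\<mu>. gauss \<alpha> (z - w))" for z
        by (intro integral_nonneg_AE) simp
      have "(\<Sum>z\<in>gaussian_grid n. of_real (gauss \<alpha> z) * T (\<lambda>w. fock_kernel \<alpha> w z) z)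
          = complex_of_real (\<alpha> / pi * (\<Sum>z\<in>gaussian_grid n. LINT w|\<mu>. gauss \<alpha> (z - w)))"
        unfolding TK toeplitz_kernel_diagonal(2)[OF \<mu>] by (simp add: sum_distrib_left)
      then have "norm (complex_of_real (\<alpha> / pi * (\<Sum>z\<in>gaussian_grid n. LINT w|\<mu>. gauss \<alpha> (z - w)))) \<le> D * ?N"
        using kernel_trace_le[OF Y bT rep less_imp_le[OF D(1)] D(2)[OF unit_separated_gaussian_grid], of n]
        by simp
      moreover have "0 \<le> \<alpha> / pi * (\<Sum>z\<in>gaussian_grid n. LINT w|\<mu>. gauss \<alpha> (z - w))"
        using alpha_pos nn by (intro mult_nonneg_nonneg sum_nonneg) auto
      ultimately have "\<alpha> / pi * (\<Sum>z\<in>gaussian_grid n. LINT w|\<mu>. gauss \<alpha> (z - w)) \<le> D * ?N"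
        by (simp only: norm_of_real abs_of_nonneg)
      then show ?thesis using alpha_pos by (simp add: field_simps)
    qed
    from emeasure_le_of_grid_sums[OF alpha_pos \<mu> this]
    show "emeasure \<mu> UNIV \<le> ennreal (exp (2 * \<alpha>) * (pi / \<alpha> * D) * ?N)"
      by (simp add: mult.assoc)
  qed
qed

section \<open>Nuclear Toeplitz operators\<close>

text \<open>Both statements for a general domain with total kernels and a general Fock space as target. The
  lower bound holds for every representation of every extension, whereas the upper bound uses the
  explicit representation of the integral operator, to which every extension is equal.\<close>

proposition (in dilation_continuous_space) toeplitz_nuclear_iff_finite:
  assumes s: "1 \<le> s" and sampling: "sampling_bounded \<alpha> X (fock \<alpha> s)"
  shows "admissible_measure \<alpha> \<mu> \<Longrightarrow>
      nuclear_toeplitz_extensions \<alpha> \<mu> X (fock \<alpha> s) \<noteq> {} \<longleftrightarrow> emeasure \<mu> UNIV < \<infinity>"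
    and "\<exists>c1 > 0. \<exists>c2 > 0. \<forall>\<mu>. admissible_measure \<alpha> \<mu> \<longrightarrow>
      (\<forall>T \<in> nuclear_toeplitz_extensions \<alpha> \<mu> X (fock \<alpha> s).
         c1 * measure \<mu> UNIV \<le> nuclear_norm X (fock \<alpha> s) T \<and>
         nuclear_norm X (fock \<alpha> s) T \<le> c2 * measure \<mu> UNIV)"
proof -
  let ?Y = "fock \<alpha> s"
  have Ysp: "gaussian_space \<alpha> ?Y" using fock_gaussian_space[OF alpha_pos s] .
  interpret Y: gaussian_space \<alpha> ?Y by fact
  obtain C where C: "C > 0"
    "\<And>\<mu> T \<phi> y. admissible_measure \<alpha> \<mu> \<Longrightarrow> T \<in> nuclear_toeplitz_extensions \<alpha> \<mu> X ?Y \<Longrightarrow>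
       nuclear_rep X ?Y T \<phi> y \<Longrightarrow>
       emeasure \<mu> UNIV \<le> ennreal (C * (\<Sum>j. dual_norm X (\<phi> j) * nrm ?Y (y j)))"
    using emeasure_le_nuclear_sum[OF Ysp sampling] by metis
  obtain D where D: "D > 0"
    "\<And>\<mu>. finite_borel_measure \<mu> \<Longrightarrow>
       bounded_operator X ?Y (toeplitz \<alpha> \<mu>) \<and>
       (\<exists>\<phi> y. nuclear_rep X ?Y (toeplitz \<alpha> \<mu>) \<phi> y \<and>
          (\<Sum>j. dual_norm X (\<phi> j) * nrm ?Y (y j)) \<le> D * measure \<mu> UNIV)"
    using toeplitz_nuclear_rep[OF s] by metis
  have fin: "finite_borel_measure \<mu>" if "admissible_measure \<alpha> \<mu>" "emeasure \<mu> UNIV < \<infinity>" for \<mu>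
  proof -
    have sets: "sets \<mu> = sets borel" using that(1) by (simp add: admissible_measure_def)
    then have "space \<mu> = UNIV" using sets_eq_imp_space_eq[OF sets] by simp
    then have "finite_measure \<mu>"
      using that(2) by (intro finite_measureI) simp
    then show ?thesis
      using sets by (intro finite_borel_measure.intro finite_borel_measure_axioms.intro)
  qed
  have nonneg: "0 \<le> (\<Sum>j. dual_norm X (\<phi> j) * nrm ?Y (y j))" if "nuclear_rep X ?Y T \<phi> y" for T \<phi> y
    using that dual_norm_nonneg Y.nrm_nonneg by (intro suminf_nonneg) (auto simp: nuclear_rep_def)
  have finite: "emeasure \<mu> UNIV < \<infinity>"
    if \<mu>: "admissible_measure \<alpha> \<mu>" and T: "T \<in> nuclear_toeplitz_extensions \<alpha> \<mu> X ?Y" for \<mu> T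
  proof -
    obtain \<phi> y where "nuclear_rep X ?Y T \<phi> y"
      using T by (auto simp: nuclear_toeplitz_extensions_def nuclear_def)
    from C(2)[OF \<mu> T this] show ?thesis by (simp add: le_less_trans)
  qed
  show "nuclear_toeplitz_extensions \<alpha> \<mu> X ?Y \<noteq> {} \<longleftrightarrow> emeasure \<mu> UNIV < \<infinity>"
    if \<mu>: "admissible_measure \<alpha> \<mu>"
  proof
    assume "emeasure \<mu> UNIV < \<infinity>"
    then have "toeplitz \<alpha> \<mu> \<in> nuclear_toeplitz_extensions \<alpha> \<mu> X ?Y"
      using D(2)[OF fin[OF \<mu>]] by (auto simp: nuclear_toeplitz_extensions_def nuclear_def)
    then show "nuclear_toeplitz_extensions \<alpha> \<mu> X ?Y \<noteq> {}" by blast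
  qed (use finite[OF \<mu>] in blast)
  have two_sided: "1 / C * measure \<mu> UNIV \<le> nuclear_norm X ?Y T \<and> nuclear_norm X ?Y T \<le> D * measure \<mu> UNIV"
    if \<mu>: "admissible_measure \<alpha> \<mu>" and T: "T \<in> nuclear_toeplitz_extensions \<alpha> \<mu> X ?Y" for \<mu> T
  proof
    have fm: "finite_borel_measure \<mu>" using fin[OF \<mu> finite[OF \<mu> T]] .
    interpret finite_borel_measure \<mu> by fact
    let ?R = "{(\<Sum>j. dual_norm X (\<phi> j) * nrm ?Y (y j)) | \<phi> y. nuclear_rep X ?Y T \<phi> y}"
    have bT: "bounded_operator X ?Y T" and ne: "?R \<noteq> {}"
      using T by (auto simp: nuclear_toeplitz_extensions_def nuclear_def)
    have "1 / C * measure \<mu> UNIV \<le> r" if "r \<in> ?R" for r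
    proof -
      from that obtain \<phi> y where rep: "nuclear_rep X ?Y T \<phi> y"
        and r: "r = (\<Sum>j. dual_norm X (\<phi> j) * nrm ?Y (y j))" by blast
      have "ennreal (measure \<mu> UNIV) \<le> ennreal (C * r)"
        using C(2)[OF \<mu> T rep] by (simp add: r emeasure_eq_measure)
      then have "measure \<mu> UNIV \<le> C * r"
        using nonneg[OF rep] C(1) by (simp add: r)
      then show ?thesis using C(1) by (simp add: field_simps)
    qed
    then show "1 / C * measure \<mu> UNIV \<le> nuclear_norm X ?Y T"
      unfolding nuclear_norm_def by (intro cInf_greatest ne) auto
    obtain \<phi> y where rep: "nuclear_rep X ?Y (toeplitz \<alpha> \<mu>) \<phi> y"
      "(\<Sum>j. dual_norm X (\<phi> j) * nrm ?Y (y j)) \<le> D * measure \<mu> UNIV"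
      and bt: "bounded_operator X ?Y (toeplitz \<alpha> \<mu>)"
      using D(2)[OF fm] by blast
    have "T f = toeplitz \<alpha> \<mu> f" if "f \<in> carr X" for f
      using T by (intro bounded_extension_unique[OF Ysp bT bt _ that]) (simp add: nuclear_toeplitz_extensions_def)
    then have "nuclear_rep X ?Y T \<phi> y"
      using rep(1) by (simp add: nuclear_rep_def)
    then have "(\<Sum>j. dual_norm X (\<phi> j) * nrm ?Y (y j)) \<in> ?R" by blast
    moreover have "bdd_below ?R" using nonneg by (intro bdd_belowI[of _ 0]) auto
    ultimately have "nuclear_norm X ?Y T \<le> (\<Sum>j. dual_norm X (\<phi> j) * nrm ?Y (y j))"
      unfolding nuclear_norm_def by (rule cInf_lower)
    then show "nuclear_norm X ?Y T \<le> D * measure \<mu> UNIV" using rep(2) by simp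
  qed
  have "1 / C > 0" using C(1) by simp
  with D(1) two_sided show "\<exists>c1 > 0. \<exists>c2 > 0. \<forall>\<mu>. admissible_measure \<alpha> \<mu> \<longrightarrow>
      (\<forall>T \<in> nuclear_toeplitz_extensions \<alpha> \<mu> X ?Y.
         c1 * measure \<mu> UNIV \<le> nuclear_norm X ?Y T \<and>
         nuclear_norm X ?Y T \<le> c2 * measure \<mu> UNIV)"
    by blast
qed

theorem theorem1p1:
  fixes \<alpha> p q :: real and s :: ereal
  assumes "\<alpha> > 0" and "1 \<le> q" and "q \<le> p" and "1 \<le> s"
  shows
    "(\<forall>\<mu>. admissible_measure \<alpha> \<mu> \<longrightarrow>
        (nuclear_toeplitz_extensions \<alpha> \<mu> (fock \<alpha> (ereal p)) (fock \<alpha> (ereal q)) \<noteq> {} \<longleftrightarrow>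
           emeasure \<mu> UNIV < \<infinity>) \<and>
        (nuclear_toeplitz_extensions \<alpha> \<mu> (fock_inf0 \<alpha>) (fock \<alpha> s) \<noteq> {} \<longleftrightarrow>
           emeasure \<mu> UNIV < \<infinity>)) \<and>
     (\<exists>c1 > 0. \<exists>c2 > 0. \<forall>\<mu>. admissible_measure \<alpha> \<mu> \<longrightarrow>
        (\<forall>T \<in> nuclear_toeplitz_extensions \<alpha> \<mu> (fock \<alpha> (ereal p)) (fock \<alpha> (ereal q)).
           c1 * measure \<mu> UNIV \<le> nuclear_norm (fock \<alpha> (ereal p)) (fock \<alpha> (ereal q)) T \<and>
           nuclear_norm (fock \<alpha> (ereal p)) (fock \<alpha> (ereal q)) T \<le> c2 * measure \<mu> UNIV) \<and>
        (\<forall>T \<in> nuclear_toeplitz_extensions \<alpha> \<mu> (fock_inf0 \<alpha>) (fock \<alpha> s).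
           c1 * measure \<mu> UNIV \<le> nuclear_norm (fock_inf0 \<alpha>) (fock \<alpha> s) T \<and>
           nuclear_norm (fock_inf0 \<alpha>) (fock \<alpha> s) T \<le> c2 * measure \<mu> UNIV))"
proof -
  have q: "1 \<le> ereal q" and p: "1 \<le> p" using assms by (auto simp: one_ereal_def)
  have eq: "fock \<alpha> (ereal r) = fock_fin \<alpha> r" for r by (simp add: fock_def)
  have "dilation_continuous_space \<alpha> (fock \<alpha> (ereal p))"
    unfolding eq by (rule fock_fin_dilation_continuous[OF assms(1) p])
  then interpret P: dilation_continuous_space \<alpha> "fock \<alpha> (ereal p)" .
  interpret Z: dilation_continuous_space \<alpha> "fock_inf0 \<alpha>"
    using fock_inf0_dilation_continuous[OF assms(1)] .
  have sp: "sampling_bounded \<alpha> (fock \<alpha> (ereal p)) (fock \<alpha> (ereal q))"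
    unfolding eq by (rule sampling_bounded_fock_fin[OF assms(1-3)])
  note P = P.toeplitz_nuclear_iff_finite[OF q sp]
  note Z = Z.toeplitz_nuclear_iff_finite[OF assms(4) sampling_bounded_fock_inf0[OF assms(1,4)]]
  obtain a1 a2 where a: "a1 > 0" "a2 > 0"
    "\<And>\<mu> T. admissible_measure \<alpha> \<mu> \<Longrightarrow> T \<in> nuclear_toeplitz_extensions \<alpha> \<mu> (fock \<alpha> (ereal p)) (fock \<alpha> (ereal q)) \<Longrightarrow>
       a1 * measure \<mu> UNIV \<le> nuclear_norm (fock \<alpha> (ereal p)) (fock \<alpha> (ereal q)) T \<and>
       nuclear_norm (fock \<alpha> (ereal p)) (fock \<alpha> (ereal q)) T \<le> a2 * measure \<mu> UNIV"
    using P(2) by blast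
  obtain b1 b2 where b: "b1 > 0" "b2 > 0"
    "\<And>\<mu> T. admissible_measure \<alpha> \<mu> \<Longrightarrow> T \<in> nuclear_toeplitz_extensions \<alpha> \<mu> (fock_inf0 \<alpha>) (fock \<alpha> s) \<Longrightarrow>
       b1 * measure \<mu> UNIV \<le> nuclear_norm (fock_inf0 \<alpha>) (fock \<alpha> s) T \<and>
       nuclear_norm (fock_inf0 \<alpha>) (fock \<alpha> s) T \<le> b2 * measure \<mu> UNIV"
    using Z(2) by blast
  have lo: "min a1 b1 * measure \<mu> UNIV \<le> a1 * measure \<mu> UNIV" "min a1 b1 * measure \<mu> UNIV \<le> b1 * measure \<mu> UNIV"
    and hi: "a2 * measure \<mu> UNIV \<le> max a2 b2 * measure \<mu> UNIV" "b2 * measure \<mu> UNIV \<le> max a2 b2 * measure \<mu> UNIV"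
    for \<mu> :: "complex measure"
    by (intro mult_right_mono; simp)+
  show ?thesis
  proof (intro conjI allI impI)
    fix \<mu> assume "admissible_measure \<alpha> \<mu>"
    then show "(nuclear_toeplitz_extensions \<alpha> \<mu> (fock \<alpha> (ereal p)) (fock \<alpha> (ereal q)) \<noteq> {}) = (emeasure \<mu> UNIV < \<infinity>)"
      "(nuclear_toeplitz_extensions \<alpha> \<mu> (fock_inf0 \<alpha>) (fock \<alpha> s) \<noteq> {}) = (emeasure \<mu> UNIV < \<infinity>)"
      using P(1)[of \<mu>] Z(1)[of \<mu>] by simp_all
  next
    have "min a1 b1 > 0" "max a2 b2 > 0" using a b by auto
    moreover have "min a1 b1 * measure \<mu> UNIV \<le> nuclear_norm (fock \<alpha> (ereal p)) (fock \<alpha> (ereal q)) T \<and>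
        nuclear_norm (fock \<alpha> (ereal p)) (fock \<alpha> (ereal q)) T \<le> max a2 b2 * measure \<mu> UNIV"
      if "admissible_measure \<alpha> \<mu>"
        "T \<in> nuclear_toeplitz_extensions \<alpha> \<mu> (fock \<alpha> (ereal p)) (fock \<alpha> (ereal q))" for \<mu> T
      using a(3)[OF that] lo(1)[of \<mu>] hi(1)[of \<mu>] by linarith
    moreover have "min a1 b1 * measure \<mu> UNIV \<le> nuclear_norm (fock_inf0 \<alpha>) (fock \<alpha> s) T \<and>
        nuclear_norm (fock_inf0 \<alpha>) (fock \<alpha> s) T \<le> max a2 b2 * measure \<mu> UNIV"
      if "admissible_measure \<alpha> \<mu>" "T \<in> nuclear_toeplitz_extensions \<alpha> \<mu> (fock_inf0 \<alpha>) (fock \<alpha> s)" for \<mu> T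
      using b(3)[OF that] lo(2)[of \<mu>] hi(2)[of \<mu>] by linarith
    ultimately show "\<exists>c1 > 0. \<exists>c2 > 0. \<forall>\<mu>. admissible_measure \<alpha> \<mu> \<longrightarrow>
        (\<forall>T \<in> nuclear_toeplitz_extensions \<alpha> \<mu> (fock \<alpha> (ereal p)) (fock \<alpha> (ereal q)).
           c1 * measure \<mu> UNIV \<le> nuclear_norm (fock \<alpha> (ereal p)) (fock \<alpha> (ereal q)) T \<and>
           nuclear_norm (fock \<alpha> (ereal p)) (fock \<alpha> (ereal q)) T \<le> c2 * measure \<mu> UNIV) \<and>
        (\<forall>T \<in> nuclear_toeplitz_extensions \<alpha> \<mu> (fock_inf0 \<alpha>) (fock \<alpha> s).
           c1 * measure \<mu> UNIV \<le> nuclear_norm (fock_inf0 \<alpha>) (fock \<alpha> s) T \<and>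
           nuclear_norm (fock_inf0 \<alpha>) (fock \<alpha> s) T \<le> c2 * measure \<mu> UNIV)"
      by blast
  qed
qed

end
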